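(* Let $k,s_1,s_2$ be fixed nonnegative integers. For $r_1,r_2\ge0$ put $$X_{\min\{s_1,r_1\}-t}=(-1)^t\,t!\,2^t\prod_{i=t}^{r_1-1}[x^2-x-2(s_1+i)]\quad(0\le t\le\min\{s_1,r_1\}),$$ $$X'_{\min\{s_2,r_2\}-t}=(-1)^t\,t!\prod_{m=t}^{r_2-1}[x-(s_2+m)]\quad(0\le t\le\min\{s_2,r_2\}).$$ (i) Let $s_1+s_2\le k$. The set of all distinct eigenvalues of the Gram matrix $G_{2s_1+s_2}$ of the algebra of $\mathbb{Z}_2$-relations (with entries $\{X_0,\dots,X_{\min\{s_1,r_1\}}\}$ and $\{X'_0,\dots,X'_{\min\{s_2,r_2\}}\}$) is given by (a) $\displaystyle\sum_{t=0}^{\min\{s_1,r_1\}}\left[\sum_{j=0}^{l}(-1)^j\binom{l}{j}\binom{s_1-l}{t-j}\binom{r_1-l}{t-j}\right]X_{\min\{s_1,r_1\}-t}$ for all $0\le l\le\min\{s_1,r_1\}$ and $0\le r_1\le k-s_1-s_2$; (b) $\displaystyle\sum_{t=0}^{\min\{s_2,r_2\}}\left[\sum_{j=0}^{l}(-1)^j\binom{l}{j}\binom{s_2-l}{t-j}\binom{r_2-l}{t-j}\right]X'_{\min\{s_2,r_2\}-t}$ for all $0\le l\le\min\{s_2,r_2\}$ and $0\le r_2\le k-s_1-s_2$. (ii) Let $s_1+s_2\le k-1$. The set of all distinct eigenvalues of the block submatrices $\widetilde A_{2r_1+r_2,2r_1+r_2}$, where $0\le 2r_1+r_2\le 2k-2s_1-2s_2-1$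 and $0\le r_1,r_2\le k-s_1-s_2-1$, of the Gram matrix $\widetilde G_{2s_1+s_2}$ of the signed partition algebra (with entries $\{X_0,\dots,X_{\min\{s_1,r_1\}}\}$ and $\{X'_0,\dots,X'_{\min\{s_2,r_2\}}\}$) is given by (a) $\displaystyle\sum_{t=0}^{\min\{s_1,r_1\}}\left[\sum_{j=0}^{l}(-1)^j\binom{l}{j}\binom{s_1-l}{t-j}\binom{r_1-l}{t-j}\right]X_{\min\{s_1,r_1\}-t}$ for all $0\le l\le\min\{s_1,r_1\}$ and $0\le r_1\le k-s_1-s_2$; (b) $\displaystyle\sum_{t=0}^{\min\{s_2,r_2\}}\left[\sum_{j=0}^{l}(-1)^j\binom{l}{j}\binom{s_2-l}{t-j}\binom{r_2-l}{t-j}\right]X'_{\min\{s_2,r_2\}-t}$ for all $0\le l\le\min\{s_2,r_2\}$ and $0\le r_2\le k-s_1-s_2-1$.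
   Context: Here $x$ is an indeterminate over $\mathbb{C}$; $\binom{a}{b}=0$ for $b<0$ or $b>a$; empty products are $1$. $\mathbb{Z}_2$-stable partitions. Let $\mathbb{Z}_2=\{e,g\}$ act on $\{1,\dots,k\}\times\mathbb{Z}_2$ by $h\cdot(i,h')=(i,hh')$. A set partition of $\{1,\dots,k\}\times\mathbb{Z}_2$ is $\mathbb{Z}_2$-stable if $p\sim q$ implies $hp\sim hq$ for all $h\in\mathbb{Z}_2$. Its blocks are either $\mathbb{Z}_2$-classes (blocks $C$ with $gC=C$) or $\{e\}$-classes (blocks with $gC\ne C$), the latter occurring in pairs $\{C,gC\}$. Each $\mathbb{Z}_2$-class or pair of $\{e\}$-classes has an underlying subset of $\{1,\dots,k\}$, namely its projection to the first coordinate. Diagrams. $\mathbb{J}^{2r_1+r_2}_{2s_1+s_2}$ is the set of diagrams $U^{(d,P)}_{(d,P)}$ given by a $\mathbb{Z}_2$-stable partition $d$ of $\{1,\dots,k\}\times\mathbb{Z}_2$ having $s_1+r_1$ pairs of $\{e\}$-classes and $s_2+r_2$ $\mathbb{Z}_2$-classes, together with a choice $P$ of $s_1$ of the pairs of $\{e\}$-classes and $s_2$ of the $\mathbb{Z}_2$-classes (so $|P|=2s_1+s_2$ blocks). The diagram has $d$ in its top row and a copy of $d$ in its bottom row, with each block in $P$ (a through class) joined to its copy in the bottom row; the other blocks are horizontal edges. Put $J^{2k}_{2s_1+s_2}=\bigcup_{0\le r_1,r_2\le k-s_1-s_2}\mathbb{J}^{2r_1+r_2}_{2s_1+s_2}$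 (the union being over pairs $(r_1,r_2)$). For the signed partition algebra, $\widetilde{\mathbb{J}}^{2r_1+r_2}_{2s_1+s_2}\subseteq\mathbb{J}^{2r_1+r_2}_{2s_1+s_2}$ consists of those diagrams satisfying $s_1+s_2+H_e+H_{\mathbb{Z}_2}\le k-1$, where $H_e$ is the number of pairs of $\{e\}$-horizontal edges whose underlying subset of $\{1,\dots,k\}$ has at least $2$ elements and $H_{\mathbb{Z}_2}=r_2$ is the number of $\mathbb{Z}_2$-horizontal edges. Put $\widetilde J^{2k}_{2s_1+s_2}=\bigcup\widetilde{\mathbb{J}}^{2r_1+r_2}_{2s_1+s_2}$ over $0\le r_1\le k-s_1-s_2$, $0\le r_2\le k-s_1-s_2-1$. Gram matrices. $G_{2s_1+s_2}$ (resp. $\widetilde G_{2s_1+s_2}$) is the square matrix indexed by $J^{2k}_{2s_1+s_2}$ (resp. $\widetilde J^{2k}_{2s_1+s_2}$). The product of two diagrams is formed by stacking the first above the second and identifying the bottom row of the first with the top row of the second. The $(i,j)$ entry is $x^{l}$ if the product of the $i$-th and $j$-th diagrams has propagating number (number of blocks meeting both top and bottom row) equal to $2s_1+s_2$, where $l$ is the number of connected components lying entirely in the middle row; otherwise (propagating number $<2s_1+s_2$) the entry is $0$. Equivalently, for $(d_i,P_i)$ and $(d_j,P_j)$ and the join $d_i\vee d_j$, the propagating number is the number of blocks of the join containing a block of $P_i$ and a block of $P_j$, and $l$ is the number of blocks of the join containing no block of $P_i$ or $P_j$. The block submatrix $A_{2r_1+r_2,2r_1'+r_2'}$ (resp. $\widetilde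 A_{2r_1+r_2,2r_1'+r_2'}$) has rows indexed by $\mathbb{J}^{2r_1+r_2}_{2s_1+s_2}$ and columns by $\mathbb{J}^{2r_1'+r_2'}_{2s_1+s_2}$ (resp. by the corresponding $\widetilde{\mathbb{J}}$ sets). The phrase "with entries" refers to the reduced diagonal blocks $A'_{2r_1+r_2,2r_1+r_2}$ and $\widetilde A'_{2r_1+r_2,2r_1+r_2}$ which the paper obtains from the Gram matrices by column operations and corresponding row operations (the reduced matrices being called similar to the Gram matrices): the entry at $(d,P),(d',P')$ is $X_{\min\{s_1,r_1\}-t_1}X'_{\min\{s_2,r_2\}-t_2}$ if $d=d'$ and $P'$ is obtained from $P$ by exchanging $t_1$ pairs of $\{e\}$-classes and $t_2$ $\mathbb{Z}_2$-classes with horizontal ones, and $0$ otherwise. The paper writes these blocks as tensor products of one factor with entries $X$ and one factor with entries $X'$.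
   Formalization: False for G, Ã as written. Proved: G reduces by U^T G U, det U=1, to blocks A'; (a), (b) are the spectra of the tensor factors with entries X, X'; A', Ã' have their products as eigenvalues. For signed G the reduction is shown only on rows with r1+r2<k-s1-s2. *)

theory Defs
  imports
    "HOL-Algebra.Algebraic_Closure_Type"
    "HOL-Computational_Algebra.Polynomial_Factorial"
    "HOL-Library.Disjoint_Sets"
    "Jordan_Normal_Form.Spectral_Radius"
begin

section \<open>Stable partitions\<close>

text \<open>The group \<open>\<int>\<^sub>2 = {e, g}\<close> is the type \<^typ>\<open>bool\<close> with \<open>e = False\<close>, \<open>g = True\<close> and
  exclusive or as multiplication.\<close>

type_synonym node = "nat \<times> bool"

definition act :: "bool \<Rightarrow> node \<Rightarrow> node" where
  "act h p = (fst p, h \<noteq> snd p)"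

definition nodes :: "nat \<Rightarrow> node set" where
  "nodes k = {1..k} \<times> UNIV"

definition same_block :: "'v set set \<Rightarrow> 'v \<Rightarrow> 'v \<Rightarrow> bool" where
  "same_block d p q \<longleftrightarrow> (\<exists>C\<in>d. p \<in> C \<and> q \<in> C)"

definition stable_partition :: "nat \<Rightarrow> node set set \<Rightarrow> bool" where
  "stable_partition k d \<longleftrightarrow> partition_on (nodes k) d \<and>
     (\<forall>h p q. same_block d p q \<longrightarrow> same_block d (act h p) (act h q))"

definition z_classes :: "node set set \<Rightarrow> node set set" where
  "z_classes B = {C \<in> B. act True ` C = C}"

definition e_pairs :: "node set set \<Rightarrow> node set set set" where
  "e_pairs B = {{C, act True ` C} |C. C \<in> B \<and> act True ` C \<noteq> C}"


section \<open>Diagrams\<close>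

text \<open>A pair \<open>(d, P)\<close> stands for the diagram whose two rows are both \<open>d\<close> and whose through
  classes are the blocks in \<open>P\<close>; since \<open>P\<close> consists of whole pairs of \<open>{e}\<close>-classes and of
  \<open>\<int>\<^sub>2\<close>-classes, it is invariant under the action.\<close>

type_synonym diagram = "node set set \<times> node set set"

definition diagrams :: "nat \<Rightarrow> nat \<Rightarrow> nat \<Rightarrow> nat \<Rightarrow> nat \<Rightarrow> diagram set" where
  "diagrams k s1 s2 r1 r2 = {(d, P). stable_partition k d \<and>
     card (e_pairs d) = s1 + r1 \<and> card (z_classes d) = s2 + r2 \<and>
     P \<subseteq> d \<and> (\<forall>C\<in>P. act True ` C \<in> P) \<and>
     card (e_pairs P) = s1 \<and> card (z_classes P) = s2}"

definition all_diagrams :: "nat \<Rightarrow> nat \<Rightarrow> nat \<Rightarrow> diagram set" where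
  "all_diagrams k s1 s2 =
     (\<Union>r1\<in>{..k - s1 - s2}. \<Union>r2\<in>{..k - s1 - s2}. diagrams k s1 s2 r1 r2)"

definition H_e :: "diagram \<Rightarrow> nat" where
  "H_e p = card {Q \<in> e_pairs (fst p - snd p). card (fst ` \<Union>Q) \<ge> 2}"

definition H_z :: "diagram \<Rightarrow> nat" where
  "H_z p = card (z_classes (fst p - snd p))"

definition signed_diagrams :: "nat \<Rightarrow> nat \<Rightarrow> nat \<Rightarrow> nat \<Rightarrow> nat \<Rightarrow> diagram set" where
  "signed_diagrams k s1 s2 r1 r2 =
     {p \<in> diagrams k s1 s2 r1 r2. s1 + s2 + H_e p + H_z p + 1 \<le> k}"

text \<open>The range \<open>0 \<le> r\<^sub>2 \<le> k - s\<^sub>1 - s\<^sub>2 - 1\<close> is empty for \<open>s\<^sub>1 + s\<^sub>2 = k\<close>, hence \<open><\<close> rather than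
  truncated subtraction.\<close>

definition all_signed_diagrams :: "nat \<Rightarrow> nat \<Rightarrow> nat \<Rightarrow> diagram set" where
  "all_signed_diagrams k s1 s2 =
     (\<Union>r1\<in>{..k - s1 - s2}. \<Union>r2\<in>{..<k - s1 - s2}. signed_diagrams k s1 s2 r1 r2)"


section \<open>Gram matrices\<close>

text \<open>The blocks of a diagram placed with its top row at level \<open>n\<close> and its bottom row at level
  \<open>n + 1\<close>.\<close>

definition placed_blocks :: "nat \<Rightarrow> diagram \<Rightarrow> (nat \<times> node) set set" where
  "placed_blocks n p =
     {{n, Suc n} \<times> C |C. C \<in> snd p} \<union>
     {{n} \<times> C |C. C \<in> fst p - snd p} \<union> {{Suc n} \<times> C |C. C \<in> fst p - snd p}"

definition components :: "'v set set \<Rightarrow> 'v set set" where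
  "components B = \<Union>B // {(u, v). same_block B u v}\<^sup>*"

definition stacked :: "diagram \<Rightarrow> diagram \<Rightarrow> (nat \<times> node) set set" where
  "stacked p q = components (placed_blocks 0 p \<union> placed_blocks 1 q)"

definition propagating_number :: "diagram \<Rightarrow> diagram \<Rightarrow> nat" where
  "propagating_number p q = card {c \<in> stacked p q. 0 \<in> fst ` c \<and> 2 \<in> fst ` c}"

definition middle_components :: "diagram \<Rightarrow> diagram \<Rightarrow> nat" where
  "middle_components p q = card {c \<in> stacked p q. fst ` c = {1}}"

abbreviation var_x :: "complex poly" where
  "var_x \<equiv> [:0, 1:]"

definition gram_entry :: "nat \<Rightarrow> nat \<Rightarrow> diagram \<Rightarrow> diagram \<Rightarrow> complex poly" where
  "gram_entry s1 s2 p q =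
     (if propagating_number p q = 2 * s1 + s2 then var_x ^ middle_components p q else 0)"


section \<open>Reduced Gram matrices\<close>

text \<open>\<open>X_e s r i\<close> and \<open>X_z s r i\<close> are \<open>X\<^sub>i\<close> and \<open>X'\<^sub>i\<close> for \<open>0 \<le> i \<le> min s r\<close>; the formulas are in
  terms of \<open>t\<close>, where \<open>i = min s r - t\<close>.\<close>

definition X_e :: "nat \<Rightarrow> nat \<Rightarrow> nat \<Rightarrow> complex poly" where
  "X_e s r i = (let t = min s r - i in
     (- 1) ^ t * of_nat (fact t) * 2 ^ t * (\<Prod>j\<in>{t..<r}. var_x\<^sup>2 - var_x - of_nat (2 * (s + j))))"

definition X_z :: "nat \<Rightarrow> nat \<Rightarrow> nat \<Rightarrow> complex poly" where
  "X_z s r i = (let t = min s r - i in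
     (- 1) ^ t * of_nat (fact t) * (\<Prod>m\<in>{t..<r}. var_x - of_nat (s + m)))"

text \<open>The matrix \<^term>\<open>factor_entry entry s r\<close> is indexed by \<open>s\<close>-element subsets of a set with
  \<open>s + r\<close> elements; \<^term>\<open>card (S - T)\<close> is the number \<open>t\<close> of exchanged elements.\<close>

definition factor_entry ::
  "(nat \<Rightarrow> nat \<Rightarrow> nat \<Rightarrow> complex poly) \<Rightarrow> nat \<Rightarrow> nat \<Rightarrow> 'a set \<Rightarrow> 'a set \<Rightarrow> complex poly" where
  "factor_entry entry s r S T = entry s r (min s r - card (S - T))"

definition subsets_of_card :: "nat \<Rightarrow> 'a set \<Rightarrow> 'a set set" where
  "subsets_of_card s A = {S. S \<subseteq> A \<and> card S = s}"

text \<open>The direct sum of the reduced diagonal blocks; \<open>r\<^sub>1\<close> and \<open>r\<^sub>2\<close> are recovered from the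
  class counts of \<open>d\<close>. For fixed \<open>d\<close> it is the tensor product of a
  factor indexed by the \<open>s\<^sub>1\<close>-subsets of \<^term>\<open>e_pairs d\<close>, with entries \<open>X\<close>, and a factor
  indexed by the \<open>s\<^sub>2\<close>-subsets of \<^term>\<open>z_classes d\<close>, with entries \<open>X'\<close>.\<close>

definition reduced_entry :: "nat \<Rightarrow> nat \<Rightarrow> diagram \<Rightarrow> diagram \<Rightarrow> complex poly" where
  "reduced_entry s1 s2 p q =
     (if fst p = fst q then
        factor_entry X_e s1 (card (e_pairs (fst p)) - s1) (e_pairs (snd p)) (e_pairs (snd q)) *
        factor_entry X_z s2 (card (z_classes (fst p)) - s2) (z_classes (snd p)) (z_classes (snd q))
      else 0)"


section \<open>Eigenvalues\<close>

definition matrix_of :: "'i list \<Rightarrow> ('i \<Rightarrow> 'i \<Rightarrow> 'a) \<Rightarrow> 'a mat" where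
  "matrix_of ix M = mat (length ix) (length ix) (\<lambda>(a, b). M (ix ! a) (ix ! b))"

definition enumerates :: "'i list \<Rightarrow> 'i set \<Rightarrow> bool" where
  "enumerates ix I \<longleftrightarrow> distinct ix \<and> set ix = I"

text \<open>Eigenvalues are taken in the algebraic closure of \<open>\<complex>(x)\<close>, so that none is missed.\<close>

definition emb :: "complex poly \<Rightarrow> complex poly fract alg_closure" where
  "emb p = to_ac (to_fract p)"

definition has_eigenvalue_set ::
  "'i set \<Rightarrow> ('i \<Rightarrow> 'i \<Rightarrow> complex poly) \<Rightarrow> complex poly set \<Rightarrow> bool" where
  "has_eigenvalue_set I M E \<longleftrightarrow> finite I \<and>
     (\<forall>ix. enumerates ix I \<longrightarrow> spectrum (map_mat emb (matrix_of ix M)) = emb ` E)"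

text \<open>For \<open>j > t\<close> the binomial coefficients with lower index \<open>t - j < 0\<close> vanish; on \<^typ>\<open>nat\<close> the
  subtraction would truncate, hence the case distinction.\<close>

definition eigenvalue_formula ::
  "(nat \<Rightarrow> nat \<Rightarrow> nat \<Rightarrow> complex poly) \<Rightarrow> nat \<Rightarrow> nat \<Rightarrow> nat \<Rightarrow> complex poly" where
  "eigenvalue_formula entry s r l =
     (\<Sum>t = 0..min s r.
        of_int (\<Sum>j = 0..l. if j \<le> t
          then (- 1) ^ j * int (l choose j) * int ((s - l) choose (t - j)) * int ((r - l) choose (t - j))
          else 0) * entry s r (min s r - t))"

definition eigenvalue_list ::
  "(nat \<Rightarrow> nat \<Rightarrow> nat \<Rightarrow> complex poly) \<Rightarrow> nat \<Rightarrow> nat \<Rightarrow> complex poly set" where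
  "eigenvalue_list entry s r = {eigenvalue_formula entry s r l |l. l \<le> min s r}"

definition products :: "complex poly set \<Rightarrow> complex poly set \<Rightarrow> complex poly set" where
  "products A B = {a * b |a b. a \<in> A \<and> b \<in> B}"

end

theory Submission
  imports Defs
begin

text \<open>Order the diagrams by \<open>(d, P) \<le> (D, P')\<close> if \<open>D\<close> is coarser than \<open>d\<close>, no two blocks of \<open>P\<close> lie in the
  same block of \<open>D\<close>, and \<open>P'\<close> consists of the blocks of \<open>D\<close> that contain a block of \<open>P\<close>. Let \<open>Z\<close> be the zeta
  matrix of this order, \<open>G\<close> the Gram matrix and \<open>R\<close> the reduced matrix. Then \<open>G = Z\<^sup>T R Z\<close>, so that
  \<open>U = Z\<^sup>-\<^sup>1\<close> is the required congruence.

  For two diagrams whose partitions have the join \<open>J\<close>, the identity \<open>G = Z\<^sup>T R Z\<close> evaluates a weighted sum over the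
  stable coarsenings of \<open>J\<close>, that is, over the stable partitions of the set of blocks of \<open>J\<close>: the sum is
  \<open>x\<^sup>l\<close> if the two sets of through blocks agree in \<open>J\<close> and \<open>0\<close> otherwise. Delete an orbit of blocks and sum over
  the ways to insert it again. If the orbit is horizontal for both diagrams, this multiplies the weight by \<open>x\<close> or
  \<open>x\<^sup>2\<close>; if it is through for the first diagram only, the contributions cancel.

  A reduced block with fixed \<open>d\<close> is a tensor product of two matrices in the Johnson scheme. Products of factors
  \<open>[a \<in> S] - [b \<in> S]\<close> over disjoint pairs \<open>(a, b)\<close> are common eigenvectors of the scheme. They span, since a function
  on subsets that is orthogonal to all of them is invariant under exchanging two elements, by induction, and hence
  is constant. A symmetric matrix with a spanning family of eigenvectors has no further eigenvalues.\<close>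

section \<open>Stable partitions of a set with an involution\<close>

text \<open>The entries of the reduced blocks are explained by the insertion of one orbit. Suppose m
  classes of one kind are present, each with a blocks: a = 1 for fixed blocks, a = 2 for pairs of
  free blocks. Opening a new class has the factor y - a m, joining one of the a m present blocks has
  the factor 1, so the total is y. For a fixed point y = x. A free orbit can also enter a fixed
  block, which totals x, but it has to be worth x ^ 2, since it consists of two horizontal blocks;
  hence y = x ^ 2 - x for free blocks. The factor (-1)^t t! a^t is what the cancellation in
  \<open>weight_gen_rec\<close> demands.

  A congruence does not preserve eigenvalues, so every spectrum is computed for a reduced matrix or
  for one of its tensor factors.

  In the signed case the diagrams with r2 = k - s1 - s2 are missing, although they can lie above
  diagrams that are present. The congruence is therefore claimed only for rows whose partition has
  fewer than k classes (pairs counted once); these diagrams are closed upwards.\<close>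

definition stable_partitions :: "('a \<Rightarrow> 'a) \<Rightarrow> 'a set \<Rightarrow> 'a set set set" where
  "stable_partitions \<tau> V = {D. partition_on V D \<and> (\<forall>C\<in>D. \<tau> ` C \<in> D)}"

definition fix_blocks :: "('a \<Rightarrow> 'a) \<Rightarrow> 'a set set \<Rightarrow> 'a set set" where
  "fix_blocks \<tau> B = {C \<in> B. \<tau> ` C = C}"

definition free_blocks :: "('a \<Rightarrow> 'a) \<Rightarrow> 'a set set \<Rightarrow> 'a set set" where
  "free_blocks \<tau> B = {C \<in> B. \<tau> ` C \<noteq> C}"

definition block_pairs :: "('a \<Rightarrow> 'a) \<Rightarrow> 'a set set \<Rightarrow> 'a set set set" where
  "block_pairs \<tau> B = {{C, \<tau> ` C} |C. C \<in> B \<and> \<tau> ` C \<noteq> C}"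

text \<open>The points of \<open>P\<close> will be the through blocks of a diagram. A block of
  \<open>D\<close> with two of them is a merge of through blocks, which lowers the propagating
  number.\<close>

definition separated :: "'a set set \<Rightarrow> 'a set \<Rightarrow> bool" where
  "separated D P \<longleftrightarrow> (\<forall>C\<in>D. \<forall>x\<in>C \<inter> P. \<forall>y\<in>C \<inter> P. x = y)"

text \<open>\<open>C = {}\<close> stands for a new block.\<close>

definition extend_fix :: "'a \<Rightarrow> 'a \<Rightarrow> 'a set set \<Rightarrow> 'a set \<Rightarrow> 'a set set" where
  "extend_fix c c' D C = insert (C \<union> {c, c'}) (D - {C})"

text \<open>\<open>C\<close> is a single block and not a pair: \<open>c\<close> can join either
  member of a pair, and \<open>\<tau> c\<close> then joins the other. This is the origin of the
  factor 2 in \<open>weight_e\<close>.\<close>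

definition extend_free :: "('a \<Rightarrow> 'a) \<Rightarrow> 'a \<Rightarrow> 'a set set \<Rightarrow> 'a set \<Rightarrow> 'a set set" where
  "extend_free \<tau> c D C = insert (insert c C) (insert (insert (\<tau> c) (\<tau> ` C)) (D - {C, \<tau> ` C}))"

text \<open>A union replaces a choice: in a partition only one block contributes to it.\<close>

definition block_of :: "'a set set \<Rightarrow> 'a \<Rightarrow> 'a set" where
  "block_of D x = \<Union>{B \<in> D. x \<in> B}"

lemma block_of_eq: "partition_on V D \<Longrightarrow> B \<in> D \<Longrightarrow> x \<in> B \<Longrightarrow> block_of D x = B"
  unfolding block_of_def partition_on_def disjoint_def by blast

lemma block_of_in: "partition_on V D \<Longrightarrow> x \<in> V \<Longrightarrow> block_of D x \<in> D \<and> x \<in> block_of D x"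
  by (metis Union_iff block_of_eq partition_onD1)

lemma partition_block_eq:
  "partition_on V D \<Longrightarrow> B \<in> D \<Longrightarrow> C \<in> D \<Longrightarrow> x \<in> B \<Longrightarrow> x \<in> C \<Longrightarrow> B = C"
  by (metis block_of_eq)

locale involution =
  fixes \<tau> :: "'a \<Rightarrow> 'a"
  assumes \<tau>\<tau> [simp]: "\<tau> (\<tau> x) = x"
begin

lemma \<tau>_eq_iff [simp]: "\<tau> x = \<tau> y \<longleftrightarrow> x = y"
  by (metis \<tau>\<tau>)

lemma mem_image_iff: "x \<in> \<tau> ` C \<longleftrightarrow> \<tau> x \<in> C"
  by (metis \<tau>\<tau> image_iff)

lemma inj_\<tau>: "inj \<tau>"
  by (rule injI) simp

lemma image_image_\<tau> [simp]: "\<tau> ` \<tau> ` C = C"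
  by (auto simp: mem_image_iff)

lemma image_eq_iff [simp]: "\<tau> ` C = \<tau> ` D \<longleftrightarrow> C = D"
  by (metis image_image_\<tau>)

section \<open>Insertion and deletion of one orbit\<close>

lemma stable_partitions_insert_fix:
  assumes "\<tau> ` C = C" "C \<noteq> {}" "C \<inter> \<Union>D = {}"
  shows "insert C D \<in> stable_partitions \<tau> V \<longleftrightarrow> D \<in> stable_partitions \<tau> (V - C) \<and> C \<subseteq> V"
proof -
  have "E \<in> D \<Longrightarrow> \<tau> ` E \<noteq> C" for E
    using assms by (metis Int_absorb2 Union_upper image_image_\<tau> )
  then show ?thesis
    using assms partition_on_insert[of C D V] unfolding stable_partitions_def
    by (auto simp: disjnt_def)
qed

lemma stable_partitions_insert_free:
  assumes "C \<inter> \<tau> ` C = {}" "C \<noteq> {}" "(C \<union> \<tau> ` C) \<inter> \<Union>D = {}"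
  shows "insert C (insert (\<tau> ` C) D) \<in> stable_partitions \<tau> V
    \<longleftrightarrow> D \<in> stable_partitions \<tau> (V - C - \<tau> ` C) \<and> C \<subseteq> V \<and> \<tau> ` C \<subseteq> V"
proof -
  have 1: "E \<in> D \<Longrightarrow> \<tau> ` E \<noteq> C \<and> \<tau> ` E \<noteq> \<tau> ` C" for E
    using assms by auto
  have d: "disjnt C (\<Union>(insert (\<tau> ` C) D))" "disjnt (\<tau> ` C) (\<Union>D)"
    using assms by (auto simp: disjnt_def)
  have "partition_on V (insert C (insert (\<tau> ` C) D)) \<longleftrightarrow>
      partition_on (V - C - \<tau> ` C) D \<and> C \<subseteq> V \<and> \<tau> ` C \<subseteq> V"
    unfolding partition_on_insert[OF d(1)] partition_on_insert[OF d(2)] using assms(1,2) by auto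
  with 1 show ?thesis
    unfolding stable_partitions_def by (auto simp: image_image)
qed

lemma stable_partitionsD:
  assumes "D \<in> stable_partitions \<tau> V"
  shows "partition_on V D" "C \<in> D \<Longrightarrow> \<tau> ` C \<in> D" "C \<in> D \<Longrightarrow> C \<noteq> {}" "C \<in> D \<Longrightarrow> C \<subseteq> V"
  using assms unfolding stable_partitions_def partition_on_def by auto

lemma extend_fix_mem:
  assumes "c \<in> V" "\<tau> c \<in> V" "D \<in> stable_partitions \<tau> (V - {c, \<tau> c})"
    "C \<in> insert {} D" "\<tau> ` C = C"
  shows "extend_fix c (\<tau> c) D C \<in> stable_partitions \<tau> V"
proof -
  note D = stable_partitionsD[OF assms(3)]
  have CV: "C \<subseteq> V - {c, \<tau> c}"
    using assms(4) D(4) by auto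
  have inv: "\<tau> ` (C \<union> {c, \<tau> c}) = C \<union> {c, \<tau> c}"
    using assms(5) by auto
  have disj: "C \<inter> \<Union>(D - {C}) = {}"
    using assms(4) partition_block_eq[OF D(1)] by blast
  \<comment> \<open>The old block leaves the partition before the enlarged one enters. For
    \<open>C = {}\<close> nothing leaves, as \<open>{}\<close> is not a block.\<close>
  have "D - {C} \<in> stable_partitions \<tau> (V - (C \<union> {c, \<tau> c}))"
  proof (cases "C = {}")
    case True
    then have "D - {C} = D" using D(3) by auto
    then show ?thesis using assms(3) True by simp
  next
    case False
    then have "insert C (D - {C}) = D" using assms(4) by auto
    then have "insert C (D - {C}) \<in> stable_partitions \<tau> (V - {c, \<tau> c})" using assms(3) by simp
    moreover have "V - {c, \<tau> c} - C = V - (C \<union> {c, \<tau> c})" by auto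
    ultimately show ?thesis
      using stable_partitions_insert_fix[OF assms(5) False disj] by auto
  qed
  moreover have "(C \<union> {c, \<tau> c}) \<inter> \<Union>(D - {C}) = {}"
    using disj D(4) by blast
  ultimately show ?thesis
    unfolding extend_fix_def using stable_partitions_insert_fix[OF inv] CV assms(1,2) by auto
qed

lemma extend_free_mem:
  assumes "c \<in> V" "\<tau> c \<in> V" "c \<noteq> \<tau> c" "D \<in> stable_partitions \<tau> (V - {c, \<tau> c})"
    "C \<in> insert {} D" "\<tau> ` C \<noteq> C \<or> C = {}"
  shows "extend_free \<tau> c D C \<in> stable_partitions \<tau> V"
proof -
  note D = stable_partitionsD[OF assms(4)]
  have CV: "C \<subseteq> V - {c, \<tau> c}"
    using assms(5) D(4) by auto
  have CV': "\<tau> ` C \<subseteq> V - {c, \<tau> c}"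
    using assms(5) D(2,4) by blast
  have disj: "(C \<union> \<tau> ` C) \<inter> \<Union>(D - {C, \<tau> ` C}) = {}"
    using assms(5) partition_block_eq[OF D(1)] D(2) by blast
  have CC: "C \<inter> \<tau> ` C = {}"
    using assms(5,6) partition_block_eq[OF D(1)] D(2) by blast
  have "D - {C, \<tau> ` C} \<in> stable_partitions \<tau> (V - (insert c C) - (insert (\<tau> c) (\<tau> ` C)))"
  proof (cases "C = {}")
    case True
    then have "D - {C, \<tau> ` C} = D" "(V - (insert c C) - (insert (\<tau> c) (\<tau> ` C))) = V - {c, \<tau> c}"
      using D(3) by auto
    then show ?thesis using assms(4) by simp
  next
    case False
    then have "insert C (insert (\<tau> ` C) (D - {C, \<tau> ` C})) = D" using assms(5) D(2) by auto
    then have "insert C (insert (\<tau> ` C) (D - {C, \<tau> ` C})) \<in> stable_partitions \<tau> (V - {c, \<tau> c})"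
      using assms(4) by simp
    moreover have "V - {c, \<tau> c} - C - \<tau> ` C = (V - (insert c C) - (insert (\<tau> c) (\<tau> ` C)))" by auto
    ultimately show ?thesis
      using stable_partitions_insert_free[OF CC False disj] by auto
  qed
  moreover have "insert c C \<inter> \<tau> ` insert c C = {}"
    using CC assms(3) CV CV' by auto
  moreover have "(insert c C \<union> \<tau> ` insert c C) \<inter> \<Union>(D - {C, \<tau> ` C}) = {}"
  proof -
    have "E \<inter> (insert c C \<union> \<tau> ` insert c C) = {}" if "E \<in> D - {C, \<tau> ` C}" for E
    proof -
      have "c \<notin> E" "\<tau> c \<notin> E" using that D(4)[of E] by auto
      moreover have "E \<inter> (C \<union> \<tau> ` C) = {}" using that disj by blast
      ultimately show ?thesis by auto
    qed
    then show ?thesis by blast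
  qed
  ultimately show ?thesis
    unfolding extend_free_def
    using stable_partitions_insert_free[of "insert c C" "D - {C, \<tau> ` C}" V] CV CV' assms(1,2) by auto
qed

text \<open>Converse of \<open>extend_fix_mem\<close>. A block that contains the whole orbit of
  \<open>c\<close> meets its image and hence is invariant. Subtracting \<open>{{}}\<close> discards
  the remainder when the block was the orbit itself.\<close>

lemma restrict_fix_mem:
  assumes "D \<in> stable_partitions \<tau> V" "B \<in> D" "c \<in> B" "\<tau> c \<in> B"
  defines "C \<equiv> B - {c, \<tau> c}"
  shows "(D - {B}) \<union> ({C} - {{}}) \<in> stable_partitions \<tau> (V - {c, \<tau> c})"
    "\<tau> ` C = C" "extend_fix c (\<tau> c) ((D - {B}) \<union> ({C} - {{}})) C = D"
proof -
  note D = stable_partitionsD[OF assms(1)]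
  have BB: "\<tau> ` B = B"
    using assms(2,3,4) partition_block_eq[OF D(1) D(2)[OF assms(2)] assms(2), of c]
    by (simp add: mem_image_iff)
  then show 1: "\<tau> ` C = C"
    unfolding C_def by (auto simp: mem_image_iff set_eq_iff)
  have disj: "B \<inter> \<Union>(D - {B}) = {}"
    using assms(2) partition_block_eq[OF D(1)] by blast
  have BV: "B \<subseteq> V" "B \<noteq> {}" using D assms(2) by auto
  have "insert B (D - {B}) \<in> stable_partitions \<tau> V"
    using assms(1,2) by (simp add: insert_absorb)
  then have DB: "D - {B} \<in> stable_partitions \<tau> (V - B)"
    using stable_partitions_insert_fix[OF BB BV(2) disj] by auto
  show "(D - {B}) \<union> ({C} - {{}}) \<in> stable_partitions \<tau> (V - {c, \<tau> c})"
  proof (cases "C = {}")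
    case True
    then have "B = {c, \<tau> c}" using C_def assms(3,4) by auto
    then show ?thesis using DB True by auto
  next
    case False
    have "V - {c, \<tau> c} - C = V - B" using C_def assms(3,4) by auto
    moreover have "C \<inter> \<Union>(D - {B}) = {}" using disj C_def by auto
    moreover have "(D - {B}) \<union> ({C} - {{}}) = insert C (D - {B})" using False by auto
    moreover have "C \<subseteq> V - {c, \<tau> c}" using BV(1) C_def by blast
    ultimately show ?thesis
      using stable_partitions_insert_fix[OF 1 False, of "D - {B}" "V - {c, \<tau> c}"] DB by metis
  qed
  \<comment> \<open>If the remainder were another block of \<open>D\<close>, putting it back would
    lose a block. But it lies inside \<open>B\<close>, which the other blocks avoid.\<close>
  have "C \<notin> D - {B}"
  proof
    assume C: "C \<in> D - {B}"
    then have "C \<noteq> {}" using D(3) by blast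
    moreover have "C \<subseteq> B" by (auto simp: C_def)
    ultimately show False using C disj by blast
  qed
  then have "(D - {B}) \<union> ({C} - {{}}) - {C} = D - {B}" using D(3) by auto
  moreover have "C \<union> {c, \<tau> c} = B" using C_def assms(3,4) by auto
  ultimately show "extend_fix c (\<tau> c) ((D - {B}) \<union> ({C} - {{}})) C = D"
    unfolding extend_fix_def using assms(2) by auto
qed

text \<open>Converse of \<open>extend_free_mem\<close>. Since \<open>\<tau> c\<close> is outside the
  block of \<open>c\<close>, this block differs from its image and so is disjoint from it;
  \<open>c\<close> is taken from the one and \<open>\<tau> c\<close> from the other.\<close>

lemma restrict_free_mem:
  assumes "D \<in> stable_partitions \<tau> V" "B \<in> D" "c \<in> B" "\<tau> c \<notin> B"
  defines "C \<equiv> B - {c}"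
  defines "D' \<equiv> (D - {B, \<tau> ` B}) \<union> ({C, \<tau> ` C} - {{}})"
  shows "D' \<in> stable_partitions \<tau> (V - {c, \<tau> c})"
    "\<tau> ` C \<noteq> C \<or> C = {}" "extend_free \<tau> c D' C = D"
proof -
  note D = stable_partitionsD[OF assms(1)]
  have tB: "\<tau> ` B \<in> D" using D assms by auto
  have "B \<noteq> \<tau> ` B" using assms by (auto simp: mem_image_iff)
  then have BB: "B \<inter> \<tau> ` B = {}"
    using partition_block_eq[OF D(1) assms(2) tB] by auto
  have CC: "C \<inter> \<tau> ` C = {}" unfolding C_def using BB by auto
  then show 1: "\<tau> ` C \<noteq> C \<or> C = {}" by auto
  have disj: "(B \<union> \<tau> ` B) \<inter> \<Union>(D - {B, \<tau> ` B}) = {}"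
    using assms(2) tB partition_block_eq[OF D(1)] by blast
  have BV: "B \<subseteq> V" "B \<noteq> {}" "\<tau> ` B \<subseteq> V" using D assms(2) tB by auto
  have "insert B (insert (\<tau> ` B) (D - {B, \<tau> ` B})) = D"
    using assms(2) tB by auto
  then have DB: "D - {B, \<tau> ` B} \<in> stable_partitions \<tau> (V - B - \<tau> ` B)"
    using stable_partitions_insert_free[OF BB BV(2) disj] assms(1) by auto
  have tC: "\<tau> ` C = \<tau> ` B - {\<tau> c}" unfolding C_def by auto
  have tcB: "\<tau> c \<in> \<tau> ` B" "c \<notin> \<tau> ` B" using assms by (auto simp: mem_image_iff)
  show "D' \<in> stable_partitions \<tau> (V - {c, \<tau> c})"
  proof (cases "C = {}")
    case True
    then have "V - B - \<tau> ` B = V - {c, \<tau> c}" using C_def assms(3,4) by auto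
    then show ?thesis using DB True D'_def by auto
  next
    case False
    have "V - {c, \<tau> c} - C - \<tau> ` C = V - B - \<tau> ` B" using C_def assms(3,4) tcB tC by auto
    moreover have "(C \<union> \<tau> ` C) \<inter> \<Union>(D - {B, \<tau> ` B}) = {}" using disj C_def by auto
    moreover have "D' = insert C (insert (\<tau> ` C) (D - {B, \<tau> ` B}))" using False D'_def by auto
    moreover have "C \<subseteq> V - {c, \<tau> c}" "\<tau> ` C \<subseteq> V - {c, \<tau> c}"
      using BV C_def tC assms(4) tcB by auto
    ultimately show ?thesis
      using stable_partitions_insert_free[OF CC False, of "D - {B, \<tau> ` B}" "V - {c, \<tau> c}"] DB by metis
  qed
  have "E \<in> D - {B, \<tau> ` B} \<Longrightarrow> E \<noteq> C \<and> E \<noteq> \<tau> ` C" for E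
  proof -
    assume E: "E \<in> D - {B, \<tau> ` B}"
    have "E \<noteq> {}" "E \<inter> (B \<union> \<tau> ` B) = {}" using D(3)[of E] E disj by blast+
    moreover have "C \<subseteq> B" "\<tau> ` C \<subseteq> \<tau> ` B" by (auto simp: C_def)
    ultimately show ?thesis by blast
  qed
  then have "D' - {C, \<tau> ` C} = D - {B, \<tau> ` B}" using D(3) D'_def by blast
  moreover have "insert c C = B" "insert (\<tau> c) (\<tau> ` C) = \<tau> ` B" using C_def assms(3,4) tC tcB by auto
  ultimately show "extend_free \<tau> c D' C = D"
    unfolding extend_free_def using assms(2) tB by auto
qed

text \<open>Both \<open>C\<close> and \<open>D\<close> can be read off from the extension. This is
  the injectivity half of the bijection in \<open>sum_extend_fix\<close>.\<close>

lemma extend_fix_inverse: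
  assumes "D \<in> stable_partitions \<tau> (V - {c, \<tau> c})" "C \<in> insert {} D"
  defines "E \<equiv> extend_fix c (\<tau> c) D C"
  shows "\<tau> c \<in> block_of E c" "block_of E c - {c, \<tau> c} = C"
    "E - {block_of E c} \<union> ({C} - {{}}) = D"
proof -
  note D = stable_partitionsD[OF assms(1)]
  have nin: "c \<notin> B" "\<tau> c \<notin> B" if "B \<in> D" for B using D(4)[OF that] by auto
  have 1: "block_of E c = C \<union> {c, \<tau> c}"
    unfolding block_of_def E_def extend_fix_def using nin by auto
  then show "\<tau> c \<in> block_of E c" by simp
  show "block_of E c - {c, \<tau> c} = C"
    unfolding 1 using assms(2) nin by auto
  have "C \<union> {c, \<tau> c} \<notin> D" using nin by auto
  then show "E - {block_of E c} \<union> ({C} - {{}}) = D"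
    unfolding 1 unfolding E_def extend_fix_def using assms(2) D(3) by auto
qed

lemma extend_free_inverse:
  assumes "D \<in> stable_partitions \<tau> (V - {c, \<tau> c})" "C \<in> insert {} D" "\<tau> c \<noteq> c"
  defines "E \<equiv> extend_free \<tau> c D C"
  shows "\<tau> c \<notin> block_of E c" "block_of E c - {c} = C"
    "E - {block_of E c, \<tau> ` block_of E c} \<union> ({C, \<tau> ` C} - {{}}) = D"
proof -
  note D = stable_partitionsD[OF assms(1)]
  have nin: "c \<notin> B" "\<tau> c \<notin> B" if "B \<in> D" for B using D(4)[OF that] by auto
  have nC: "c \<notin> C" "\<tau> c \<notin> C" "c \<notin> \<tau> ` C" using nin assms(2) by (auto simp: mem_image_iff)
  have 1: "block_of E c = insert c C"
    unfolding block_of_def E_def extend_free_def using nin nC assms(3) by auto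
  then show "\<tau> c \<notin> block_of E c" using nC assms(3) by simp
  show "block_of E c - {c} = C"
    unfolding 1 using nC by auto
  have "insert c C \<notin> D" "\<tau> ` insert c C \<notin> D" using nin by auto
  then show "E - {block_of E c, \<tau> ` block_of E c} \<union> ({C, \<tau> ` C} - {{}}) = D"
    unfolding 1 unfolding E_def extend_free_def using assms(2) D(2,3) by auto
qed

lemma finite_stable_partitions: "finite V \<Longrightarrow> finite (stable_partitions \<tau> V)"
  unfolding stable_partitions_def using finitely_many_partition_on[of V] by (auto intro: finite_subset)

lemma finite_block_set: "finite V \<Longrightarrow> D \<in> stable_partitions \<tau> V \<Longrightarrow> finite D"
  using finite_elements stable_partitionsD(1) by blast

text \<open>The partitions whose block through \<open>c\<close> contains the whole orbit correspond
  to pairs of a partition without the orbit and the remainder of that block, which is invariant or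
  empty.\<close>

lemma sum_extend_fix:
  assumes "finite V" "c \<in> V" "\<tau> c \<in> V"
  shows "(\<Sum>D | D \<in> stable_partitions \<tau> V \<and> \<tau> c \<in> block_of D c. F D) =
    (\<Sum>D\<in>stable_partitions \<tau> (V - {c, \<tau> c}). \<Sum>C\<in>insert {} (fix_blocks \<tau> D). F (extend_fix c (\<tau> c) D C))"
proof -
  let ?S = "SIGMA D:stable_partitions \<tau> (V - {c, \<tau> c}). insert {} (fix_blocks \<tau> D)"
  let ?T = "{D. D \<in> stable_partitions \<tau> V \<and> \<tau> c \<in> block_of D c}"
  let ?i = "\<lambda>(D, C). extend_fix c (\<tau> c) D C"
  define j where "j = (\<lambda>D. (D - {block_of D c} \<union> ({block_of D c - {c, \<tau> c}} - {{}}), block_of D c - {c, \<tau> c}))"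
  have fin: "finite D" if "D \<in> stable_partitions \<tau> (V - {c, \<tau> c})" for D
    using finite_block_set[OF _ that] assms(1) by auto
  have "(\<Sum>D\<in>?T. F D) = (\<Sum>x\<in>?S. F (?i x))"
  proof (rule sum.reindex_bij_witness[where i = ?i and j = j])
    fix D assume "D \<in> ?T"
    then have D: "D \<in> stable_partitions \<tau> V" "\<tau> c \<in> block_of D c" by auto
    have B: "block_of D c \<in> D" "c \<in> block_of D c"
      using block_of_in[OF stable_partitionsD(1)[OF D(1)] assms(2)] by auto
    note R = restrict_fix_mem[OF D(1) B D(2)]
    show "?i (j D) = D" using R(3) by (simp add: j_def)
    then show "F (?i (j D)) = F D" by simp
    show "j D \<in> ?S" unfolding j_def mem_Sigma_iff fix_blocks_def using R(1,2) by blast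
  next
    fix x assume "x \<in> ?S"
    moreover obtain D C where x: "x = (D, C)" by (cases x)
    ultimately have D: "D \<in> stable_partitions \<tau> (V - {c, \<tau> c})" and C: "C \<in> insert {} D" "\<tau> ` C = C"
      unfolding x mem_Sigma_iff fix_blocks_def by blast+
    note E = extend_fix_inverse[OF D C(1)]
    show "j (?i x) = x" using E(2,3) by (simp add: x j_def)
    show "?i x \<in> ?T" using E(1) extend_fix_mem[OF assms(2,3) D C] by (simp add: x)
  qed
  also have "\<dots> = (\<Sum>D\<in>stable_partitions \<tau> (V - {c, \<tau> c}). \<Sum>C\<in>insert {} (fix_blocks \<tau> D). F (extend_fix c (\<tau> c) D C))"
    using fin assms(1) by (subst sum.Sigma) (auto simp: finite_stable_partitions fix_blocks_def split_def)
  finally show ?thesis .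
qed

text \<open>The complementary case. Only the remainder of the block of \<open>c\<close> is recorded,
  since stability determines the remainder of the block of \<open>\<tau> c\<close>.\<close>

lemma sum_extend_free:
  assumes "finite V" "c \<in> V" "\<tau> c \<in> V" "\<tau> c \<noteq> c"
  shows "(\<Sum>D | D \<in> stable_partitions \<tau> V \<and> \<tau> c \<notin> block_of D c. F D) =
    (\<Sum>D\<in>stable_partitions \<tau> (V - {c, \<tau> c}). \<Sum>C\<in>insert {} (free_blocks \<tau> D). F (extend_free \<tau> c D C))"
proof -
  let ?S = "SIGMA D:stable_partitions \<tau> (V - {c, \<tau> c}). insert {} (free_blocks \<tau> D)"
  let ?T = "{D. D \<in> stable_partitions \<tau> V \<and> \<tau> c \<notin> block_of D c}"
  let ?i = "\<lambda>(D, C). extend_free \<tau> c D C"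
  define j where "j = (\<lambda>D. (D - {block_of D c, \<tau> ` block_of D c} \<union>
    ({block_of D c - {c}, \<tau> ` (block_of D c - {c})} - {{}}), block_of D c - {c}))"
  have fin: "finite D" if "D \<in> stable_partitions \<tau> (V - {c, \<tau> c})" for D
    using finite_block_set[OF _ that] assms(1) by auto
  have "(\<Sum>D\<in>?T. F D) = (\<Sum>x\<in>?S. F (?i x))"
  proof (rule sum.reindex_bij_witness[where i = ?i and j = j])
    fix D assume "D \<in> ?T"
    then have D: "D \<in> stable_partitions \<tau> V" "\<tau> c \<notin> block_of D c" by auto
    have B: "block_of D c \<in> D" "c \<in> block_of D c"
      using block_of_in[OF stable_partitionsD(1)[OF D(1)] assms(2)] by auto
    note R = restrict_free_mem[OF D(1) B D(2)]
    show "?i (j D) = D" using R(3) by (simp add: j_def)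
    then show "F (?i (j D)) = F D" by simp
    show "j D \<in> ?S" unfolding j_def mem_Sigma_iff free_blocks_def using R(1,2) by blast
  next
    fix x assume "x \<in> ?S"
    moreover obtain D C where x: "x = (D, C)" by (cases x)
    ultimately have D: "D \<in> stable_partitions \<tau> (V - {c, \<tau> c})" and C: "C \<in> insert {} D" "\<tau> ` C \<noteq> C \<or> C = {}"
      unfolding x mem_Sigma_iff free_blocks_def by blast+
    note E = extend_free_inverse[OF D C(1) assms(4)]
    show "j (?i x) = x" using E(2,3) by (simp add: x j_def)
    show "?i x \<in> ?T" using E(1) extend_free_mem[OF assms(2,3) _ D C] assms(4) by (simp add: x)
  qed
  also have "\<dots> = (\<Sum>D\<in>stable_partitions \<tau> (V - {c, \<tau> c}). \<Sum>C\<in>insert {} (free_blocks \<tau> D). F (extend_free \<tau> c D C))"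
    using fin assms(1) by (subst sum.Sigma) (auto simp: finite_stable_partitions free_blocks_def split_def)
  finally show ?thesis .
qed

end

section \<open>Block counts and separation after an insertion\<close>

context involution begin

text \<open>The pairs split the free blocks into disjoint sets of two elements: the image of a free
  block is again free and generates the same pair.\<close>

lemma card_free_blocks:
  assumes "finite B" "\<And>C. C \<in> B \<Longrightarrow> \<tau> ` C \<in> B"
  shows "card (free_blocks \<tau> B) = 2 * card (block_pairs \<tau> B)"
proof -
  have U: "\<Union>(block_pairs \<tau> B) = free_blocks \<tau> B"
  proof
    show "\<Union>(block_pairs \<tau> B) \<subseteq> free_blocks \<tau> B"
    proof
      fix E assume "E \<in> \<Union>(block_pairs \<tau> B)"
      then obtain C where "C \<in> B" "\<tau> ` C \<noteq> C" "E = C \<or> E = \<tau> ` C" unfolding block_pairs_def by blast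
      then show "E \<in> free_blocks \<tau> B" using assms(2)[of C]
        unfolding free_blocks_def by auto
    qed
    show "free_blocks \<tau> B \<subseteq> \<Union>(block_pairs \<tau> B)"
      unfolding free_blocks_def block_pairs_def by blast
  qed
  have fin: "finite (free_blocks \<tau> B)"
    using assms(1) by (simp add: free_blocks_def)
  have "2 * card (block_pairs \<tau> B) = card (\<Union>(block_pairs \<tau> B))"
  proof (rule card_partition)
    show "finite (\<Union>(block_pairs \<tau> B))" using U fin by simp
    then show "finite (block_pairs \<tau> B)" by (rule finite_UnionD)
    show "card Q = 2" if "Q \<in> block_pairs \<tau> B" for Q
      using that unfolding block_pairs_def by (auto simp: card_2_iff)
    show "Q \<inter> R = {}" if QR: "Q \<in> block_pairs \<tau> B" "R \<in> block_pairs \<tau> B" "Q \<noteq> R" for Q R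
    proof -
      obtain C D where "Q = {C, \<tau> ` C}" "R = {D, \<tau> ` D}"
        using QR unfolding block_pairs_def by auto
      then show ?thesis using QR(3) image_image_\<tau>[of C] image_image_\<tau>[of D] by auto
    qed
  qed
  then show ?thesis using U by simp
qed

lemma block_pairs_filter:
  assumes "\<And>C. \<Phi> (\<tau> ` C) \<longleftrightarrow> \<Phi> C"
  shows "finite D \<Longrightarrow> (\<And>C. C \<in> D \<Longrightarrow> \<tau> ` C \<in> D) \<Longrightarrow>
    card {B \<in> free_blocks \<tau> D. \<Phi> B} = 2 * card (block_pairs \<tau> {B \<in> D. \<Phi> B})"
  using card_free_blocks[of "{B \<in> D. \<Phi> B}"] assms
  by (simp add: free_blocks_def conj_ac cong: conj_cong)

lemma image_Int_empty_iff:
  assumes "\<tau> ` P = P"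
  shows "\<tau> ` C \<inter> P = {} \<longleftrightarrow> C \<inter> P = {}"
  using assms by (metis image_Int image_is_empty inj_\<tau>)

text \<open>By separation a block holds at most one point of \<open>P\<close>, so
  \<open>block_of D\<close> is injective on \<open>P\<close>. A block through a point of
  \<open>P\<close> is invariant just if the point is fixed: an invariant block also contains the
  image of the point, which is in \<open>P\<close> again and thus is the same point.\<close>

lemma card_fix_meeting:
  assumes "D \<in> stable_partitions \<tau> V" "P \<subseteq> V" "\<tau> ` P = P" "separated D P"
  shows "card {B \<in> fix_blocks \<tau> D. B \<inter> P \<noteq> {}} = card {x \<in> P. \<tau> x = x}" (is ?fix)
    and "card {B \<in> free_blocks \<tau> D. B \<inter> P \<noteq> {}} = card {x \<in> P. \<tau> x \<noteq> x}" (is ?free)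
proof -
  note D = stable_partitionsD[OF assms(1)]
  have sep: "B \<in> D \<Longrightarrow> x \<in> B \<Longrightarrow> y \<in> B \<Longrightarrow> x \<in> P \<Longrightarrow> y \<in> P \<Longrightarrow> x = y" for B x y
    using assms(4) unfolding separated_def by blast
  have tP: "x \<in> P \<Longrightarrow> \<tau> x \<in> P" for x using assms(3) by auto
  have blk: "block_of D x \<in> D" "x \<in> block_of D x" if "x \<in> P" for x
    using block_of_in[OF D(1)] that assms(2) by auto
  have fix_iff: "\<tau> ` B = B \<longleftrightarrow> \<tau> x = x" if "B \<in> D" "x \<in> B" "x \<in> P" for B x
    using that sep[OF that(1,2) _ that(3) tP[OF that(3)]] partition_block_eq[OF D(1) D(2)[OF that(1)] that(1), of x]
    by (metis imageI image_image_\<tau> mem_image_iff)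
  have inj: "inj_on (block_of D) P"
    using blk sep by (metis inj_onI)
  have "{B \<in> fix_blocks \<tau> D. B \<inter> P \<noteq> {}} = block_of D ` {x \<in> P. \<tau> x = x}"
  proof (intro equalityI subsetI)
    fix B assume "B \<in> {B \<in> fix_blocks \<tau> D. B \<inter> P \<noteq> {}}"
    then obtain x where "B \<in> D" "\<tau> ` B = B" "x \<in> B" "x \<in> P" by (auto simp: fix_blocks_def)
    then show "B \<in> block_of D ` {x \<in> P. \<tau> x = x}"
      using fix_iff block_of_eq[OF D(1)] by (intro image_eqI[of _ _ x]) auto
  next
    fix B assume "B \<in> block_of D ` {x \<in> P. \<tau> x = x}"
    then obtain x where "x \<in> P" "\<tau> x = x" "B = block_of D x" by auto
    then show "B \<in> {B \<in> fix_blocks \<tau> D. B \<inter> P \<noteq> {}}"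
      using blk[of x] fix_iff[of B x] by (auto simp: fix_blocks_def)
  qed
  then show ?fix
    using card_image inj_on_subset[OF inj] by (metis (no_types, lifting) mem_Collect_eq subsetI)
  have "{B \<in> free_blocks \<tau> D. B \<inter> P \<noteq> {}} = block_of D ` {x \<in> P. \<tau> x \<noteq> x}"
  proof (intro equalityI subsetI)
    fix B assume "B \<in> {B \<in> free_blocks \<tau> D. B \<inter> P \<noteq> {}}"
    then obtain x where "B \<in> D" "\<tau> ` B \<noteq> B" "x \<in> B" "x \<in> P" by (auto simp: free_blocks_def)
    then show "B \<in> block_of D ` {x \<in> P. \<tau> x \<noteq> x}"
      using fix_iff block_of_eq[OF D(1)] by (intro image_eqI[of _ _ x]) auto
  next
    fix B assume "B \<in> block_of D ` {x \<in> P. \<tau> x \<noteq> x}"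
    then obtain x where "x \<in> P" "\<tau> x \<noteq> x" "B = block_of D x" by auto
    then show "B \<in> {B \<in> free_blocks \<tau> D. B \<inter> P \<noteq> {}}"
      using blk[of x] fix_iff[of B x] by (auto simp: free_blocks_def)
  qed
  then show ?free
    using card_image inj_on_subset[OF inj] by (metis (no_types, lifting) mem_Collect_eq subsetI)
qed

lemma blocks_extend_fix:
  assumes "D \<in> stable_partitions \<tau> (V - {c, \<tau> c})" "C \<in> insert {} (fix_blocks \<tau> D)"
  shows "fix_blocks \<tau> (extend_fix c (\<tau> c) D C) = insert (C \<union> {c, \<tau> c}) (fix_blocks \<tau> D - {C})"
    "free_blocks \<tau> (extend_fix c (\<tau> c) D C) = free_blocks \<tau> D"
    "C \<union> {c, \<tau> c} \<notin> D"
proof -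
  note D = stable_partitionsD[OF assms(1)]
  have "\<tau> ` C = C" using assms(2) by (auto simp: fix_blocks_def)
  then have inv: "\<tau> ` (C \<union> {c, \<tau> c}) = C \<union> {c, \<tau> c}" by auto
  show "fix_blocks \<tau> (extend_fix c (\<tau> c) D C) = insert (C \<union> {c, \<tau> c}) (fix_blocks \<tau> D - {C})"
    unfolding fix_blocks_def extend_fix_def using inv by blast
  show "free_blocks \<tau> (extend_fix c (\<tau> c) D C) = free_blocks \<tau> D"
    unfolding free_blocks_def extend_fix_def using inv \<open>\<tau> ` C = C\<close> by blast
  show "C \<union> {c, \<tau> c} \<notin> D" using D(4)[of "C \<union> {c, \<tau> c}"] by auto
qed

lemma blocks_extend_free:
  assumes "D \<in> stable_partitions \<tau> (V - {c, \<tau> c})" "C \<in> insert {} (free_blocks \<tau> D)" "\<tau> c \<noteq> c"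
  shows "fix_blocks \<tau> (extend_free \<tau> c D C) = fix_blocks \<tau> D"
    "free_blocks \<tau> (extend_free \<tau> c D C) =
      insert (insert c C) (insert (\<tau> ` insert c C) (free_blocks \<tau> D - {C, \<tau> ` C}))"
    "insert c C \<notin> D" "\<tau> ` insert c C \<notin> D" "insert c C \<noteq> \<tau> ` insert c C"
proof -
  note D = stable_partitionsD[OF assms(1)]
  have C: "C \<in> insert {} D" using assms(2) by (auto simp: free_blocks_def)
  have nin: "c \<notin> E" "\<tau> c \<notin> E" if "E \<in> D" for E using D(4)[OF that] by auto
  have "c \<notin> C" "\<tau> c \<notin> C" using nin C by auto
  then have ne: "c \<notin> \<tau> ` insert c C" using assms(3) by (auto simp: mem_image_iff)
  then show "insert c C \<noteq> \<tau> ` insert c C" by blast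
  then have ne': "\<tau> ` insert c C \<noteq> insert c C" "\<tau> ` \<tau> ` insert c C \<noteq> \<tau> ` insert c C"
    using image_image_\<tau>[of "insert c C"] by simp_all
  show "insert c C \<notin> D" "\<tau> ` insert c C \<notin> D" using nin by blast+
  have e: "extend_free \<tau> c D C = insert (insert c C) (insert (\<tau> ` insert c C) (D - {C, \<tau> ` C}))"
    unfolding extend_free_def by simp
  have CC: "E \<in> D \<Longrightarrow> \<tau> ` E = E \<Longrightarrow> E \<notin> {C, \<tau> ` C}" for E
  proof -
    assume E: "E \<in> D" "\<tau> ` E = E"
    have "E \<noteq> {}" using D(3) E(1) by blast
    moreover have "C = {} \<or> \<tau> ` C \<noteq> C" using assms(2) by (auto simp: free_blocks_def)
    ultimately show ?thesis using E(2) image_image_\<tau>[of C] by auto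
  qed
  show "fix_blocks \<tau> (extend_free \<tau> c D C) = fix_blocks \<tau> D"
    unfolding fix_blocks_def e using ne' CC by blast
  show "free_blocks \<tau> (extend_free \<tau> c D C) =
      insert (insert c C) (insert (\<tau> ` insert c C) (free_blocks \<tau> D - {C, \<tau> ` C}))"
    unfolding free_blocks_def e using ne' by blast
qed

lemma separated_insert:
  "separated (insert E D) P \<longleftrightarrow> (\<forall>x\<in>E \<inter> P. \<forall>y\<in>E \<inter> P. x = y) \<and> separated D P"
  by (simp add: separated_def)

lemma separated_remove:
  assumes "C \<in> insert {} D"
  shows "separated D P \<longleftrightarrow> (\<forall>x\<in>C \<inter> P. \<forall>y\<in>C \<inter> P. x = y) \<and> separated (D - {C}) P"
proof (cases "C \<in> D")
  case True
  then show ?thesis using separated_insert[of C "D - {C}" P] by (simp add: insert_absorb)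
next
  case False
  then show ?thesis using assms by simp
qed

text \<open>The third claim is the reason why a free orbit of through points can only be inserted
  into free blocks: inside one block its two points would already violate separation.\<close>

lemma separated_extend_fix:
  assumes "D \<in> stable_partitions \<tau> (V - {c, \<tau> c})" "C \<in> insert {} D"
  shows "c \<notin> P \<Longrightarrow> \<tau> c \<notin> P \<Longrightarrow> separated (extend_fix c (\<tau> c) D C) P \<longleftrightarrow> separated D P"
    "c \<in> P \<Longrightarrow> \<tau> c = c \<Longrightarrow>
      separated (extend_fix c (\<tau> c) D C) P \<longleftrightarrow> separated D (P - {c}) \<and> C \<inter> (P - {c}) = {}"
    "c \<in> P \<Longrightarrow> \<tau> c \<in> P \<Longrightarrow> \<tau> c \<noteq> c \<Longrightarrow> \<not> separated (extend_fix c (\<tau> c) D C) P"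
proof -
  note D = stable_partitionsD[OF assms(1)]
  have nin: "c \<notin> E" "\<tau> c \<notin> E" if "E \<in> D" for E using D(4)[OF that] by auto
  have nC: "c \<notin> C" using nin assms(2) by auto
  show "separated (extend_fix c (\<tau> c) D C) P \<longleftrightarrow> separated D P" if "c \<notin> P" "\<tau> c \<notin> P"
  proof -
    have "(C \<union> {c, \<tau> c}) \<inter> P = C \<inter> P" using that by auto
    then show ?thesis
      unfolding extend_fix_def separated_insert using separated_remove[OF assms(2), of P] by simp
  qed
  show "c \<in> P \<Longrightarrow> \<tau> c \<in> P \<Longrightarrow> \<tau> c \<noteq> c \<Longrightarrow> \<not> separated (extend_fix c (\<tau> c) D C) P"
    unfolding extend_fix_def separated_insert by auto
  assume c: "c \<in> P" "\<tau> c = c"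
  have "separated (D - {C}) P \<longleftrightarrow> separated (D - {C}) (P - {c})"
    unfolding separated_def using nin by (intro ball_cong) auto
  moreover have "(\<forall>x\<in>(C \<union> {c, \<tau> c}) \<inter> P. \<forall>y\<in>(C \<union> {c, \<tau> c}) \<inter> P. x = y) \<longleftrightarrow> C \<inter> (P - {c}) = {}"
    using c nC by auto
  ultimately show "separated (extend_fix c (\<tau> c) D C) P \<longleftrightarrow> separated D (P - {c}) \<and> C \<inter> (P - {c}) = {}"
    unfolding extend_fix_def separated_insert using separated_remove[OF assms(2), of "P - {c}"] by auto
qed

lemma separated_extend_free:
  assumes "D \<in> stable_partitions \<tau> (V - {c, \<tau> c})" "C \<in> insert {} D" "\<tau> c \<noteq> c" "\<tau> ` P = P"
  shows "c \<notin> P \<Longrightarrow> separated (extend_free \<tau> c D C) P \<longleftrightarrow> separated D P"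
    "c \<in> P \<Longrightarrow> C \<noteq> \<tau> ` C \<or> C = {} \<Longrightarrow> separated (extend_free \<tau> c D C) P \<longleftrightarrow>
      separated D (P - {c, \<tau> c}) \<and> C \<inter> (P - {c, \<tau> c}) = {}"
proof -
  note D = stable_partitionsD[OF assms(1)]
  have nin: "c \<notin> E" "\<tau> c \<notin> E" if "E \<in> D" for E using D(4)[OF that] by auto
  have C: "C = {} \<or> C \<in> D" "\<tau> ` C = {} \<or> \<tau> ` C \<in> D" using assms(2) D(2) by auto
  have tc: "\<tau> c \<in> P \<longleftrightarrow> c \<in> P" using assms(4) mem_image_iff[of c P] by simp
  \<comment> \<open>\<open>C\<close> may coincide with its image here, so the two are removed one
    after the other.\<close>
  have rem: "separated D R \<longleftrightarrow> (\<forall>x\<in>C \<inter> R. \<forall>y\<in>C \<inter> R. x = y) \<and>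
      (\<forall>x\<in>\<tau> ` C \<inter> R. \<forall>y\<in>\<tau> ` C \<inter> R. x = y) \<and> separated (D - {C, \<tau> ` C}) R" for R
  proof -
    have "separated D R \<longleftrightarrow> (\<forall>x\<in>C \<inter> R. \<forall>y\<in>C \<inter> R. x = y) \<and> separated (D - {C}) R"
      by (rule separated_remove[OF assms(2)])
    also have "separated (D - {C}) R \<longleftrightarrow> (C = \<tau> ` C \<or> (\<forall>x\<in>\<tau> ` C \<inter> R. \<forall>y\<in>\<tau> ` C \<inter> R. x = y)) \<and>
        separated (D - {C} - {\<tau> ` C}) R"
      using separated_remove[of "\<tau> ` C" "D - {C}" R] C by (cases "C = \<tau> ` C") auto
    finally show ?thesis by (auto simp: Diff_insert2[symmetric])
  qed
  have ext: "separated (extend_free \<tau> c D C) P \<longleftrightarrow> (\<forall>x\<in>insert c C \<inter> P. \<forall>y\<in>insert c C \<inter> P. x = y) \<and>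
      (\<forall>x\<in>insert (\<tau> c) (\<tau> ` C) \<inter> P. \<forall>y\<in>insert (\<tau> c) (\<tau> ` C) \<inter> P. x = y) \<and> separated (D - {C, \<tau> ` C}) P"
    unfolding extend_free_def separated_insert by simp
  show "separated (extend_free \<tau> c D C) P \<longleftrightarrow> separated D P" if "c \<notin> P"
  proof -
    have "insert c C \<inter> P = C \<inter> P" "insert (\<tau> c) (\<tau> ` C) \<inter> P = \<tau> ` C \<inter> P"
      using that tc by simp_all
    then show ?thesis using ext rem[of P] by simp
  qed
  assume c: "c \<in> P" "C \<noteq> \<tau> ` C \<or> C = {}"
  let ?R = "P - {c, \<tau> c}"
  have nC: "c \<notin> C" "\<tau> c \<notin> C" "c \<notin> \<tau> ` C" "\<tau> c \<notin> \<tau> ` C" using nin C by auto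
  have 1: "C \<inter> ?R = C \<inter> P" "\<tau> ` C \<inter> ?R = \<tau> ` C \<inter> P" using nC by auto
  have 2: "\<tau> ` C \<inter> P = {} \<longleftrightarrow> C \<inter> P = {}" by (rule image_Int_empty_iff[OF assms(4)])
  have sep_R: "separated (D - {C, \<tau> ` C}) P \<longleftrightarrow> separated (D - {C, \<tau> ` C}) ?R"
    unfolding separated_def using nin by (intro ball_cong) auto
  \<comment> \<open>A block that receives a point of \<open>P\<close> stays admissible exactly when
    it had no point of \<open>P\<close> before.\<close>
  have single: "(\<forall>x\<in>insert a E \<inter> P. \<forall>y\<in>insert a E \<inter> P. x = y) \<longleftrightarrow> E \<inter> P = {}"
    if "a \<in> P" "a \<notin> E" for a E
  proof
    assume "\<forall>x\<in>insert a E \<inter> P. \<forall>y\<in>insert a E \<inter> P. x = y"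
    then have "x = a" if "x \<in> E \<inter> P" for x using that \<open>a \<in> P\<close> by simp
    then show "E \<inter> P = {}" using \<open>a \<notin> E\<close> by auto
  next
    assume "E \<inter> P = {}"
    then have "insert a E \<inter> P = {a}" using \<open>a \<in> P\<close> by simp
    then show "\<forall>x\<in>insert a E \<inter> P. \<forall>y\<in>insert a E \<inter> P. x = y" by simp
  qed
  have "separated (extend_free \<tau> c D C) P \<longleftrightarrow> C \<inter> P = {} \<and> separated (D - {C, \<tau> ` C}) ?R"
    unfolding ext single[OF c(1) nC(1)] single[OF tc[THEN iffD2, OF c(1)] nC(4)] 2 sep_R by simp
  also have "\<dots> \<longleftrightarrow> separated D ?R \<and> C \<inter> ?R = {}"
  proof (cases "C \<inter> P = {}")
    case True
    then show ?thesis unfolding rem[of ?R] 1 True 2[THEN iffD2, OF True] by simp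
  next
    case False
    then show ?thesis unfolding 1 by simp
  qed
  finally show "separated (extend_free \<tau> c D C) P \<longleftrightarrow> separated D ?R \<and> C \<inter> ?R = {}" .
qed

end

section \<open>The weighted sum over stable partitions\<close>

text \<open>Common form of the two families of entries. \<open>a\<close> is the number of blocks in
  one class, so \<open>a * (s + j)\<close> is the number of blocks when \<open>s + j\<close> classes
  are present.\<close>

definition weight_gen :: "nat \<Rightarrow> 'b::comm_ring_1 \<Rightarrow> nat \<Rightarrow> nat \<Rightarrow> nat \<Rightarrow> 'b" where
  "weight_gen a y s r t = (- 1) ^ t * of_nat (fact t) * of_nat a ^ t * (\<Prod>j\<in>{t..<r}. y - of_nat (a * (s + j)))"

text \<open>The cancellation for different through sets. An orbit that is through on the first side
  only can open a class, join one of the a (R - t) blocks that are horizontal on both sides, or join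
  one of the a (t + 1) blocks that are through on the second side only. Up to a common factor the
  three contributions are (y - a (s + R)) + a (R - t) - (y - a (s + t)) = 0.\<close>

lemma weight_gen_rec:
  fixes y :: "'b::comm_ring_1"
  assumes "t \<le> R"
  shows "weight_gen a y s (Suc R) (Suc t) + of_nat (a * (R - t)) * weight_gen a y s R (Suc t)
    + of_nat (a * Suc t) * weight_gen a y s R t = 0"
\<comment> \<open>For \<open>t = R\<close> the product that starts at \<open>t\<close> is empty and
  cannot be split as below; there the middle term has the coefficient 0.\<close>
proof (cases "t = R")
  case True
  then show ?thesis by (simp add: weight_gen_def algebra_simps)
next
  case False
  define K :: 'b where "K = (- 1) ^ t * of_nat (fact t) * of_nat a ^ t"
  define Pr where "Pr = (\<Prod>j\<in>{Suc t..<R}. y - of_nat (a * (s + j)))"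
  define n where "n = R - t"
  have R: "R = t + n" using assms n_def by simp
  have K': "(- 1) ^ Suc t * of_nat (fact (Suc t)) * of_nat a ^ Suc t = - (of_nat a * of_nat (Suc t) * K)"
    by (simp add: K_def algebra_simps)
  have 1: "(\<Prod>j\<in>{Suc t..<Suc R}. y - of_nat (a * (s + j))) = Pr * (y - of_nat (a * (s + R)))"
    unfolding Pr_def using assms False by (subst prod.atLeastLessThan_Suc) auto
  have 2: "(\<Prod>j\<in>{t..<R}. y - of_nat (a * (s + j))) = (y - of_nat (a * (s + t))) * Pr"
    unfolding Pr_def using assms False by (subst prod.atLeast_Suc_lessThan) auto
  have "- (of_nat a * of_nat (Suc t) * K) * (Pr * (y - of_nat (a * (s + (t + n))))) +
      of_nat (a * n) * (- (of_nat a * of_nat (Suc t) * K) * Pr) +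
      of_nat (a * Suc t) * (K * ((y - of_nat (a * (s + t))) * Pr)) = 0"
    by (simp add: algebra_simps)
  then show ?thesis
    unfolding weight_gen_def K' 1 2 Pr_def[symmetric] n_def[symmetric] K_def[symmetric]
    by (simp only: R[symmetric])
qed

text \<open>The counterpart for horizontal orbits. The factor of a new class is completed to y by
  the a (s + R) ways of joining a present block, which do not change the weight.\<close>

lemma weight_gen_Suc_0: "weight_gen a y s (Suc R) 0 = (y - of_nat (a * (s + R))) * weight_gen a y s R 0"
  by (simp add: weight_gen_def algebra_simps)

abbreviation weight_e :: "nat \<Rightarrow> nat \<Rightarrow> nat \<Rightarrow> complex poly" where
  "weight_e \<equiv> weight_gen 2 (var_x\<^sup>2 - var_x)"

abbreviation weight_z :: "nat \<Rightarrow> nat \<Rightarrow> nat \<Rightarrow> complex poly" where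
  "weight_z \<equiv> weight_gen 1 var_x"

lemma Collect_insert_remove:
  "{B \<in> insert E (S - {C}). \<Phi> B} = ({B \<in> S. \<Phi> B} - {C}) \<union> (if \<Phi> E then {E} else {})"
  by auto

lemma card_insert2: "a \<notin> K \<Longrightarrow> b \<notin> K \<Longrightarrow> a \<noteq> b \<Longrightarrow> finite K \<Longrightarrow> card (insert a (insert b K)) = card K + 2"
  by simp

lemma Collect_insert2_remove:
  assumes "\<Phi> E' \<longleftrightarrow> \<Phi> E"
  shows "{B \<in> insert E (insert E' (S - {C, C'})). \<Phi> B} = ({B \<in> S. \<Phi> B} - {C, C'}) \<union> (if \<Phi> E then {E, E'} else {})"
  using assms by auto

context involution begin

text \<open>\<open>P\<close> and \<open>Q\<close> are the through points of two diagrams. The last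
  argument of either factor is the number of exchanged classes, namely those that are through for
  \<open>P\<close> only. Free blocks are counted with both members of a pair, whence the division by
  2.\<close>

definition weight :: "nat \<Rightarrow> nat \<Rightarrow> 'a set \<Rightarrow> 'a set \<Rightarrow> 'a set set \<Rightarrow> complex poly" where
  "weight s1 s2 P Q D = (if separated D P \<and> separated D Q then
     weight_e s1 (card (free_blocks \<tau> D) div 2 - s1)
       (card {B \<in> free_blocks \<tau> D. B \<inter> P \<noteq> {} \<and> B \<inter> Q = {}} div 2) *
     weight_z s2 (card (fix_blocks \<tau> D) - s2)
       (card {B \<in> fix_blocks \<tau> D. B \<inter> P \<noteq> {} \<and> B \<inter> Q = {}}) else 0)"

text \<open>Only \<open>C = {}\<close> opens a class; otherwise the enlarged block replaces
  \<open>C\<close>, and its status with respect to \<open>P\<close> and \<open>Q\<close> may differ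
  from that of \<open>C\<close>. Hence \<open>C\<close> is taken out of the old count and the
  enlarged block is counted on its own. The orbit is removed from \<open>P\<close> on the right,
  where the ground set no longer contains it.\<close>

lemma weight_extend_fix:
  assumes fin: "finite V" and D: "D \<in> stable_partitions \<tau> (V - {c, \<tau> c})"
    and C: "C \<in> insert {} (fix_blocks \<tau> D)"
  defines "E \<equiv> extend_fix c (\<tau> c) D C"
  shows "card (free_blocks \<tau> E) = card (free_blocks \<tau> D)"
    "card (fix_blocks \<tau> E) = card (fix_blocks \<tau> D) + (if C = {} then 1 else 0)"
    "card {B \<in> free_blocks \<tau> E. B \<inter> P \<noteq> {} \<and> B \<inter> Q = {}} =
      card {B \<in> free_blocks \<tau> D. B \<inter> (P - {c, \<tau> c}) \<noteq> {} \<and> B \<inter> Q = {}}"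
    "card {B \<in> fix_blocks \<tau> E. B \<inter> P \<noteq> {} \<and> B \<inter> Q = {}} =
      card ({B \<in> fix_blocks \<tau> D. B \<inter> (P - {c, \<tau> c}) \<noteq> {} \<and> B \<inter> Q = {}} - {C}) +
      (if (C \<union> {c, \<tau> c}) \<inter> P \<noteq> {} \<and> (C \<union> {c, \<tau> c}) \<inter> Q = {} then 1 else 0)"
proof -
  note D' = stable_partitionsD[OF D]
  have finD: "finite D" using finite_block_set[OF _ D] fin by simp
  note b = blocks_extend_fix[OF D C]
  have sub: "fix_blocks \<tau> D \<subseteq> D" "free_blocks \<tau> D \<subseteq> D" by (auto simp: fix_blocks_def free_blocks_def)
  have finF: "finite (fix_blocks \<tau> D)" using finD sub finite_subset by blast
  have nin: "c \<notin> B" "\<tau> c \<notin> B" if "B \<in> D" for B using D'(4)[OF that] by auto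
  have Pr: "B \<inter> (P - {c, \<tau> c}) = B \<inter> P" if "B \<in> D" for B using nin[OF that] by auto
  show "card (free_blocks \<tau> E) = card (free_blocks \<tau> D)" unfolding E_def b(2) ..
  have CD: "C \<union> {c, \<tau> c} \<notin> fix_blocks \<tau> D - {C}" using b(3) sub by auto
  have 0: "{} \<notin> fix_blocks \<tau> D" using D'(3) sub by auto
  have "card (fix_blocks \<tau> E) = Suc (card (fix_blocks \<tau> D - {C}))"
    unfolding E_def b(1) using CD finF by simp
  also have "\<dots> = card (fix_blocks \<tau> D) + (if C = {} then 1 else 0)"
  proof (cases "C = {}")
    case True then show ?thesis using 0 by simp
  next
    case False
    then have "C \<in> fix_blocks \<tau> D" using C by simp
    then show ?thesis using card_Suc_Diff1[OF finF] False by simp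
  qed
  finally show "card (fix_blocks \<tau> E) = card (fix_blocks \<tau> D) + (if C = {} then 1 else 0)" .
  show "card {B \<in> free_blocks \<tau> E. B \<inter> P \<noteq> {} \<and> B \<inter> Q = {}} =
      card {B \<in> free_blocks \<tau> D. B \<inter> (P - {c, \<tau> c}) \<noteq> {} \<and> B \<inter> Q = {}}"
    unfolding E_def b(2)
    by (rule arg_cong[where f = card], rule Collect_cong, rule conj_cong[OF refl]) (use Pr sub(2) in \<open>simp only: subset_iff\<close>)
  let ?K = "{B \<in> fix_blocks \<tau> D. B \<inter> (P - {c, \<tau> c}) \<noteq> {} \<and> B \<inter> Q = {}} - {C}"
  have "{B \<in> fix_blocks \<tau> E. B \<inter> P \<noteq> {} \<and> B \<inter> Q = {}} = ?K \<union>
      (if (C \<union> {c, \<tau> c}) \<inter> P \<noteq> {} \<and> (C \<union> {c, \<tau> c}) \<inter> Q = {} then {C \<union> {c, \<tau> c}} else {})"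
  proof -
    have "{B \<in> fix_blocks \<tau> D. B \<inter> (P - {c, \<tau> c}) \<noteq> {} \<and> B \<inter> Q = {}} =
        {B \<in> fix_blocks \<tau> D. B \<inter> P \<noteq> {} \<and> B \<inter> Q = {}}"
      by (rule Collect_cong, rule conj_cong[OF refl]) (use Pr sub(1) in \<open>simp only: subset_iff\<close>)
    then show ?thesis unfolding E_def b(1) Collect_insert_remove by simp
  qed
  then show "card {B \<in> fix_blocks \<tau> E. B \<inter> P \<noteq> {} \<and> B \<inter> Q = {}} = card ?K +
      (if (C \<union> {c, \<tau> c}) \<inter> P \<noteq> {} \<and> (C \<union> {c, \<tau> c}) \<inter> Q = {} then 1 else 0)"
    using CD finF by (cases "(C \<union> {c, \<tau> c}) \<inter> P \<noteq> {} \<and> (C \<union> {c, \<tau> c}) \<inter> Q = {}") simp_all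
qed

lemma weight_extend_free:
  assumes fin: "finite V" and D: "D \<in> stable_partitions \<tau> (V - {c, \<tau> c})"
    and C: "C \<in> insert {} (free_blocks \<tau> D)" and cc: "\<tau> c \<noteq> c" "\<tau> ` P = P" "\<tau> ` Q = Q"
  defines "E \<equiv> extend_free \<tau> c D C"
  shows "card (fix_blocks \<tau> E) = card (fix_blocks \<tau> D)"
    "card (free_blocks \<tau> E) = card (free_blocks \<tau> D) + (if C = {} then 2 else 0)"
    "card {B \<in> fix_blocks \<tau> E. B \<inter> P \<noteq> {} \<and> B \<inter> Q = {}} =
      card {B \<in> fix_blocks \<tau> D. B \<inter> (P - {c, \<tau> c}) \<noteq> {} \<and> B \<inter> Q = {}}"
    "card {B \<in> free_blocks \<tau> E. B \<inter> P \<noteq> {} \<and> B \<inter> Q = {}} =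
      card ({B \<in> free_blocks \<tau> D. B \<inter> (P - {c, \<tau> c}) \<noteq> {} \<and> B \<inter> Q = {}} - {C, \<tau> ` C}) +
      (if insert c C \<inter> P \<noteq> {} \<and> insert c C \<inter> Q = {} then 2 else 0)"
proof -
  note D' = stable_partitionsD[OF D]
  have finD: "finite D" using finite_block_set[OF _ D] fin by simp
  note b = blocks_extend_free[OF D C cc(1)]
  have sub: "fix_blocks \<tau> D \<subseteq> D" "free_blocks \<tau> D \<subseteq> D" by (auto simp: fix_blocks_def free_blocks_def)
  have finF: "finite (free_blocks \<tau> D)" using finD sub finite_subset by blast
  have nin: "c \<notin> B" "\<tau> c \<notin> B" if "B \<in> D" for B using D'(4)[OF that] by auto
  have Pr: "B \<inter> (P - {c, \<tau> c}) = B \<inter> P" if "B \<in> D" for B using nin[OF that] by auto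
  show "card (fix_blocks \<tau> E) = card (fix_blocks \<tau> D)" unfolding E_def b(1) ..
  let ?A = "insert c C" and ?B = "\<tau> ` insert c C"
  have new: "?A \<notin> free_blocks \<tau> D" "?B \<notin> free_blocks \<tau> D" "?A \<noteq> ?B" using b(3,4,5) sub by auto
  have 0: "{} \<notin> free_blocks \<tau> D" using D'(3) sub by auto
  have "card (free_blocks \<tau> E) = Suc (Suc (card (free_blocks \<tau> D - {C, \<tau> ` C})))"
    unfolding E_def b(2) using new finF by (subst card_insert_disjoint) auto
  also have "\<dots> = card (free_blocks \<tau> D) + (if C = {} then 2 else 0)"
  proof (cases "C = {}")
    case True then show ?thesis using 0 by simp
  next
    case False
    then have C': "C \<in> free_blocks \<tau> D" using C by simp
    then have "\<tau> ` C \<in> free_blocks \<tau> D" "\<tau> ` C \<noteq> C" using D'(2) by (auto simp: free_blocks_def)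
    with C' have "{C, \<tau> ` C} \<subseteq> free_blocks \<tau> D" "card {C, \<tau> ` C} = 2" by auto
    then show ?thesis using card_Diff_subset[of "{C, \<tau> ` C}" "free_blocks \<tau> D"]
      card_mono[OF finF, of "{C, \<tau> ` C}"] False by simp
  qed
  finally show "card (free_blocks \<tau> E) = card (free_blocks \<tau> D) + (if C = {} then 2 else 0)" .
  show "card {B \<in> fix_blocks \<tau> E. B \<inter> P \<noteq> {} \<and> B \<inter> Q = {}} =
      card {B \<in> fix_blocks \<tau> D. B \<inter> (P - {c, \<tau> c}) \<noteq> {} \<and> B \<inter> Q = {}}"
    unfolding E_def b(1)
    by (rule arg_cong[where f = card], rule Collect_cong, rule conj_cong[OF refl]) (use Pr sub(1) in \<open>simp only: subset_iff\<close>)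
  let ?K = "{B \<in> free_blocks \<tau> D. B \<inter> (P - {c, \<tau> c}) \<noteq> {} \<and> B \<inter> Q = {}} - {C, \<tau> ` C}"
  have AB: "?B \<inter> P \<noteq> {} \<and> ?B \<inter> Q = {} \<longleftrightarrow> ?A \<inter> P \<noteq> {} \<and> ?A \<inter> Q = {}"
    unfolding image_Int_empty_iff[OF cc(2)] image_Int_empty_iff[OF cc(3)] ..
  have "{B \<in> free_blocks \<tau> E. B \<inter> P \<noteq> {} \<and> B \<inter> Q = {}} = ?K \<union>
      (if ?A \<inter> P \<noteq> {} \<and> ?A \<inter> Q = {} then {?A, ?B} else {})"
  proof -
    have "{B \<in> free_blocks \<tau> D. B \<inter> (P - {c, \<tau> c}) \<noteq> {} \<and> B \<inter> Q = {}} =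
        {B \<in> free_blocks \<tau> D. B \<inter> P \<noteq> {} \<and> B \<inter> Q = {}}"
      by (rule Collect_cong, rule conj_cong[OF refl]) (use Pr sub(2) in \<open>simp only: subset_iff\<close>)
    then show ?thesis
      unfolding E_def b(2) using Collect_insert2_remove[of "\<lambda>B. B \<inter> P \<noteq> {} \<and> B \<inter> Q = {}", OF AB] by (simp only:)
  qed
  moreover have "?A \<notin> ?K" "?B \<notin> ?K" "finite ?K" using new finF by auto
  ultimately show "card {B \<in> free_blocks \<tau> E. B \<inter> P \<noteq> {} \<and> B \<inter> Q = {}} = card ?K +
      (if ?A \<inter> P \<noteq> {} \<and> ?A \<inter> Q = {} then 2 else 0)"
  proof (cases "?A \<inter> P \<noteq> {} \<and> ?A \<inter> Q = {}")
    case True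
    have "?K \<union> {?A, ?B} = insert ?A (insert ?B ?K)" by simp
    moreover have "card (insert ?A (insert ?B ?K)) = card ?K + 2"
      by (rule card_insert2[OF \<open>?A \<notin> ?K\<close> \<open>?B \<notin> ?K\<close> new(3) \<open>finite ?K\<close>])
    ultimately show ?thesis
      using \<open>{B \<in> free_blocks \<tau> E. B \<inter> P \<noteq> {} \<and> B \<inter> Q = {}} = _\<close> unfolding if_P[OF True] by (simp only:)
  qed (simp only: if_False Un_empty_right add_0_right)
qed

text \<open>The two kinds of insertion together. A fixed point always shares the block of its image,
  so for it the second kind does not occur.\<close>

lemma sum_stable_partitions_delete:
  assumes "finite V" "c \<in> V" "\<tau> c \<in> V"
  shows "(\<Sum>D\<in>stable_partitions \<tau> V. F D) = (\<Sum>D\<in>stable_partitions \<tau> (V - {c, \<tau> c}).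
    (\<Sum>C\<in>insert {} (fix_blocks \<tau> D). F (extend_fix c (\<tau> c) D C)) +
    (if \<tau> c = c then 0 else \<Sum>C\<in>insert {} (free_blocks \<tau> D). F (extend_free \<tau> c D C)))"
proof -
  let ?S = "stable_partitions \<tau> V"
  have "(\<Sum>D\<in>?S. F D) = (\<Sum>D | D \<in> ?S \<and> \<tau> c \<in> block_of D c. F D) + (\<Sum>D | D \<in> ?S \<and> \<tau> c \<notin> block_of D c. F D)"
    using finite_stable_partitions[OF assms(1)]
    by (subst sum.union_disjoint[symmetric]) (auto intro!: sum.cong)
  also have "(\<Sum>D | D \<in> ?S \<and> \<tau> c \<notin> block_of D c. F D) = (if \<tau> c = c then 0 else
      (\<Sum>D\<in>stable_partitions \<tau> (V - {c, \<tau> c}). \<Sum>C\<in>insert {} (free_blocks \<tau> D). F (extend_free \<tau> c D C)))"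
  proof (cases "\<tau> c = c")
    case True
    then have "{D. D \<in> ?S \<and> \<tau> c \<notin> block_of D c} = {}"
      using block_of_in[OF stable_partitionsD(1) assms(2)] by auto
    then have "(\<Sum>D | D \<in> ?S \<and> \<tau> c \<notin> block_of D c. F D) = 0" by (simp only: sum.empty)
    then show ?thesis using True by simp
  qed (use sum_extend_free[OF assms] in simp)
  finally show ?thesis
    unfolding sum_extend_fix[OF assms] by (simp add: sum.distrib)
qed

lemma fix_blocks_subset: "fix_blocks \<tau> D \<subseteq> D"
  and free_blocks_subset: "free_blocks \<tau> D \<subseteq> D"
  by (auto simp: fix_blocks_def free_blocks_def)

lemma card_filter_split:
  assumes "finite S"
  shows "card {B \<in> S. \<Phi> B} = card {B \<in> S. \<Phi> B \<and> \<not> \<Psi> B} + card {B \<in> S. \<Phi> B \<and> \<Psi> B}"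
    "card {B \<in> S. \<Psi> B} = card {B \<in> S. \<not> \<Phi> B \<and> \<Psi> B} + card {B \<in> S. \<Phi> B \<and> \<Psi> B}"
    "card S = card {B \<in> S. \<Phi> B} + card {B \<in> S. \<not> \<Phi> B \<and> \<Psi> B} + card {B \<in> S. \<not> \<Phi> B \<and> \<not> \<Psi> B}"
proof -
  have split2: "card {B \<in> A. Q B} = card {B \<in> A. Q B \<and> R B} + card {B \<in> A. Q B \<and> \<not> R B}" if "finite A" for A Q R
    using that by (subst card_Un_disjoint[symmetric]) (auto intro!: arg_cong[of _ _ card])
  show "card {B \<in> S. \<Phi> B} = card {B \<in> S. \<Phi> B \<and> \<not> \<Psi> B} + card {B \<in> S. \<Phi> B \<and> \<Psi> B}"
    using split2[OF assms, of \<Phi> \<Psi>] by simp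
  show "card {B \<in> S. \<Psi> B} = card {B \<in> S. \<not> \<Phi> B \<and> \<Psi> B} + card {B \<in> S. \<Phi> B \<and> \<Psi> B}"
    using split2[OF assms, of \<Psi> \<Phi>] by (simp add: conj_commute)
  show "card S = card {B \<in> S. \<Phi> B} + card {B \<in> S. \<not> \<Phi> B \<and> \<Psi> B} + card {B \<in> S. \<not> \<Phi> B \<and> \<not> \<Psi> B}"
    using split2[OF assms, of "\<lambda>_. True" \<Phi>] split2[OF assms, of "\<lambda>B. \<not> \<Phi> B" \<Psi>] by simp
qed

text \<open>The shape of a sum over insertions of a point of \<open>P\<close>: joining a block that
  already meets \<open>P\<close> gives 0, and otherwise only the question whether the block meets
  \<open>Q\<close> matters. The element \<open>e\<close> will be \<open>{}\<close>, the new
  block.\<close>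

lemma sum_filter_split:
  assumes "finite S" "e \<notin> S"
    "\<And>B. B \<in> S \<Longrightarrow> \<Phi> B \<Longrightarrow> F B = 0"
    "\<And>B. B \<in> S \<Longrightarrow> \<not> \<Phi> B \<Longrightarrow> \<Psi> B \<Longrightarrow> F B = x1"
    "\<And>B. B \<in> S \<Longrightarrow> \<not> \<Phi> B \<Longrightarrow> \<not> \<Psi> B \<Longrightarrow> F B = x2"
  shows "(\<Sum>B\<in>insert e S. F B) = (F e :: complex poly) +
    of_nat (card {B \<in> S. \<not> \<Phi> B \<and> \<not> \<Psi> B}) * x2 + of_nat (card {B \<in> S. \<not> \<Phi> B \<and> \<Psi> B}) * x1"
proof -
  have "(\<Sum>B\<in>S. F B) = (\<Sum>B\<in>{B \<in> S. \<Phi> B}. F B) + (\<Sum>B\<in>{B \<in> S. \<not> \<Phi> B \<and> \<Psi> B}. F B) + (\<Sum>B\<in>{B \<in> S. \<not> \<Phi> B \<and> \<not> \<Psi> B}. F B)"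
  proof -
    have split2: "sum F A = sum F {B \<in> A. Q B} + sum F {B \<in> A. \<not> Q B}" if "finite A" for A Q
      using that by (subst sum.union_disjoint[symmetric]) (auto intro!: sum.cong)
    show ?thesis
      using split2[OF assms(1), of \<Phi>] split2[of "{B \<in> S. \<not> \<Phi> B}" \<Psi>] assms(1) by (simp add: add.assoc)
  qed
  then show ?thesis using assms by (simp add: algebra_simps)
qed

section \<open>Cancellation of an orbit that is through on one side only\<close>

lemma sum_weight_fix_neq:
  assumes fin: "finite V" and PV: "P \<subseteq> V" "Q \<subseteq> V" and st: "\<tau> ` P = P" "\<tau> ` Q = Q"
    and cards: "card {x \<in> P. \<tau> x = x} = s2" "card {x \<in> Q. \<tau> x = x} = s2"
    and c: "c \<in> P" "c \<notin> Q" "\<tau> c = c" and D: "D \<in> stable_partitions \<tau> (V - {c, \<tau> c})"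
  shows "(\<Sum>C\<in>insert {} (fix_blocks \<tau> D). weight s1 s2 P Q (extend_fix c (\<tau> c) D C)) = 0"
proof -
  define R where "R = P - {c, \<tau> c}"
  have R: "P - {c, \<tau> c} = R" "P - {c} = R" using c by (auto simp: R_def)
  have stR: "\<tau> ` R = R" unfolding R_def image_set_diff[OF inj_\<tau>] st(1) using c by simp
  note D' = stable_partitionsD[OF D]
  have finD: "finite D" using finite_block_set[OF _ D] fin by simp
  have finF: "finite (fix_blocks \<tau> D)" using finD fix_blocks_subset finite_subset by blast
  have CD: "C \<in> insert {} D" if "C \<in> insert {} (fix_blocks \<tau> D)" for C using that fix_blocks_subset by auto
  have sepP: "separated (extend_fix c (\<tau> c) D C) P \<longleftrightarrow> separated D R \<and> C \<inter> R = {}"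
    if "C \<in> insert {} (fix_blocks \<tau> D)" for C
    using separated_extend_fix(2)[OF D CD[OF that] c(1,3)] unfolding R by simp
  have sepQ: "separated (extend_fix c (\<tau> c) D C) Q \<longleftrightarrow> separated D Q"
    if "C \<in> insert {} (fix_blocks \<tau> D)" for C
    using separated_extend_fix(1)[OF D CD[OF that], of Q] c by simp
  show ?thesis
  proof (cases "separated D R \<and> separated D Q")
    case False
    then show ?thesis using sepP sepQ by (intro sum.neutral) (auto simp: weight_def)
  next
    case True
    let ?F = "fix_blocks \<tau> D"
    define t where "t = card {B \<in> ?F. B \<inter> R \<noteq> {} \<and> B \<inter> Q = {}}"
    define n where "n = card ?F - s2"
    define We where "We = weight_e s1 (card (free_blocks \<tau> D) div 2 - s1)
      (card {B \<in> free_blocks \<tau> D. B \<inter> R \<noteq> {} \<and> B \<inter> Q = {}} div 2)"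
    have "{x \<in> P. \<tau> x = x} = insert c {x \<in> R. \<tau> x = x}" using c by (auto simp: R_def)
    moreover have "finite R" "c \<notin> R" using fin PV finite_subset by (auto simp: R_def)
    ultimately have cR: "Suc (card {x \<in> R. \<tau> x = x}) = s2" using cards(1) by simp
    have sub: "R \<subseteq> V - {c, \<tau> c}" "Q \<subseteq> V - {c, \<tau> c}" using PV c by (auto simp: R_def)
    note m = card_fix_meeting(1)[OF D sub(1) stR] card_fix_meeting(1)[OF D sub(2) st(2)]
    note sp = card_filter_split[OF finF, where \<Phi> = "\<lambda>B. B \<inter> R \<noteq> {}" and \<Psi> = "\<lambda>B. B \<inter> Q \<noteq> {}", simplified]
    \<comment> \<open>\<open>R\<close> has one fixed point fewer than \<open>Q\<close>, and the
      blocks that meet both sets are counted for each. So there is one more block that meets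
      \<open>Q\<close> only than there are blocks that meet \<open>R\<close> only.\<close>
    have c1: "card {B \<in> ?F. B \<inter> R = {} \<and> B \<inter> Q \<noteq> {}} = Suc t"
      using sp m True cR cards(2) by (simp add: t_def)
    have c2: "card ?F = s2 + t + card {B \<in> ?F. B \<inter> R = {} \<and> B \<inter> Q = {}}"
      using sp m True cR cards(2) by (simp add: t_def)
    \<comment> \<open>Joining a block that meets \<open>Q\<close> produces a block that is through
      on both sides, so \<open>t\<close> stays. A new block, or a block that meets neither set,
      becomes through for \<open>P\<close> only and raises \<open>t\<close>.\<close>
    have w: "weight s1 s2 P Q (extend_fix c (\<tau> c) D C) = (if C \<inter> R \<noteq> {} then 0 else We *
        weight_z s2 (if C = {} then Suc n else n) (if C \<inter> Q = {} then Suc t else t))"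
      if C: "C \<in> insert {} ?F" for C
    proof (cases "C \<inter> R = {}")
      case False
      then show ?thesis using sepP[OF C] by (simp add: weight_def)
    next
      case CR: True
      note we = weight_extend_fix(1,2)[OF fin D C] weight_extend_fix(3,4)[OF fin D C, of P Q, unfolded R]
      have "(C \<union> {c, \<tau> c}) \<inter> P \<noteq> {}" "(C \<union> {c, \<tau> c}) \<inter> Q = {} \<longleftrightarrow> C \<inter> Q = {}" using c by auto
      moreover have "{B \<in> ?F. B \<inter> R \<noteq> {} \<and> B \<inter> Q = {}} - {C} = {B \<in> ?F. B \<inter> R \<noteq> {} \<and> B \<inter> Q = {}}"
        using CR by auto
      moreover have "card (fix_blocks \<tau> (extend_fix c (\<tau> c) D C)) - s2 = (if C = {} then Suc n else n)"
        using we(2) c c2 by (simp add: n_def)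
      ultimately show ?thesis
        using we c CR sepP[OF C] sepQ[OF C] True
        by (simp add: weight_def We_def t_def)
    qed
    have "(\<Sum>C\<in>insert {} ?F. weight s1 s2 P Q (extend_fix c (\<tau> c) D C)) =
        weight s1 s2 P Q (extend_fix c (\<tau> c) D {}) +
        of_nat (card {B \<in> ?F. \<not> B \<inter> R \<noteq> {} \<and> \<not> B \<inter> Q \<noteq> {}}) * (We * weight_z s2 n (Suc t)) +
        of_nat (card {B \<in> ?F. \<not> B \<inter> R \<noteq> {} \<and> B \<inter> Q \<noteq> {}}) * (We * weight_z s2 n t)"
    proof (rule sum_filter_split[OF finF])
      show nF: "{} \<notin> ?F" using D'(3) fix_blocks_subset by auto
      fix B assume B: "B \<in> ?F"
      then have "B \<noteq> {}" "B \<in> insert {} ?F" using nF by auto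
      note wB = w[OF this(2)]
      show "B \<inter> R \<noteq> {} \<Longrightarrow> weight s1 s2 P Q (extend_fix c (\<tau> c) D B) = 0" using wB by simp
      show "\<not> B \<inter> R \<noteq> {} \<Longrightarrow> B \<inter> Q \<noteq> {} \<Longrightarrow> weight s1 s2 P Q (extend_fix c (\<tau> c) D B) = We * weight_z s2 n t"
        using wB \<open>B \<noteq> {}\<close> by simp
      show "\<not> B \<inter> R \<noteq> {} \<Longrightarrow> \<not> B \<inter> Q \<noteq> {} \<Longrightarrow> weight s1 s2 P Q (extend_fix c (\<tau> c) D B) = We * weight_z s2 n (Suc t)"
        using wB \<open>B \<noteq> {}\<close> by simp
    qed
    also have "\<dots> = We * (weight_z s2 (Suc n) (Suc t) + of_nat (1 * (n - t)) * weight_z s2 n (Suc t)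
        + of_nat (1 * Suc t) * weight_z s2 n t)"
      using w[of "{}"] c1 c2 by (simp add: n_def algebra_simps)
    also have "\<dots> = 0"
      using weight_gen_rec[of t n 1 var_x s2] c2 by (simp add: n_def)
    finally show ?thesis .
  qed
qed

text \<open>The same cancellation with two blocks per class. Insertions into a fixed block vanish
  one by one, because \<open>c\<close> and \<open>\<tau> c\<close> are two points of
  \<open>P\<close> in the same block.\<close>

lemma sum_weight_free_neq:
  assumes fin: "finite V" and PV: "P \<subseteq> V" "Q \<subseteq> V" and st: "\<tau> ` P = P" "\<tau> ` Q = Q"
    and cards: "card {x \<in> P. \<tau> x \<noteq> x} = 2 * s1" "card {x \<in> Q. \<tau> x \<noteq> x} = 2 * s1"
    and c: "c \<in> P" "c \<notin> Q" "\<tau> c \<noteq> c" and D: "D \<in> stable_partitions \<tau> (V - {c, \<tau> c})"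
  shows "(\<Sum>C\<in>insert {} (fix_blocks \<tau> D). weight s1 s2 P Q (extend_fix c (\<tau> c) D C)) = 0"
    "(\<Sum>C\<in>insert {} (free_blocks \<tau> D). weight s1 s2 P Q (extend_free \<tau> c D C)) = 0"
proof -
  have tc: "\<tau> c \<in> P" "\<tau> c \<notin> Q" using c st by (metis imageI, metis mem_image_iff)
  note D' = stable_partitionsD[OF D]
  have finD: "finite D" using finite_block_set[OF _ D] fin by simp
  have finF: "finite (free_blocks \<tau> D)" using finD free_blocks_subset finite_subset by blast
  show "(\<Sum>C\<in>insert {} (fix_blocks \<tau> D). weight s1 s2 P Q (extend_fix c (\<tau> c) D C)) = 0"
  proof (rule sum.neutral, rule ballI)
    fix C assume "C \<in> insert {} (fix_blocks \<tau> D)"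
    then have "C \<in> insert {} D" using fix_blocks_subset by auto
    then show "weight s1 s2 P Q (extend_fix c (\<tau> c) D C) = 0"
      using separated_extend_fix(3)[OF D _ c(1) tc(1) c(3)] by (simp add: weight_def)
  qed
  define R where "R = P - {c, \<tau> c}"
  have stR: "\<tau> ` R = R" unfolding R_def image_set_diff[OF inj_\<tau>] st(1) by auto
  have CD: "C \<in> insert {} D" "C \<noteq> \<tau> ` C \<or> C = {}" if "C \<in> insert {} (free_blocks \<tau> D)" for C
    using that free_blocks_subset by (auto simp: free_blocks_def)
  have sepP: "separated (extend_free \<tau> c D C) P \<longleftrightarrow> separated D R \<and> C \<inter> R = {}"
    if "C \<in> insert {} (free_blocks \<tau> D)" for C
    using separated_extend_free(2)[OF D CD(1)[OF that] c(3) st(1) c(1) CD(2)[OF that]] unfolding R_def .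
  have sepQ: "separated (extend_free \<tau> c D C) Q \<longleftrightarrow> separated D Q"
    if "C \<in> insert {} (free_blocks \<tau> D)" for C
    using separated_extend_free(1)[OF D CD(1)[OF that] c(3) st(2) c(2)] .
  show "(\<Sum>C\<in>insert {} (free_blocks \<tau> D). weight s1 s2 P Q (extend_free \<tau> c D C)) = 0"
  proof (cases "separated D R \<and> separated D Q")
    case False
    then show ?thesis using sepP sepQ by (intro sum.neutral) (auto simp: weight_def)
  next
    case True
    let ?F = "free_blocks \<tau> D"
    \<comment> \<open>\<open>t\<close> and \<open>n\<close> count pairs, whereas the sum runs over
      single blocks; the resulting multiplicities 2 (n - t) and 2 (t + 1) are those of
      \<open>weight_gen_rec\<close> for \<open>a = 2\<close>.\<close>
    define t where "t = card (block_pairs \<tau> {B \<in> D. B \<inter> R \<noteq> {} \<and> B \<inter> Q = {}})"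
    define n where "n = card (block_pairs \<tau> D) - s1"
    define Wz where "Wz = weight_z s2 (card (fix_blocks \<tau> D) - s2)
      (card {B \<in> fix_blocks \<tau> D. B \<inter> R \<noteq> {} \<and> B \<inter> Q = {}})"
    have t2: "card {B \<in> ?F. B \<inter> R \<noteq> {} \<and> B \<inter> Q = {}} = 2 * t"
      unfolding t_def by (rule block_pairs_filter[OF _ finD D'(2)])
        (simp_all add: image_Int_empty_iff[OF stR] image_Int_empty_iff[OF st(2)])
    have n2: "card ?F = 2 * card (block_pairs \<tau> D)"
      by (rule card_free_blocks[OF finD D'(2)])
    have "{x \<in> P. \<tau> x \<noteq> x} = insert c (insert (\<tau> c) {x \<in> R. \<tau> x \<noteq> x})" using c tc by (auto simp: R_def)
    moreover have "finite R" "c \<notin> R" "\<tau> c \<notin> R" using fin PV finite_subset by (auto simp: R_def)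
    ultimately have cR: "card {x \<in> R. \<tau> x \<noteq> x} + 2 = 2 * s1" using cards(1) c by simp
    have sub: "R \<subseteq> V - {c, \<tau> c}" "Q \<subseteq> V - {c, \<tau> c}" using PV c tc by (auto simp: R_def)
    note m = card_fix_meeting(2)[OF D sub(1) stR] card_fix_meeting(2)[OF D sub(2) st(2)]
    note sp = card_filter_split[OF finF, where \<Phi> = "\<lambda>B. B \<inter> R \<noteq> {}" and \<Psi> = "\<lambda>B. B \<inter> Q \<noteq> {}", simplified]
    have c1: "card {B \<in> ?F. B \<inter> R = {} \<and> B \<inter> Q \<noteq> {}} = 2 * Suc t"
      using sp m True cR cards(2) t2 by simp
    have c2: "card ?F = 2 * s1 + 2 * t + card {B \<in> ?F. B \<inter> R = {} \<and> B \<inter> Q = {}}"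
      using sp m True cR cards(2) t2 by simp
    have c3: "card {B \<in> ?F. B \<inter> R = {} \<and> B \<inter> Q = {}} = 2 * (n - t)" "t \<le> n" "s1 \<le> card (block_pairs \<tau> D)"
      using c2 n2 by (simp_all add: n_def)
    have w: "weight s1 s2 P Q (extend_free \<tau> c D C) = (if C \<inter> R \<noteq> {} then 0 else Wz *
        weight_e s1 (if C = {} then Suc n else n) (if C \<inter> Q = {} then Suc t else t))"
      if C: "C \<in> insert {} ?F" for C
    proof (cases "C \<inter> R = {}")
      case False
      then show ?thesis using sepP[OF C] by (simp add: weight_def)
    next
      case CR: True
      note we = weight_extend_free[OF fin D C c(3) st, folded R_def]
      have "insert c C \<inter> P \<noteq> {}" "insert c C \<inter> Q = {} \<longleftrightarrow> C \<inter> Q = {}" using c by auto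
      moreover have "{B \<in> ?F. B \<inter> R \<noteq> {} \<and> B \<inter> Q = {}} - {C, \<tau> ` C} = {B \<in> ?F. B \<inter> R \<noteq> {} \<and> B \<inter> Q = {}}"
        using CR image_Int_empty_iff[OF stR, of C] by blast
      ultimately have 1: "card {B \<in> free_blocks \<tau> (extend_free \<tau> c D C). B \<inter> P \<noteq> {} \<and> B \<inter> Q = {}} div 2 =
          (if C \<inter> Q = {} then Suc t else t)"
        using we(4) t2 by simp
      have 2: "card (free_blocks \<tau> (extend_free \<tau> c D C)) div 2 - s1 = (if C = {} then Suc n else n)"
        using we(2) c3(3) n2 by (simp add: n_def Suc_diff_le)
      have "separated (extend_free \<tau> c D C) P \<and> separated (extend_free \<tau> c D C) Q"
        using sepP[OF C] sepQ[OF C] True CR by simp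
      then show ?thesis
        unfolding weight_def 1 2 we(1,3) Wz_def using CR by (simp only: simp_thms if_True if_False mult.commute)
    qed
    have "(\<Sum>C\<in>insert {} ?F. weight s1 s2 P Q (extend_free \<tau> c D C)) =
        weight s1 s2 P Q (extend_free \<tau> c D {}) +
        of_nat (card {B \<in> ?F. \<not> B \<inter> R \<noteq> {} \<and> \<not> B \<inter> Q \<noteq> {}}) * (Wz * weight_e s1 n (Suc t)) +
        of_nat (card {B \<in> ?F. \<not> B \<inter> R \<noteq> {} \<and> B \<inter> Q \<noteq> {}}) * (Wz * weight_e s1 n t)"
    proof (rule sum_filter_split[OF finF])
      show nF: "{} \<notin> ?F" using D'(3) free_blocks_subset by auto
      fix B assume B: "B \<in> ?F"
      then have "B \<noteq> {}" "B \<in> insert {} ?F" using nF by auto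
      note wB = w[OF this(2)]
      show "B \<inter> R \<noteq> {} \<Longrightarrow> weight s1 s2 P Q (extend_free \<tau> c D B) = 0" using wB by simp
      show "\<not> B \<inter> R \<noteq> {} \<Longrightarrow> B \<inter> Q \<noteq> {} \<Longrightarrow> weight s1 s2 P Q (extend_free \<tau> c D B) = Wz * weight_e s1 n t"
        using wB \<open>B \<noteq> {}\<close> by simp
      show "\<not> B \<inter> R \<noteq> {} \<Longrightarrow> \<not> B \<inter> Q \<noteq> {} \<Longrightarrow> weight s1 s2 P Q (extend_free \<tau> c D B) = Wz * weight_e s1 n (Suc t)"
        using wB \<open>B \<noteq> {}\<close> by simp
    qed
    also have "\<dots> = Wz * weight_e s1 (Suc n) (Suc t) +
        of_nat (2 * (n - t)) * (Wz * weight_e s1 n (Suc t)) + of_nat (2 * Suc t) * (Wz * weight_e s1 n t)"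
      using w[of "{}"] c1 c3(1) by simp
    also have "\<dots> = Wz * (weight_e s1 (Suc n) (Suc t) + of_nat (2 * (n - t)) * weight_e s1 n (Suc t)
        + of_nat (2 * Suc t) * weight_e s1 n t)"
      by (simp only: distrib_left mult.left_commute)
    also have "\<dots> = 0"
      unfolding weight_gen_rec[OF c3(2)] by simp
    finally show ?thesis .
  qed
qed

section \<open>Horizontal orbits and the value of the sum\<close>

lemma sum_insert_const:
  assumes "finite S" "e \<notin> S"
  shows "(\<Sum>C\<in>insert e S. k * (if C = e then a else b)) = k * a + of_nat (card S) * (k * (b :: complex poly))"
proof -
  have "(\<Sum>C\<in>S. k * (if C = e then a else b)) = (\<Sum>C\<in>S. k * b)"
    using assms(2) by (intro sum.cong) auto
  then show ?thesis using assms by simp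
qed

text \<open>With m fixed blocks present, a new one has the factor x - m and each of the m joins the
  factor 1; with m free blocks the new pair has the factor x ^ 2 - x - m. The first claim covers
  free orbits too, so a free orbit is worth x + (x ^ 2 - x) = x ^ 2 altogether.\<close>

lemma sum_weight_eq:
  assumes fin: "finite V" and PV: "P \<subseteq> V" and st: "\<tau> ` P = P"
    and cards: "card {x \<in> P. \<tau> x = x} = s2" "card {x \<in> P. \<tau> x \<noteq> x} = 2 * s1"
    and c: "c \<notin> P" and D: "D \<in> stable_partitions \<tau> (V - {c, \<tau> c})"
  shows "(\<Sum>C\<in>insert {} (fix_blocks \<tau> D). weight s1 s2 P P (extend_fix c (\<tau> c) D C)) =
      var_x * weight s1 s2 P P D"
    "\<tau> c \<noteq> c \<Longrightarrow> (\<Sum>C\<in>insert {} (free_blocks \<tau> D). weight s1 s2 P P (extend_free \<tau> c D C)) =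
      (var_x\<^sup>2 - var_x) * weight s1 s2 P P D"
proof -
  have tc: "\<tau> c \<notin> P" using c st by (metis mem_image_iff)
  note D' = stable_partitionsD[OF D]
  have finD: "finite D" using finite_block_set[OF _ D] fin by simp
  have finF: "finite (free_blocks \<tau> D)" "finite (fix_blocks \<tau> D)" by (rule finite_subset[OF free_blocks_subset finD], rule finite_subset[OF fix_blocks_subset finD])
  have nF: "{} \<notin> fix_blocks \<tau> D" "{} \<notin> free_blocks \<tau> D"
    using D'(3) subsetD[OF fix_blocks_subset] subsetD[OF free_blocks_subset] by blast+
  have sub: "P \<subseteq> V - {c, \<tau> c}" using PV c tc by auto
  define We where "We = weight_e s1 (card (free_blocks \<tau> D) div 2 - s1) 0"
  define Wz where "Wz = weight_z s2 (card (fix_blocks \<tau> D) - s2) 0"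
  have w0: "weight s1 s2 P P E = (if separated E P then weight_e s1 (card (free_blocks \<tau> E) div 2 - s1) 0 *
      weight_z s2 (card (fix_blocks \<tau> E) - s2) 0 else 0)" for E
    unfolding weight_def by simp
  have sep1: "separated (extend_fix c (\<tau> c) D C) P \<longleftrightarrow> separated D P" if "C \<in> insert {} (fix_blocks \<tau> D)" for C
    using separated_extend_fix(1)[OF D _ c tc] that fix_blocks_subset by blast
  have sep2: "separated (extend_free \<tau> c D C) P \<longleftrightarrow> separated D P" if "C \<in> insert {} (free_blocks \<tau> D)" "\<tau> c \<noteq> c" for C
    using separated_extend_free(1)[OF D _ that(2) st c] that free_blocks_subset by blast
  \<comment> \<open>Separated through points lie in different blocks, so there are enough blocks for
    the truncated difference in \<open>weight\<close> to be a true one.\<close>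
  have M: "s2 \<le> card (fix_blocks \<tau> D)" if "separated D P"
    using card_fix_meeting(1)[OF D sub st that] cards(1) card_mono[OF finF(2), of "{B \<in> fix_blocks \<tau> D. B \<inter> P \<noteq> {}}"] by auto
  have N: "2 * s1 \<le> card (free_blocks \<tau> D)" if "separated D P"
    using card_fix_meeting(2)[OF D sub st that] cards(2) card_mono[OF finF(1), of "{B \<in> free_blocks \<tau> D. B \<inter> P \<noteq> {}}"] by auto
  have N2: "card (free_blocks \<tau> D) = 2 * (card (free_blocks \<tau> D) div 2)"
    using card_free_blocks[OF finD D'(2)] by simp
  show "(\<Sum>C\<in>insert {} (fix_blocks \<tau> D). weight s1 s2 P P (extend_fix c (\<tau> c) D C)) = var_x * weight s1 s2 P P D"
  proof (cases "separated D P")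
    case False
    then show ?thesis using sep1 by (simp add: w0)
  next
    case True
    have "weight s1 s2 P P (extend_fix c (\<tau> c) D C) = We * (if C = {} then (var_x - of_nat (card (fix_blocks \<tau> D))) * Wz else Wz)"
      if "C \<in> insert {} (fix_blocks \<tau> D)" for C
      using weight_extend_fix(1,2)[OF fin D that] c tc sep1[OF that] True M[OF True]
        weight_gen_Suc_0[of 1 var_x s2 "card (fix_blocks \<tau> D) - s2"]
      by (simp add: w0 We_def Wz_def Suc_diff_le)
    then have "(\<Sum>C\<in>insert {} (fix_blocks \<tau> D). weight s1 s2 P P (extend_fix c (\<tau> c) D C)) =
        (\<Sum>C\<in>insert {} (fix_blocks \<tau> D). We * (if C = {} then (var_x - of_nat (card (fix_blocks \<tau> D))) * Wz else Wz))"
      by (rule sum.cong[OF refl])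
    also have "\<dots> = We * ((var_x - of_nat (card (fix_blocks \<tau> D))) * Wz) + of_nat (card (fix_blocks \<tau> D)) * (We * Wz)"
      by (rule sum_insert_const[OF finF(2) nF(1)])
    also have "\<dots> = var_x * (We * Wz)" by (simp add: algebra_simps)
    finally show ?thesis using True by (simp add: w0 We_def Wz_def)
  qed
  assume ne: "\<tau> c \<noteq> c"
  show "(\<Sum>C\<in>insert {} (free_blocks \<tau> D). weight s1 s2 P P (extend_free \<tau> c D C)) = (var_x\<^sup>2 - var_x) * weight s1 s2 P P D"
  proof (cases "separated D P")
    case False
    then show ?thesis using sep2 ne by (simp add: w0)
  next
    case True
    have *: "2 * (s1 + (card (free_blocks \<tau> D) div 2 - s1)) = card (free_blocks \<tau> D)"
      "Suc (card (free_blocks \<tau> D) div 2) - s1 = Suc (card (free_blocks \<tau> D) div 2 - s1)"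
    proof -
      have "s1 \<le> card (free_blocks \<tau> D) div 2" using N[OF True] by linarith
      then show "2 * (s1 + (card (free_blocks \<tau> D) div 2 - s1)) = card (free_blocks \<tau> D)"
        "Suc (card (free_blocks \<tau> D) div 2) - s1 = Suc (card (free_blocks \<tau> D) div 2 - s1)"
        by (simp_all only: le_add_diff_inverse N2[symmetric] Suc_diff_le)
    qed
    have "weight s1 s2 P P (extend_free \<tau> c D C) = Wz * (if C = {} then (var_x\<^sup>2 - var_x - of_nat (card (free_blocks \<tau> D))) * We else We)"
      if "C \<in> insert {} (free_blocks \<tau> D)" for C
      using weight_extend_free(1,2)[OF fin D that ne st st] sep2[OF that ne] True
        weight_gen_Suc_0[of 2 "var_x\<^sup>2 - var_x" s1 "card (free_blocks \<tau> D) div 2 - s1"]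
      unfolding * by (simp add: w0 We_def Wz_def * mult.commute)
    then have "(\<Sum>C\<in>insert {} (free_blocks \<tau> D). weight s1 s2 P P (extend_free \<tau> c D C)) =
        (\<Sum>C\<in>insert {} (free_blocks \<tau> D). Wz * (if C = {} then (var_x\<^sup>2 - var_x - of_nat (card (free_blocks \<tau> D))) * We else We))"
      by (rule sum.cong[OF refl])
    also have "\<dots> = Wz * ((var_x\<^sup>2 - var_x - of_nat (card (free_blocks \<tau> D))) * We) + of_nat (card (free_blocks \<tau> D)) * (Wz * We)"
      by (rule sum_insert_const[OF finF(1) nF(2)])
    also have "\<dots> = (var_x\<^sup>2 - var_x) * (Wz * We)" by (simp add: algebra_simps)
    finally show ?thesis using True by (simp add: w0 We_def Wz_def mult.commute)
  qed
qed

text \<open>If every point is through, only the partition into singletons is separated. It has no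
  horizontal class and no exchanged class, so its weight is an empty product.\<close>

lemma sum_weight_all:
  assumes fin: "finite P" and st: "\<tau> ` P = P"
    and cards: "card {x \<in> P. \<tau> x = x} = s2" "card {x \<in> P. \<tau> x \<noteq> x} = 2 * s1"
  shows "(\<Sum>D\<in>stable_partitions \<tau> P. weight s1 s2 P P D) = 1"
proof -
  let ?S = "(\<lambda>x. {x}) ` P"
  have S: "?S \<in> stable_partitions \<tau> P"
    unfolding stable_partitions_def using partition_on_singletons st by auto
  have sep: "separated ?S P" by (auto simp: separated_def)
  have eq: "D = ?S" if D: "D \<in> stable_partitions \<tau> P" "separated D P" for D
  proof -
    note D' = stable_partitionsD[OF D(1)]
    have 1: "\<exists>x\<in>P. B = {x}" if B: "B \<in> D" for B
    proof -
      obtain x where "x \<in> B" using D'(3) \<open>B \<in> D\<close> by blast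
      moreover have "B \<subseteq> P" using D'(4)[OF B] .
      ultimately have "x \<in> P" "B = {x}" using D(2) B unfolding separated_def by blast+
      then show ?thesis by blast
    qed
    have "{x} \<in> D" if "x \<in> P" for x
      using 1 block_of_in[OF D'(1) that] by force
    with 1 show ?thesis by auto
  qed
  have full: "{B \<in> fix_blocks \<tau> ?S. B \<inter> P \<noteq> {}} = fix_blocks \<tau> ?S" "{B \<in> free_blocks \<tau> ?S. B \<inter> P \<noteq> {}} = free_blocks \<tau> ?S"
    by (auto simp: fix_blocks_def free_blocks_def)
  have "card (fix_blocks \<tau> ?S) = s2" "card (free_blocks \<tau> ?S) = 2 * s1"
    using card_fix_meeting[OF S subset_refl st sep] unfolding full cards by auto
  then have 1: "weight s1 s2 P P ?S = 1"
    using sep by (simp add: weight_def weight_gen_def)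
  have "(\<Sum>D\<in>stable_partitions \<tau> P. weight s1 s2 P P D) = (\<Sum>D\<in>{?S}. weight s1 s2 P P D)"
  proof (rule sum.mono_neutral_right)
    show "\<forall>D\<in>stable_partitions \<tau> P - {?S}. weight s1 s2 P P D = 0"
      using eq by (auto simp: weight_def)
  qed (use S finite_stable_partitions[OF fin] in auto)
  then show ?thesis using 1 by simp
qed

text \<open>Induction on the number of horizontal points, one orbit at a time; an orbit contributes
  x to the power of its size.\<close>

lemma sum_weight_same:
  assumes "finite V" "\<tau> ` V = V" "P \<subseteq> V" "\<tau> ` P = P"
    and "card {x \<in> P. \<tau> x = x} = s2" "card {x \<in> P. \<tau> x \<noteq> x} = 2 * s1"
  shows "(\<Sum>D\<in>stable_partitions \<tau> V. weight s1 s2 P P D) = var_x ^ card (V - P)"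
  using assms
proof (induction "card (V - P)" arbitrary: V rule: less_induct)
  case less
  show ?case
  proof (cases "V = P")
    case True
    then show ?thesis using sum_weight_all less.prems by simp
  next
    case False
    then obtain c where c: "c \<in> V" "c \<notin> P" using less.prems by auto
    then have tc: "\<tau> c \<in> V" "\<tau> c \<notin> P" using less.prems mem_image_iff by (metis imageI, metis)
    let ?V = "V - {c, \<tau> c}"
    have V': "finite ?V" "\<tau> ` ?V = ?V" "P \<subseteq> ?V"
      using less.prems(1,2,3) c tc by (auto simp: image_set_diff[OF inj_\<tau>])
    have card: "card (V - P) = card (?V - P) + (if \<tau> c = c then 1 else 2)"
    proof -
      have "V - P = (?V - P) \<union> {c, \<tau> c}" using c tc by auto
      moreover have "card ((?V - P) \<union> {c, \<tau> c}) = card (?V - P) + card {c, \<tau> c}"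
        using less.prems(1) by (intro card_Un_disjoint) auto
      ultimately show ?thesis by auto
    qed
    then have IH: "(\<Sum>D\<in>stable_partitions \<tau> ?V. weight s1 s2 P P D) = var_x ^ card (?V - P)"
      using less.hyps[OF _ V' less.prems(4-6)] by simp
    have "(\<Sum>D\<in>stable_partitions \<tau> V. weight s1 s2 P P D) = (\<Sum>D\<in>stable_partitions \<tau> ?V.
        (if \<tau> c = c then var_x else var_x\<^sup>2) * weight s1 s2 P P D)"
      unfolding sum_stable_partitions_delete[OF less.prems(1) c(1) tc(1)]
      using sum_weight_eq[OF less.prems(1,3-6) c(2)] by (intro sum.cong[OF refl]) (simp add: algebra_simps)
    also have "\<dots> = (if \<tau> c = c then var_x else var_x\<^sup>2) * var_x ^ card (?V - P)"
      by (simp only: sum_distrib_left[symmetric] IH)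
    also have "\<dots> = var_x ^ card (V - P)"
      unfolding card by (simp add: power_add power2_eq_square mult.commute)
    finally show ?thesis .
  qed
qed

text \<open>For different sets the equal class counts give equal cardinalities, so some point of
  \<open>P\<close> is outside \<open>Q\<close>. Deleting its orbit already makes every inner sum
  vanish, and no induction takes place.\<close>

theorem sum_weight:
  assumes "finite V" "\<tau> ` V = V" "P \<subseteq> V" "\<tau> ` P = P" "Q \<subseteq> V" "\<tau> ` Q = Q"
    and "card {x \<in> P. \<tau> x = x} = s2" "card {x \<in> P. \<tau> x \<noteq> x} = 2 * s1"
    and "card {x \<in> Q. \<tau> x = x} = s2" "card {x \<in> Q. \<tau> x \<noteq> x} = 2 * s1"
  shows "(\<Sum>D\<in>stable_partitions \<tau> V. weight s1 s2 P Q D) = (if P = Q then var_x ^ card (V - P) else 0)"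
proof (cases "P = Q")
  case True
  then show ?thesis using sum_weight_same assms by simp
next
  case False
  have fin: "finite P" "finite Q" using assms finite_subset by auto
  have split: "card R = card {x \<in> R. \<tau> x = x} + card {x \<in> R. \<tau> x \<noteq> x}" if "finite R" for R
    using that by (subst card_Un_disjoint[symmetric]) (auto intro!: arg_cong[of _ _ card])
  have "card P = card Q" using split[OF fin(1)] split[OF fin(2)] assms by simp
  then have "\<not> P \<subseteq> Q" using False card_subset_eq[OF fin(2), of P] by auto
  then obtain c where c: "c \<in> P" "c \<notin> Q" by auto
  have V: "c \<in> V" "\<tau> c \<in> V" using c assms(2,3) by auto
  have "(\<Sum>D\<in>stable_partitions \<tau> V. weight s1 s2 P Q D) = 0"
    unfolding sum_stable_partitions_delete[OF assms(1) V]
  proof (rule sum.neutral, rule ballI)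
    fix D assume D: "D \<in> stable_partitions \<tau> (V - {c, \<tau> c})"
    show "(\<Sum>C\<in>insert {} (fix_blocks \<tau> D). weight s1 s2 P Q (extend_fix c (\<tau> c) D C)) +
      (if \<tau> c = c then 0 else \<Sum>C\<in>insert {} (free_blocks \<tau> D). weight s1 s2 P Q (extend_free \<tau> c D C)) = 0"
    proof (cases "\<tau> c = c")
      case True
      then show ?thesis
        using sum_weight_fix_neq[OF assms(1,3,5,4,6,7,9) c True D] by simp
    next
      case False
      then show ?thesis
        using sum_weight_free_neq[OF assms(1,3,5,4,6,8,10) c False D] by simp
    qed
  qed
  then show ?thesis using False by simp
qed

end

section \<open>Coarsenings of a stable partition\<close>

text \<open>The first argument is the coarser partition.\<close>

definition refined_by :: "'a set set \<Rightarrow> 'a set set \<Rightarrow> bool" where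
  "refined_by D d \<longleftrightarrow> (\<forall>C\<in>d. \<exists>B\<in>D. C \<subseteq> B)"

definition lift :: "'a set set \<Rightarrow> 'a set set \<Rightarrow> 'a set set" where
  "lift D P = {B \<in> D. \<exists>C\<in>P. C \<subseteq> B}"

definition unmerged :: "'a set set \<Rightarrow> 'a set set \<Rightarrow> bool" where
  "unmerged D P \<longleftrightarrow> (\<forall>B\<in>D. \<forall>C\<in>P. \<forall>C'\<in>P. C \<subseteq> B \<longrightarrow> C' \<subseteq> B \<longrightarrow> C = C')"

lemma refined_by_refl: "refined_by d d"
  by (auto simp: refined_by_def)

lemma refined_by_trans: "refined_by D E \<Longrightarrow> refined_by E d \<Longrightarrow> refined_by D d"
  unfolding refined_by_def by (meson order_trans)

lemma refined_block:
  assumes "partition_on V D" "partition_on V d" "refined_by D d" "C \<in> d" "B \<in> D" "x \<in> C" "x \<in> B"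
  shows "C \<subseteq> B"
proof -
  obtain B' where "B' \<in> D" "C \<subseteq> B'" using assms(3,4) by (auto simp: refined_by_def)
  then show ?thesis using partition_block_eq[OF assms(1) _ assms(5)] assms(6,7) by blast
qed

lemma lift_refined:
  assumes "partition_on V D" "partition_on V d" "refined_by D d"
  shows "lift D d = D"
proof -
  have "\<exists>C\<in>d. C \<subseteq> B" if B: "B \<in> D" for B
  proof -
    have "B \<noteq> {}" using B partition_onD3[OF assms(1)] by auto
    then obtain x where x: "x \<in> B" by blast
    then have "x \<in> \<Union>d" using B partition_onD1[OF assms(1)] partition_onD1[OF assms(2)] by blast
    then obtain C where C: "C \<in> d" "x \<in> C" by (rule UnionE)
    then show ?thesis using refined_block[OF assms C(1) B C(2) x] by blast
  qed
  then show ?thesis unfolding lift_def by blast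
qed


text \<open>A block of \<open>P\<close> lies in one block of \<open>E\<close>, and any block of
  \<open>D\<close> that contains the former contains the latter. With \<open>E\<close> the join of
  two partitions, this moves the through sets of both diagrams to the join.\<close>

lemma lift_lift:
  assumes "partition_on V D" "partition_on V E" "partition_on V d" "refined_by D E" "refined_by E d" "P \<subseteq> d"
  shows "lift D (lift E P) = lift D P"
proof -
  have "(\<exists>K\<in>lift E P. K \<subseteq> B) \<longleftrightarrow> (\<exists>C\<in>P. C \<subseteq> B)" if B: "B \<in> D" for B
  proof
    assume "\<exists>K\<in>lift E P. K \<subseteq> B"
    then obtain K C where "K \<subseteq> B" "C \<in> P" "C \<subseteq> K" by (auto simp: lift_def)
    then show "\<exists>C\<in>P. C \<subseteq> B" by blast
  next
    assume "\<exists>C\<in>P. C \<subseteq> B"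
    then obtain C where C: "C \<in> P" "C \<subseteq> B" by blast
    then have "C \<in> d" using assms(6) by auto
    then obtain K where K: "K \<in> E" "C \<subseteq> K" using assms(5) by (auto simp: refined_by_def)
    obtain x where x: "x \<in> C" using \<open>C \<in> d\<close> partition_onD3[OF assms(3)] by fastforce
    have "K \<subseteq> B" using refined_block[OF assms(1,2,4) K(1) B, of x] x K(2) C(2) by auto
    then show "\<exists>K\<in>lift E P. K \<subseteq> B" using K C(1) by (auto simp: lift_def)
  qed
  then show ?thesis unfolding lift_def[of D] by blast
qed

lemma unmerged_mono:
  assumes "refined_by D E" "unmerged D P"
  shows "unmerged E P"
  unfolding unmerged_def
proof (intro ballI impI)
  fix B C C' assume "B \<in> E" and C: "C \<in> P" "C' \<in> P" "C \<subseteq> B" "C' \<subseteq> B"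
  then obtain B' where "B' \<in> D" "B \<subseteq> B'" using assms(1) by (auto simp: refined_by_def)
  then show "C = C'" using C assms(2) unfolding unmerged_def by (meson order_trans)
qed

text \<open>As \<open>E\<close> merges nothing, different members of \<open>P\<close> give different
  members of \<open>lift E P\<close>; hence a merge in \<open>D\<close> is seen equally well before
  and after lifting to \<open>E\<close>.\<close>

lemma unmerged_lift:
  assumes "partition_on V D" "partition_on V E" "partition_on V d" "refined_by D E" "refined_by E d" "P \<subseteq> d"
    and "unmerged E P"
  shows "unmerged D (lift E P) \<longleftrightarrow> unmerged D P"
proof
  assume l: "unmerged D (lift E P)"
  show "unmerged D P" unfolding unmerged_def
  proof (intro ballI impI)
    fix B C C' assume B: "B \<in> D" and C: "C \<in> P" "C' \<in> P" "C \<subseteq> B" "C' \<subseteq> B"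
    have K: "\<exists>K\<in>lift E P. K \<subseteq> B \<and> C \<subseteq> K" if "C \<in> P" "C \<subseteq> B" for C
    proof -
      have "C \<in> d" using assms(6) that by auto
      then obtain K where K: "K \<in> E" "C \<subseteq> K" using assms(5) by (auto simp: refined_by_def)
      obtain x where x: "x \<in> C" using \<open>C \<in> d\<close> partition_onD3[OF assms(3)] by fastforce
      have "K \<subseteq> B" using refined_block[OF assms(1,2,4) K(1) B, of x] x K(2) that(2) by auto
      then show ?thesis using K that(1) by (auto simp: lift_def)
    qed
    obtain K K' where "K \<in> lift E P" "K \<subseteq> B" "C \<subseteq> K" "K' \<in> lift E P" "K' \<subseteq> B" "C' \<subseteq> K'"
      using K[OF C(1,3)] K[OF C(2,4)] by blast
    moreover from this have "K = K'" using l B unfolding unmerged_def by blast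
    moreover have "K \<in> E" using calculation(1) by (simp add: lift_def)
    ultimately show "C = C'" using assms(7) C(1,2) unfolding unmerged_def by blast
  qed
next
  assume r: "unmerged D P"
  show "unmerged D (lift E P)" unfolding unmerged_def
  proof (intro ballI impI)
    fix B K K' assume B: "B \<in> D" and K: "K \<in> lift E P" "K' \<in> lift E P" "K \<subseteq> B" "K' \<subseteq> B"
    then obtain C C' where C: "C \<in> P" "C \<subseteq> K" "C' \<in> P" "C' \<subseteq> K'" by (auto simp: lift_def)
    then have "C \<subseteq> B" "C' \<subseteq> B" using K(3,4) by blast+
    then have "C = C'" using r B C(1,3) unfolding unmerged_def by blast
    moreover obtain x where "x \<in> C" using C(1) assms(6) partition_onD3[OF assms(3)] by fastforce
    moreover have "K \<in> E" "K' \<in> E" using K(1,2) by (simp_all add: lift_def)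
    ultimately show "K = K'" using partition_block_eq[OF assms(2)] C(2,4) by blast
  qed
qed

lemma Collect_image_cong: "(\<And>F. F \<in> E \<Longrightarrow> \<Phi> (f F) \<longleftrightarrow> \<Psi> F) \<Longrightarrow> {B \<in> f ` E. \<Phi> B} = f ` {F \<in> E. \<Psi> F}"
  by blast

lemma Collect_subset_trans: "S \<subseteq> E \<Longrightarrow> {F \<in> S. \<Phi> F} \<subseteq> E"
  by blast

section \<open>Coarsenings as partitions of the set of blocks\<close>

context involution begin

text \<open>This allows \<open>sum_weight\<close> to be applied with blocks in the role of
  points.\<close>

lemma involution_image: "involution ((`) \<tau>)"
  by unfold_locales simp

lemma image_Union_blocks: "\<tau> ` \<Union>F = \<Union>((`) \<tau> ` F)"
  by (rule image_Union)

text \<open>Taking the union of a family of blocks loses nothing, because the blocks are disjoint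
  and nonempty. All translations between families of blocks and coarser blocks rest on this.\<close>

lemma Union_inj_blocks:
  assumes "partition_on V J" "F \<subseteq> J"
  shows "{K \<in> J. K \<subseteq> \<Union>F} = F"
proof (intro equalityI subsetI)
  fix K assume K: "K \<in> {K \<in> J. K \<subseteq> \<Union>F}"
  then obtain x where "x \<in> K" using partition_onD3[OF assms(1)] by fastforce
  then obtain K' where "x \<in> K'" "K' \<in> F" using K by auto
  then show "K \<in> F" using partition_block_eq[OF assms(1), of K K' x] K assms(2) \<open>x \<in> K\<close> by auto
qed (use assms(2) in blast)

lemma Union_blocks_eq_iff:
  assumes "partition_on V J" "F \<subseteq> J" "F' \<subseteq> J"
  shows "\<Union>F = \<Union>F' \<longleftrightarrow> F = F'"
  using Union_inj_blocks[OF assms(1,2)] Union_inj_blocks[OF assms(1,3)] by metis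

text \<open>The counterpart of \<open>weight\<close> for coarsenings: a class that meets
  \<open>P\<close> but not \<open>Q\<close> becomes a class in \<open>lift d P - lift d Q\<close>.
  Separation is not part of it; the sums are restricted to partitions that are unmerged for both
  sets.\<close>

definition coarse_weight :: "nat \<Rightarrow> nat \<Rightarrow> 'a set set \<Rightarrow> 'a set set \<Rightarrow> 'a set set \<Rightarrow> complex poly" where
  "coarse_weight s1 s2 P Q d =
     weight_e s1 (card (free_blocks \<tau> d) div 2 - s1) (card (free_blocks \<tau> (lift d P - lift d Q)) div 2) *
     weight_z s2 (card (fix_blocks \<tau> d) - s2) (card (fix_blocks \<tau> (lift d P - lift d Q)))"

context
  fixes V J
  assumes J: "J \<in> stable_partitions \<tau> V"
begin

lemma base_partition: "partition_on V J"
  and base_stable: "C \<in> J \<Longrightarrow> \<tau> ` C \<in> J"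
  using stable_partitionsD[OF J] by auto

lemma coarse_subset: "E \<in> stable_partitions ((`) \<tau>) J \<Longrightarrow> F \<in> E \<Longrightarrow> F \<subseteq> J"
  using involution.stable_partitionsD(4)[OF involution_image] .

lemma inj_on_Union: "E \<in> stable_partitions ((`) \<tau>) J \<Longrightarrow> inj_on Union E"
  using Union_blocks_eq_iff[OF base_partition] coarse_subset by (metis inj_onI)

lemma Union_coarse_mem:
  assumes E: "E \<in> stable_partitions ((`) \<tau>) J"
  shows "Union ` E \<in> stable_partitions \<tau> V" "refined_by (Union ` E) J"
proof -
  note E' = involution.stable_partitionsD[OF involution_image E]
  note sub = coarse_subset[OF E]
  have "partition_on V (Union ` E)"
  proof (rule partition_onI)
    show "\<Union>(Union ` E) = V"
      using partition_onD1[OF E'(1)] partition_onD1[OF base_partition] by auto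
    show "disjnt p q" if pq: "p \<in> Union ` E" "q \<in> Union ` E" "p \<noteq> q" for p q
    proof -
      obtain F F' where F: "p = \<Union>F" "q = \<Union>F'" "F \<in> E" "F' \<in> E" using pq by auto
      show ?thesis unfolding disjnt_iff
      proof (intro allI notI)
        fix x assume "x \<in> p \<and> x \<in> q"
        then obtain K K' where K: "x \<in> K" "K \<in> F" "x \<in> K'" "K' \<in> F'" using F by auto
        then have "K = K'" using partition_block_eq[OF base_partition] sub F by blast
        then have "F = F'" using partition_block_eq[OF E'(1) F(3,4)] K by auto
        then show False using pq F by simp
      qed
    qed
    show "{} \<notin> Union ` E"
    proof
      assume "{} \<in> Union ` E"
      then obtain F where "F \<in> E" "\<Union>F = {}" by auto
      moreover from this obtain K where "K \<in> F" using E'(3) by blast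
      moreover have "K \<in> J" using sub calculation by (meson subsetD)
      ultimately show False using partition_onD3[OF base_partition] by (metis Union_empty_conv)
    qed
  qed
  moreover have "\<tau> ` C \<in> Union ` E" if "C \<in> Union ` E" for C
    using that E'(2) image_Union_blocks by blast
  ultimately show "Union ` E \<in> stable_partitions \<tau> V" by (simp add: stable_partitions_def)
  have "\<exists>B\<in>Union ` E. C \<subseteq> B" if "C \<in> J" for C
  proof -
    have "C \<in> \<Union>E" using that partition_onD1[OF E'(1)] by simp
    then obtain F where "F \<in> E" "C \<in> F" by (rule UnionE)
    then show ?thesis by (intro bexI[of _ "\<Union>F"]) auto
  qed
  then show "refined_by (Union ` E) J" unfolding refined_by_def by simp
qed

text \<open>A coarsening is a way of grouping the blocks of \<open>J\<close>. The inverse map sends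
  a block to the set of blocks of \<open>J\<close> inside it, whose union is the whole
  block.\<close>

lemma bij_betw_coarse:
  "bij_betw ((`) Union) (stable_partitions ((`) \<tau>) J) {d \<in> stable_partitions \<tau> V. refined_by d J}"
proof (rule bij_betwI[where g = "\<lambda>d. (\<lambda>B. {K \<in> J. K \<subseteq> B}) ` d"])
  show "(`) Union \<in> stable_partitions ((`) \<tau>) J \<rightarrow> {d \<in> stable_partitions \<tau> V. refined_by d J}"
    using Union_coarse_mem by auto
  have inv: "\<Union>{K \<in> J. K \<subseteq> B} = B" if d: "d \<in> stable_partitions \<tau> V" "refined_by d J" "B \<in> d" for d B
  proof (intro equalityI subsetI)
    fix x assume x: "x \<in> B"
    then have "x \<in> V" using stable_partitionsD(4)[OF d(1,3)] by auto
    then obtain K where K: "K \<in> J" "x \<in> K" using partition_onD1[OF base_partition] by auto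
    then have "K \<subseteq> B" using refined_block[OF stable_partitionsD(1)[OF d(1)] base_partition d(2) _ d(3)] x by auto
    then show "x \<in> \<Union>{K \<in> J. K \<subseteq> B}" using K by auto
  qed auto
  show "(\<lambda>d. (\<lambda>B. {K \<in> J. K \<subseteq> B}) ` d) \<in> {d \<in> stable_partitions \<tau> V. refined_by d J} \<rightarrow> stable_partitions ((`) \<tau>) J"
  proof
    fix d assume "d \<in> {d \<in> stable_partitions \<tau> V. refined_by d J}"
    then have d: "d \<in> stable_partitions \<tau> V" "refined_by d J" by auto
    note d' = stable_partitionsD[OF d(1)]
    let ?E = "(\<lambda>B. {K \<in> J. K \<subseteq> B}) ` d"
    have Jne: "K \<noteq> {}" if "K \<in> J" for K using that partition_onD3[OF base_partition] by auto
    have "partition_on J ?E"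
    proof (rule partition_onI)
      show "\<Union>?E = J" using d(2) by (auto simp: refined_by_def)
      show "disjnt p q" if pq: "p \<in> ?E" "q \<in> ?E" "p \<noteq> q" for p q
      proof -
        obtain B B' where B: "p = {K \<in> J. K \<subseteq> B}" "q = {K \<in> J. K \<subseteq> B'}" "B \<in> d" "B' \<in> d" using pq by auto
        show ?thesis unfolding disjnt_iff
        proof (intro allI notI)
          fix K assume K: "K \<in> p \<and> K \<in> q"
          then obtain x where "x \<in> K" using Jne B by blast
          then have "B = B'" using partition_block_eq[OF d'(1) B(3,4), of x] K B by blast
          then show False using pq B by simp
        qed
      qed
      show "{} \<notin> ?E"
      proof
        assume "{} \<in> ?E"
        then obtain B where "B \<in> d" "{K \<in> J. K \<subseteq> B} = {}" by auto
        then have "B = {}" using inv[OF d] by blast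
        then show False using d'(3) \<open>B \<in> d\<close> by blast
      qed
    qed
    moreover have "(`) \<tau> ` {K \<in> J. K \<subseteq> B} = {K \<in> J. K \<subseteq> \<tau> ` B}" for B
    proof (intro equalityI subsetI)
      fix K assume "K \<in> {K \<in> J. K \<subseteq> \<tau> ` B}"
      then have "\<tau> ` K \<in> {K \<in> J. K \<subseteq> B}" using base_stable by (auto simp: subset_iff mem_image_iff)
      then show "K \<in> (`) \<tau> ` {K \<in> J. K \<subseteq> B}" by (metis imageI image_image_\<tau>)
    qed (use base_stable in blast)
    ultimately show "?E \<in> stable_partitions ((`) \<tau>) J"
      unfolding stable_partitions_def using d'(2) by auto
  qed
  show "(\<lambda>d. (\<lambda>B. {K \<in> J. K \<subseteq> B}) ` d) (Union ` E) = E" if E: "E \<in> stable_partitions ((`) \<tau>) J" for E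
  proof -
    have "{K \<in> J. K \<subseteq> \<Union>F} = F" if "F \<in> E" for F
      by (rule Union_inj_blocks[OF base_partition coarse_subset[OF E that]])
    then have "(\<lambda>F. {K \<in> J. K \<subseteq> \<Union>F}) ` E = (\<lambda>F. F) ` E" by (rule image_cong[OF refl])
    then show ?thesis unfolding image_image by simp
  qed
  show "Union ` (\<lambda>B. {K \<in> J. K \<subseteq> B}) ` d = d" if "d \<in> {d \<in> stable_partitions \<tau> V. refined_by d J}" for d
  proof -
    have "(\<lambda>B. \<Union>{K \<in> J. K \<subseteq> B}) ` d = (\<lambda>B. B) ` d" using that inv by (intro image_cong) auto
    then show ?thesis unfolding image_image by simp
  qed
qed

context
  fixes E
  assumes E: "E \<in> stable_partitions ((`) \<tau>) J"
begin

lemma Union_fixed_iff: "F \<in> E \<Longrightarrow> \<tau> ` \<Union>F = \<Union>F \<longleftrightarrow> (`) \<tau> ` F = F"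
  unfolding image_Union_blocks
  using coarse_subset[OF E] base_stable by (intro Union_blocks_eq_iff[OF base_partition]) blast+

lemma fix_blocks_coarse: "fix_blocks \<tau> (Union ` E) = Union ` fix_blocks ((`) \<tau>) E"
  unfolding fix_blocks_def by (rule Collect_image_cong) (rule Union_fixed_iff)

lemma free_blocks_coarse: "free_blocks \<tau> (Union ` E) = Union ` free_blocks ((`) \<tau>) E"
  unfolding free_blocks_def by (rule Collect_image_cong) (simp only: Union_fixed_iff)

lemma meets_coarse_iff:
  assumes "P \<subseteq> J" "F \<in> E"
  shows "(\<exists>C\<in>P. C \<subseteq> \<Union>F) \<longleftrightarrow> F \<inter> P \<noteq> {}"
proof
  assume "\<exists>C\<in>P. C \<subseteq> \<Union>F"
  then obtain C where "C \<in> P" "C \<subseteq> \<Union>F" by blast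
  moreover have "C \<in> F"
    using Union_inj_blocks[OF base_partition coarse_subset[OF E assms(2)]] calculation assms(1) by blast
  ultimately show "F \<inter> P \<noteq> {}" by blast
qed blast

lemma block_subset_iff:
  assumes "C \<in> J" "F \<in> E"
  shows "C \<subseteq> \<Union>F \<longleftrightarrow> C \<in> F"
  using Union_inj_blocks[OF base_partition coarse_subset[OF E assms(2)]] assms(1) by blast

lemma lift_coarse: "P \<subseteq> J \<Longrightarrow> F \<in> E \<Longrightarrow> \<Union>F \<in> lift (Union ` E) P \<longleftrightarrow> F \<inter> P \<noteq> {}"
  unfolding lift_def using meets_coarse_iff by auto

lemma unmerged_coarse_iff:
  assumes "P \<subseteq> J"
  shows "unmerged (Union ` E) P \<longleftrightarrow> separated E P"
proof -
  have "(\<forall>C\<in>P. \<forall>C'\<in>P. C \<subseteq> \<Union>F \<longrightarrow> C' \<subseteq> \<Union>F \<longrightarrow> C = C') \<longleftrightarrow> (\<forall>C\<in>F \<inter> P. \<forall>C'\<in>F \<inter> P. C = C')"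
    if "F \<in> E" for F
  proof -
    have "C \<subseteq> \<Union>F \<longleftrightarrow> C \<in> F" if "C \<in> P" for C
      using block_subset_iff[OF _ \<open>F \<in> E\<close>] assms that by (meson subsetD)
    then have "(\<forall>C\<in>P. \<forall>C'\<in>P. C \<subseteq> \<Union>F \<longrightarrow> C' \<subseteq> \<Union>F \<longrightarrow> C = C') \<longleftrightarrow>
        (\<forall>C\<in>P. \<forall>C'\<in>P. C \<in> F \<longrightarrow> C' \<in> F \<longrightarrow> C = C')"
      by (simp cong: ball_cong)
    then show ?thesis by blast
  qed
  then show ?thesis unfolding unmerged_def separated_def ball_simps(9) by (rule ball_cong[OF refl])
qed

lemma card_coarse_filter:
  assumes "S \<subseteq> E" "P \<subseteq> J" "Q \<subseteq> J"
  shows "card {B \<in> Union ` S. B \<in> lift (Union ` E) P \<and> B \<notin> lift (Union ` E) Q} = card {F \<in> S. F \<inter> P \<noteq> {} \<and> F \<inter> Q = {}}"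
proof -
  have "{B \<in> Union ` S. B \<in> lift (Union ` E) P \<and> B \<notin> lift (Union ` E) Q} = Union ` {F \<in> S. F \<inter> P \<noteq> {} \<and> F \<inter> Q = {}}"
    by (rule Collect_image_cong) (use lift_coarse assms in \<open>simp add: subset_iff\<close>)
  then show ?thesis
    using card_image[OF inj_on_subset[OF inj_on_Union[OF E], of "{F \<in> S. F \<inter> P \<noteq> {} \<and> F \<inter> Q = {}}"]] assms(1)
    by (simp add: Collect_subset_trans)
qed

lemma card_coarse_lift:
  assumes "S \<subseteq> E" "P \<subseteq> J"
  shows "card {B \<in> Union ` S. B \<in> lift (Union ` E) P} = card {F \<in> S. F \<inter> P \<noteq> {}}"
  using card_coarse_filter[OF assms, of "{}"] by (simp add: lift_def)

end

text \<open>\<open>sum_weight\<close> transported along \<open>bij_betw_coarse\<close>; the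
  separation test in \<open>blk.weight\<close> turns into the restriction of the range of
  summation.\<close>

lemma sum_coarse_weight:
  assumes "finite V" "P \<subseteq> J" "Q \<subseteq> J" "\<And>C. C \<in> P \<Longrightarrow> \<tau> ` C \<in> P" "\<And>C. C \<in> Q \<Longrightarrow> \<tau> ` C \<in> Q"
    and "card (fix_blocks \<tau> P) = s2" "card (free_blocks \<tau> P) = 2 * s1"
    and "card (fix_blocks \<tau> Q) = s2" "card (free_blocks \<tau> Q) = 2 * s1"
  shows "(\<Sum>d | d \<in> stable_partitions \<tau> V \<and> refined_by d J \<and> unmerged d P \<and> unmerged d Q. coarse_weight s1 s2 P Q d) =
    (if P = Q then var_x ^ card (J - P) else 0)"
proof -
  interpret blk: involution "(`) \<tau>" by (rule involution_image)
  let ?S = "stable_partitions ((`) \<tau>) J"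
  have finJ: "finite J" using finite_block_set[OF assms(1) J] .
  have st: "(`) \<tau> ` W = W" if "\<And>C. C \<in> W \<Longrightarrow> \<tau> ` C \<in> W" for W :: "'a set set"
    using that image_image_\<tau> by blast
  have w: "blk.weight s1 s2 P Q E = (if unmerged (Union ` E) P \<and> unmerged (Union ` E) Q then
      coarse_weight s1 s2 P Q (Union ` E) else 0)" if E: "E \<in> ?S" for E
  proof -
    note cc = card_image[OF inj_on_subset[OF inj_on_Union[OF E]]]
    have sub: "fix_blocks ((`) \<tau>) E \<subseteq> E" "free_blocks ((`) \<tau>) E \<subseteq> E" by (auto simp: fix_blocks_def free_blocks_def)
    have 1: "free_blocks \<tau> (lift d P - lift d Q) = {B \<in> free_blocks \<tau> d. B \<in> lift d P \<and> B \<notin> lift d Q}"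
      "fix_blocks \<tau> (lift d P - lift d Q) = {B \<in> fix_blocks \<tau> d. B \<in> lift d P \<and> B \<notin> lift d Q}" for d
      by (auto simp: free_blocks_def fix_blocks_def lift_def)
    show ?thesis
      unfolding blk.weight_def coarse_weight_def unmerged_coarse_iff[OF E assms(2)] unmerged_coarse_iff[OF E assms(3)] 1
      unfolding fix_blocks_coarse[OF E] free_blocks_coarse[OF E]
        card_coarse_filter[OF E sub(1) assms(2,3)] card_coarse_filter[OF E sub(2) assms(2,3)]
        cc[OF sub(1)] cc[OF sub(2)] ..
  qed
  have finS: "finite {d \<in> stable_partitions \<tau> V. refined_by d J}" using finite_stable_partitions[OF assms(1)] by simp
  have "(\<Sum>E\<in>?S. blk.weight s1 s2 P Q E) = (\<Sum>E\<in>?S. (\<lambda>d. if unmerged d P \<and> unmerged d Q then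
      coarse_weight s1 s2 P Q d else 0) (Union ` E))"
    by (rule sum.cong[OF refl]) (rule w)
  also have "\<dots> = (\<Sum>d\<in>{d \<in> stable_partitions \<tau> V. refined_by d J}. if unmerged d P \<and> unmerged d Q then
      coarse_weight s1 s2 P Q d else 0)"
    by (rule sum.reindex_bij_betw[OF bij_betw_coarse])
  also have "\<dots> = (\<Sum>d | d \<in> stable_partitions \<tau> V \<and> refined_by d J \<and> unmerged d P \<and> unmerged d Q. coarse_weight s1 s2 P Q d)"
    unfolding sum.inter_filter[OF finS, symmetric] by (rule sum.cong) auto
  finally show ?thesis
    using blk.sum_weight[OF finJ, of P Q s2 s1] assms st[of P] st[of Q] st[of J] base_stable
    by (simp add: fix_blocks_def free_blocks_def)
qed

text \<open>This is \<open>card_fix_meeting\<close> for the blocks of \<open>J\<close>. It ensures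
  that lifting to a coarsening without merges yields a diagram with the same s1 and s2.\<close>

lemma card_lift:
  assumes "finite V" "P \<subseteq> J" "\<And>C. C \<in> P \<Longrightarrow> \<tau> ` C \<in> P" "d \<in> stable_partitions \<tau> V" "refined_by d J" "unmerged d P"
  shows "card (fix_blocks \<tau> (lift d P)) = card (fix_blocks \<tau> P)"
    "card (free_blocks \<tau> (lift d P)) = card (free_blocks \<tau> P)"
proof -
  interpret blk: involution "(`) \<tau>" by (rule involution_image)
  obtain E where E: "E \<in> stable_partitions ((`) \<tau>) J" and d: "d = Union ` E"
    using bij_betw_imp_surj_on[OF bij_betw_coarse] assms(4,5) by blast
  have st: "(`) \<tau> ` P = P" using assms(3) image_image_\<tau> by blast
  have sub: "fix_blocks ((`) \<tau>) E \<subseteq> E" "free_blocks ((`) \<tau>) E \<subseteq> E" by (auto simp: fix_blocks_def free_blocks_def)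
  have sep: "separated E P" using assms(6) unmerged_coarse_iff[OF E assms(2)] d by simp
  have 1: "fix_blocks \<tau> (lift d P) = {B \<in> fix_blocks \<tau> d. B \<in> lift d P}"
    "free_blocks \<tau> (lift d P) = {B \<in> free_blocks \<tau> d. B \<in> lift d P}"
    by (auto simp: free_blocks_def fix_blocks_def lift_def)
  show "card (fix_blocks \<tau> (lift d P)) = card (fix_blocks \<tau> P)"
    unfolding 1 unfolding d fix_blocks_coarse[OF E] card_coarse_lift[OF E sub(1) assms(2)]
      blk.card_fix_meeting(1)[OF E assms(2) st sep] by (simp add: fix_blocks_def)
  show "card (free_blocks \<tau> (lift d P)) = card (free_blocks \<tau> P)"
    unfolding 1 unfolding d free_blocks_coarse[OF E] card_coarse_lift[OF E sub(2) assms(2)]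
      blk.card_fix_meeting(2)[OF E assms(2) st sep] by (simp add: free_blocks_def)
qed

end
end

section \<open>Components of stacked diagrams\<close>

abbreviation connected_in :: "'v set set \<Rightarrow> ('v \<times> 'v) set" where
  "connected_in B \<equiv> {(u, v). same_block B u v}\<^sup>*"

lemma connected_in_sym: "(u, v) \<in> connected_in B \<Longrightarrow> (v, u) \<in> connected_in B"
proof -
  have "sym {(u, v). same_block B u v}" by (auto simp: sym_def same_block_def)
  then show "(u, v) \<in> connected_in B \<Longrightarrow> (v, u) \<in> connected_in B"
    using sym_rtrancl by (auto dest: symD)
qed

lemma connected_in_block: "C \<in> B \<Longrightarrow> u \<in> C \<Longrightarrow> v \<in> C \<Longrightarrow> (u, v) \<in> connected_in B"
  by (rule r_into_rtrancl) (auto simp: same_block_def)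

lemma connected_in_Union: "(u, v) \<in> connected_in B \<Longrightarrow> u \<in> \<Union>B \<Longrightarrow> v \<in> \<Union>B"
  by (induction rule: rtrancl_induct) (auto simp: same_block_def)

text \<open>Applied to the involution and to the embedding of the nodes as the middle row of a
  stack.\<close>

lemma connected_in_map:
  assumes "(u, v) \<in> connected_in B" and "\<And>C. C \<in> B \<Longrightarrow> \<exists>C'\<in>B'. f ` C \<subseteq> C'"
  shows "(f u, f v) \<in> connected_in B'"
  using assms(1)
proof (induction rule: rtrancl_induct)
  case (step v w)
  then obtain C where "C \<in> B" "v \<in> C" "w \<in> C" by (auto simp: same_block_def)
  then obtain C' where "C' \<in> B'" "f v \<in> C'" "f w \<in> C'" using assms(2)[of C] by blast
  then have "(f v, f w) \<in> connected_in B'" by (rule connected_in_block)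
  with step.IH show ?case by (rule rtrancl_trans)
qed simp

lemma connected_in_partition:
  assumes "(u, v) \<in> connected_in B" "partition_on V D" "refined_by D B" "K \<in> D" "u \<in> K"
  shows "v \<in> K"
  using assms(1,5)
proof (induction rule: rtrancl_induct)
  case (step v w)
  then obtain C where C: "C \<in> B" "v \<in> C" "w \<in> C" by (auto simp: same_block_def)
  then obtain K' where "K' \<in> D" "C \<subseteq> K'" using assms(3) by (auto simp: refined_by_def)
  then show ?case using partition_block_eq[OF assms(2) _ assms(4), of K' v] step C by blast
qed simp

lemma times_Union: "\<Union>((\<lambda>C. A \<times> C) ` S) = A \<times> \<Union>S"
  by auto

lemma levels_Un:
  assumes "W = a \<union> b" "W = c \<union> e"
  shows "{0, Suc 0} \<times> a \<union> {0} \<times> b \<union> {Suc 0} \<times> b \<union> {Suc 0, 2} \<times> c \<union> {Suc 0} \<times> e \<union> {2} \<times> e = {0, 1, 2} \<times> W"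
    "{1} \<times> W \<union> {0} \<times> a \<union> {2} \<times> c \<union> {0} \<times> b \<union> {2} \<times> e = {0, 1, 2} \<times> W"
proof -
  have ab: "(x \<in> a \<or> x \<in> b) \<longleftrightarrow> x \<in> W" "(x \<in> c \<or> x \<in> e) \<longleftrightarrow> x \<in> W" for x
    by (simp add: assms(1)) (simp add: assms(2))
  show "{0, Suc 0} \<times> a \<union> {0} \<times> b \<union> {Suc 0} \<times> b \<union> {Suc 0, 2} \<times> c \<union> {Suc 0} \<times> e \<union> {2} \<times> e = {0, 1, 2} \<times> W"
    "{1} \<times> W \<union> {0} \<times> a \<union> {2} \<times> c \<union> {0} \<times> b \<union> {2} \<times> e = {0, 1, 2} \<times> W"
    by (rule Set.set_eqI, rename_tac z, case_tac z, use ab in auto)+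
qed

lemma Union_image_levels:
  "\<Union>((\<lambda>K. {1} \<times> K \<union> {0} \<times> f K \<union> {2} \<times> g K) ` S) = {1} \<times> \<Union>S \<union> {0} \<times> (\<Union>K\<in>S. f K) \<union> {2} \<times> (\<Union>K\<in>S. g K)"
  by auto

lemma Union_filtered: "(\<And>C. C \<in> P \<Longrightarrow> \<exists>K\<in>S. C \<subseteq> K) \<Longrightarrow> (\<Union>K\<in>S. \<Union>{C \<in> P. C \<subseteq> K}) = \<Union>P"
  by blast

lemma components_iff: "K \<in> components B \<longleftrightarrow> (\<exists>u\<in>\<Union>B. K = connected_in B `` {u})"
  unfolding components_def quotient_def by blast

lemma component_mem: "K \<in> components B \<Longrightarrow> u \<in> K \<Longrightarrow> v \<in> K \<longleftrightarrow> (u, v) \<in> connected_in B"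
  unfolding components_iff by (auto intro: rtrancl_trans dest: connected_in_sym)

lemma partition_components: "partition_on (\<Union>B) (components B)"
proof (rule partition_onI)
  show "\<Union>(components B) = \<Union>B"
  proof (intro equalityI subsetI)
    fix x assume "x \<in> \<Union>(components B)"
    then obtain K where "K \<in> components B" "x \<in> K" by (rule UnionE)
    then obtain u where "u \<in> \<Union>B" "(u, x) \<in> connected_in B" unfolding components_iff by blast
    then show "x \<in> \<Union>B" using connected_in_Union by fast
  next
    fix x assume "x \<in> \<Union>B"
    then have "connected_in B `` {x} \<in> components B" "x \<in> connected_in B `` {x}" by (auto simp: components_iff)
    then show "x \<in> \<Union>(components B)" by (rule UnionI)
  qed
  show "disjnt K K'" if "K \<in> components B" "K' \<in> components B" "K \<noteq> K'" for K K'
  proof (unfold disjnt_iff, intro allI notI)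
    fix x assume "x \<in> K \<and> x \<in> K'"
    then have "K = K'" using component_mem[OF that(1)] component_mem[OF that(2)] by blast
    then show False using that(3) by simp
  qed
  show "{} \<notin> components B" by (auto simp: components_iff)
qed

lemma refined_by_components: "{} \<notin> B \<Longrightarrow> refined_by (components B) B"
  unfolding refined_by_def
proof
  fix C assume "{} \<notin> B" "C \<in> B"
  then obtain u where u: "u \<in> C" by fastforce
  have "C \<subseteq> connected_in B `` {u}" using connected_in_block[OF \<open>C \<in> B\<close> u] by auto
  moreover have "connected_in B `` {u} \<in> components B" using u \<open>C \<in> B\<close> by (auto simp: components_iff)
  ultimately show "\<exists>K\<in>components B. C \<subseteq> K" by blast
qed

lemma components_least:
  assumes "partition_on (\<Union>B) D" "refined_by D B"
  shows "refined_by D (components B)"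
  unfolding refined_by_def
proof
  fix K assume "K \<in> components B"
  then obtain u where u: "u \<in> \<Union>B" "K = connected_in B `` {u}" by (auto simp: components_iff)
  then obtain E where "E \<in> D" "u \<in> E" using partition_onD1[OF assms(1)] by auto
  then show "\<exists>E\<in>D. K \<subseteq> E" using connected_in_partition[OF _ assms, of u _ E] u by auto
qed

text \<open>The criterion by which components are computed below: by refinement no path leaves a
  member of \<open>D\<close>, and by the last hypothesis paths reach all of it.\<close>

lemma components_unique:
  assumes "partition_on (\<Union>B) D" "refined_by D B"
    and "\<And>K u v. K \<in> D \<Longrightarrow> u \<in> K \<Longrightarrow> v \<in> K \<Longrightarrow> (u, v) \<in> connected_in B"
  shows "components B = D"
proof -
  have eq: "K = connected_in B `` {u}" if "K \<in> D" "u \<in> K" for K u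
    using assms(3)[OF that] connected_in_partition[OF _ assms(1,2) that] by auto
  have U: "\<Union>B = \<Union>D" using partition_onD1[OF assms(1)] .
  show ?thesis
  proof (intro equalityI subsetI)
    fix K assume "K \<in> components B"
    then obtain u where "u \<in> \<Union>D" "K = connected_in B `` {u}" using U by (auto simp: components_iff)
    then show "K \<in> D" using eq by auto
  next
    fix K assume K: "K \<in> D"
    then obtain u where u: "u \<in> K" using partition_onD3[OF assms(1)] by fastforce
    then have "u \<in> \<Union>B" "K = connected_in B `` {u}" using eq[OF K u] U K by auto
    then show "K \<in> components B" by (auto simp: components_iff)
  qed
qed

lemma (in involution) components_stable:
  assumes "\<And>C. C \<in> B \<Longrightarrow> \<tau> ` C \<in> B"
  shows "components B \<in> stable_partitions \<tau> (\<Union>B)"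
proof -
  have c: "(\<tau> u, \<tau> v) \<in> connected_in B" if "(u, v) \<in> connected_in B" for u v
    using connected_in_map[OF that, of B \<tau>] assms by blast
  have "\<tau> ` K \<in> components B" if K: "K \<in> components B" for K
  proof -
    obtain u where u: "u \<in> \<Union>B" "K = connected_in B `` {u}" using K by (auto simp: components_iff)
    have "\<tau> ` K = connected_in B `` {\<tau> u}"
    proof (intro equalityI subsetI)
      fix x assume "x \<in> \<tau> ` K" then show "x \<in> connected_in B `` {\<tau> u}" using c u(2) by auto
    next
      fix x assume "x \<in> connected_in B `` {\<tau> u}"
      then have "(u, \<tau> x) \<in> connected_in B" using c[of "\<tau> u" x] by simp
      then show "x \<in> \<tau> ` K" using u(2) by (simp add: mem_image_iff)
    qed
    moreover have "\<tau> u \<in> \<Union>B" using u(1) assms by auto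
    ultimately show ?thesis by (auto simp: components_iff)
  qed
  then show ?thesis using partition_components by (auto simp: stable_partitions_def)
qed

text \<open>\<open>lift D R\<close> is the image of \<open>R\<close> under the map that sends a
  block to the block of \<open>D\<close> around it. The cardinality drops exactly when this map
  fails to be injective, that is, when two members of \<open>R\<close> are merged.\<close>

lemma card_lift_eq_iff:
  assumes "finite V" "partition_on V D" "partition_on V d" "refined_by D d" "R \<subseteq> d"
  shows "card (lift D R) \<le> card R" "card (lift D R) = card R \<longleftrightarrow> unmerged D R"
proof -
  have finR: "finite R" using finite_elements[OF assms(1,3)] assms(5) finite_subset by blast
  define f where "f C = (SOME B. B \<in> D \<and> C \<subseteq> B)" for C
  have f: "f C \<in> D \<and> C \<subseteq> f C" if "C \<in> R" for C
  proof -
    have "C \<in> d" using that assms(5) by (rule subsetD[rotated])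
    then obtain B where "B \<in> D \<and> C \<subseteq> B" using assms(4) unfolding refined_by_def by auto
    then show ?thesis unfolding f_def by (rule someI)
  qed
  have uniq: "B = f C" if "C \<in> R" "B \<in> D" "C \<subseteq> B" for C B
  proof -
    have "C \<noteq> {}" using that(1) assms(5) partition_onD3[OF assms(3)] by auto
    then obtain x where "x \<in> C" by blast
    then show ?thesis using partition_block_eq[OF assms(2) that(2), of "f C" x] f[OF that(1)] that(3) by blast
  qed
  have img: "lift D R = f ` R"
  proof (intro equalityI subsetI)
    fix B assume "B \<in> lift D R"
    then obtain C where C: "B \<in> D" "C \<in> R" "C \<subseteq> B" by (auto simp: lift_def)
    then show "B \<in> f ` R" using uniq[OF C(2,1,3)] by simp
  next
    fix B assume "B \<in> f ` R"
    then obtain C where "C \<in> R" "B = f C" by blast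
    then show "B \<in> lift D R" using f[of C] by (auto simp: lift_def)
  qed
  then show "card (lift D R) \<le> card R" using card_image_le[OF finR] by simp
  have "inj_on f R \<longleftrightarrow> unmerged D R"
  proof
    assume inj: "inj_on f R"
    show "unmerged D R" unfolding unmerged_def
    proof (intro ballI impI)
      fix B C C' assume "B \<in> D" "C \<in> R" "C' \<in> R" "C \<subseteq> B" "C' \<subseteq> B"
      then have "f C = f C'" using uniq[of C B] uniq[of C' B] by simp
      then show "C = C'" by (rule inj_onD[OF inj]) fact+
    qed
  next
    assume u: "unmerged D R"
    show "inj_on f R"
    proof (rule inj_onI)
      fix C C' assume C: "C \<in> R" "C' \<in> R" "f C = f C'"
      have "f C \<in> D" "C \<subseteq> f C" "C' \<subseteq> f C" using f[OF C(1)] f[OF C(2)] C(3) by simp_all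
      then show "C = C'" using u C(1,2) unfolding unmerged_def by blast
    qed
  qed
  then show "card (lift D R) = card R \<longleftrightarrow> unmerged D R"
    unfolding img using card_image[of f R] eq_card_imp_inj_on[OF finR, of f] by metis
qed

section \<open>The product of two diagrams and the Gram entry\<close>

context
  fixes V :: "node set" and d1 d2 P Q :: "node set set"
  assumes d1: "partition_on V d1" and d2: "partition_on V d2" and PQ: "P \<subseteq> d1" "Q \<subseteq> d2"
begin

abbreviation (input) join :: "node set set" where
  "join \<equiv> components (d1 \<union> d2)"

lemma join_union: "\<Union>(d1 \<union> d2) = V"
  using partition_onD1[OF d1] partition_onD1[OF d2] by auto

lemma join_partition: "partition_on V join"
  using partition_components[of "d1 \<union> d2"] by (simp only: join_union)

lemma join_refined: "refined_by join d1" "refined_by join d2"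
  using refined_by_components[of "d1 \<union> d2"] partition_onD3[OF d1] partition_onD3[OF d2]
  by (auto simp: refined_by_def)

lemma join_least: "partition_on V D \<Longrightarrow> refined_by D d1 \<Longrightarrow> refined_by D d2 \<Longrightarrow> refined_by D join"
  using components_least[of "d1 \<union> d2" D] by (simp only: join_union) (auto simp: refined_by_def)

text \<open>Only through blocks tie an outer row to the middle row. So the component of a join block
  \<open>K\<close> has \<open>K\<close> in the middle, the members of \<open>P\<close> inside
  \<open>K\<close> at the top and those of \<open>Q\<close> inside \<open>K\<close> at the
  bottom.\<close>

definition stack_component :: "node set \<Rightarrow> (nat \<times> node) set" where
  "stack_component K = {1} \<times> K \<union> {0} \<times> \<Union>{C \<in> P. C \<subseteq> K} \<union> {2} \<times> \<Union>{C \<in> Q. C \<subseteq> K}"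

lemma stack_component_mem:
  "(0, x) \<in> stack_component K \<longleftrightarrow> (\<exists>C\<in>P. C \<subseteq> K \<and> x \<in> C)"
  "(Suc 0, x) \<in> stack_component K \<longleftrightarrow> x \<in> K"
  "(2, x) \<in> stack_component K \<longleftrightarrow> (\<exists>C\<in>Q. C \<subseteq> K \<and> x \<in> C)"
  unfolding stack_component_def by auto

lemma stack_component_levels: "p \<in> stack_component K \<Longrightarrow> fst p = 0 \<or> fst p = Suc 0 \<or> fst p = 2"
  unfolding stack_component_def by auto

lemma block_join_cases:
  assumes "K \<in> join" "K' \<in> join" "C \<subseteq> K" "C \<subseteq> K'" "x \<in> C"
  shows "K = K'"
  using partition_block_eq[OF join_partition assms(1,2), of x] assms by auto

text \<open>The bottom row of the first diagram and the top row of the second are identified, so the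
  middle row is connected by \<open>d1\<close> and \<open>d2\<close> together and splits according
  to their join. The outer copies of horizontal blocks stay isolated.\<close>

lemma stacked_eq:
  "stacked (d1, P) (d2, Q) = stack_component ` join \<union> (\<lambda>C. {0} \<times> C) ` (d1 - P) \<union> (\<lambda>C. {2} \<times> C) ` (d2 - Q)"
  (is "_ = ?A \<union> ?B \<union> ?C")
  unfolding stacked_def
proof (rule components_unique)
  let ?pb = "placed_blocks 0 (d1, P) \<union> placed_blocks 1 (d2, Q)"
  let ?S = "?A \<union> ?B \<union> ?C"
  have pb: "?pb = (\<lambda>C. {0, Suc 0} \<times> C) ` P \<union> (\<lambda>C. {0} \<times> C) ` (d1 - P) \<union> (\<lambda>C. {Suc 0} \<times> C) ` (d1 - P) \<union>
      (\<lambda>C. {Suc 0, 2} \<times> C) ` Q \<union> (\<lambda>C. {Suc 0} \<times> C) ` (d2 - Q) \<union> (\<lambda>C. {2} \<times> C) ` (d2 - Q)"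
    unfolding placed_blocks_def fst_conv snd_conv Setcompr_eq_image
    by (simp only: One_nat_def numeral_2_eq_2 Un_assoc)
  have V: "\<Union>d1 = V" "\<Union>d2 = V" "\<Union>join = V"
    using partition_onD1[OF d1] partition_onD1[OF d2] partition_onD1[OF join_partition] by auto
  have W: "V = \<Union>P \<union> \<Union>(d1 - P)" "V = \<Union>Q \<union> \<Union>(d2 - Q)"
    unfolding Union_Un_distrib[symmetric] using V PQ by (simp_all add: Un_absorb1)
  have U: "\<Union>?pb = {0, 1, 2} \<times> V"
  proof -
    have "\<Union>?pb = {0, Suc 0} \<times> \<Union>P \<union> {0} \<times> \<Union>(d1 - P) \<union> {Suc 0} \<times> \<Union>(d1 - P) \<union>
        {Suc 0, 2} \<times> \<Union>Q \<union> {Suc 0} \<times> \<Union>(d2 - Q) \<union> {2} \<times> \<Union>(d2 - Q)"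
      unfolding pb Union_Un_distrib times_Union ..
    then show ?thesis unfolding levels_Un(1)[OF W] .
  qed
  have Pj: "\<exists>K\<in>join. C \<subseteq> K" if "C \<in> d1" for C using join_refined(1) that by (auto simp: refined_by_def)
  have Qj: "\<exists>K\<in>join. C \<subseteq> K" if "C \<in> d2" for C using join_refined(2) that by (auto simp: refined_by_def)
  have US: "\<Union>?S = {0, 1, 2} \<times> V"
  proof -
    have "\<Union>?A = {1} \<times> V \<union> {0} \<times> \<Union>P \<union> {2} \<times> \<Union>Q"
    proof -
      have "\<Union>?A = {1} \<times> \<Union>join \<union> {0} \<times> (\<Union>K\<in>join. \<Union>{C \<in> P. C \<subseteq> K}) \<union> {2} \<times> (\<Union>K\<in>join. \<Union>{C \<in> Q. C \<subseteq> K})"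
        unfolding stack_component_def by (rule Union_image_levels)
      moreover have "(\<Union>K\<in>join. \<Union>{C \<in> P. C \<subseteq> K}) = \<Union>P"
        by (rule Union_filtered) (use Pj PQ(1) in \<open>simp add: subset_iff\<close>)
      moreover have "(\<Union>K\<in>join. \<Union>{C \<in> Q. C \<subseteq> K}) = \<Union>Q"
        by (rule Union_filtered) (use Qj PQ(2) in \<open>simp add: subset_iff\<close>)
      ultimately show ?thesis using V by simp
    qed
    moreover have "\<Union>?B = {0} \<times> \<Union>(d1 - P)" "\<Union>?C = {2} \<times> \<Union>(d2 - Q)"
      by (rule times_Union)+
    ultimately show ?thesis unfolding Union_Un_distrib levels_Un(2)[OF W, symmetric] by (simp only:)
  qed
  show "partition_on (\<Union>?pb) ?S"
  proof (rule partition_onI)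
    show "\<Union>?S = \<Union>?pb" unfolding U US ..
    show "{} \<notin> ?S"
    proof
      assume "{} \<in> ?S"
      then consider K where "K \<in> join" "{} = stack_component K" | C where "C \<in> d1" "{} = {0 :: nat} \<times> C"
        | C where "C \<in> d2" "{} = {2 :: nat} \<times> C"
        by (elim UnE imageE DiffE) assumption+
      then show False
      proof cases
        case (1 K)
        then have "K = {}" unfolding stack_component_def by auto
        then show False using 1(1) partition_onD3[OF join_partition] by simp
      next
        case (2 C)
        then have "C = {}" by blast
        then show False using 2(1) partition_onD3[OF d1] by simp
      next
        case (3 C)
        then have "C = {}" by blast
        then show False using 3(1) partition_onD3[OF d2] by simp
      qed
    qed
    have AA: "K = K'" if kk: "K \<in> join" "K' \<in> join" "p \<in> stack_component K" "p \<in> stack_component K'" for K K' p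
    proof -
      obtain n x where p: "p = (n, x)" by (cases p)
      consider "n = 0" | "n = Suc 0" | "n = 2" using stack_component_levels[OF kk(3)] p by auto
      then show ?thesis
      proof cases
        case 1
        then obtain C C' where C: "C \<in> P" "C \<subseteq> K" "x \<in> C" "C' \<in> P" "C' \<subseteq> K'" "x \<in> C'"
          using kk(3,4) unfolding p 1 stack_component_mem by blast
        then have "C = C'" using partition_block_eq[OF d1] PQ by blast
        then show ?thesis using block_join_cases[OF kk(1,2)] C by blast
      next
        case 2
        then show ?thesis using kk partition_block_eq[OF join_partition kk(1,2)] unfolding p 2 stack_component_mem by blast
      next
        case 3
        then obtain C C' where C: "C \<in> Q" "C \<subseteq> K" "x \<in> C" "C' \<in> Q" "C' \<subseteq> K'" "x \<in> C'"
          using kk(3,4) unfolding p 3 stack_component_mem by blast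
        then have "C = C'" using partition_block_eq[OF d2] PQ by blast
        then show ?thesis using block_join_cases[OF kk(1,2)] C by blast
      qed
    qed
    have AB: "False" if kk: "C \<in> d1 - P" "(0, x) \<in> stack_component K" "x \<in> C" for C x K
    proof -
      obtain C' where "C' \<in> P" "x \<in> C'" using kk(2) unfolding stack_component_mem by blast
      then show False using partition_block_eq[OF d1, of C C' x] kk PQ by blast
    qed
    have AC: "False" if kk: "C \<in> d2 - Q" "(2, x) \<in> stack_component K" "x \<in> C" for C x K
    proof -
      obtain C' where "C' \<in> Q" "x \<in> C'" using kk(2) unfolding stack_component_mem by blast
      then show False using partition_block_eq[OF d2, of C C' x] kk PQ by blast
    qed
    have "p = q" if pq: "p \<in> ?S" "q \<in> ?S" "z \<in> p" "z \<in> q" for p q z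
    proof -
      have BB: "C = C'" if "C \<in> d1 - P" "C' \<in> d1 - P" "x \<in> C" "x \<in> C'" for C C' x
        using partition_block_eq[OF d1] that by blast
      have CC: "C = C'" if "C \<in> d2 - Q" "C' \<in> d2 - Q" "x \<in> C" "x \<in> C'" for C C' x
        using partition_block_eq[OF d2] that by blast
      obtain n x where z: "z = (n, x)" by (cases z)
      from pq(1) consider (a) K where "K \<in> join" "p = stack_component K" | (b) C where "C \<in> d1 - P" "p = {0} \<times> C"
        | (c) C where "C \<in> d2 - Q" "p = {2} \<times> C" by blast
      then show ?thesis
      proof cases
        case a
        from pq(2) consider (a') K' where "K' \<in> join" "q = stack_component K'" | (b') C where "C \<in> d1 - P" "q = {0} \<times> C"
          | (c') C where "C \<in> d2 - Q" "q = {2} \<times> C" by blast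
        then show ?thesis
        proof cases
          case a' then show ?thesis using AA[OF a(1) a'(1), of z] pq a a'(2) by simp
        next
          case b'
            have "n = 0 \<and> x \<in> C" using pq(4) b'(2) z by simp
            then have False using AB[OF b'(1), of x K] pq(3) a(2) z by simp
            then show ?thesis ..
        next
          case c'
            have "n = 2 \<and> x \<in> C" using pq(4) c'(2) z by simp
            then have False using AC[OF c'(1), of x K] pq(3) a(2) z by simp
            then show ?thesis ..
        qed
      next
        case b
        from pq(2) consider (a') K' where "K' \<in> join" "q = stack_component K'" | (b') C where "C \<in> d1 - P" "q = {0} \<times> C"
          | (c') C where "C \<in> d2 - Q" "q = {2} \<times> C" by blast
        then show ?thesis
        proof cases
          case a'
            have "n = 0 \<and> x \<in> C" using pq(3) b(2) z by simp
            then have False using AB[OF b(1), of x K'] pq(4) a'(2) z by simp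
            then show ?thesis ..
        next
          case (b' C')
            then have "x \<in> C" "x \<in> C'" using pq(3,4) b(2) z by simp_all
            then show ?thesis using BB[OF b(1) b'(1), of x] b(2) b'(2) by simp
        next
          case c' then show ?thesis using pq b by auto
        qed
      next
        case c
        from pq(2) consider (a') K' where "K' \<in> join" "q = stack_component K'" | (b') C where "C \<in> d1 - P" "q = {0} \<times> C"
          | (c') C where "C \<in> d2 - Q" "q = {2} \<times> C" by blast
        then show ?thesis
        proof cases
          case a'
            have "n = 2 \<and> x \<in> C" using pq(3) c(2) z by simp
            then have False using AC[OF c(1), of x K'] pq(4) a'(2) z by simp
            then show ?thesis ..
        next
          case b' then show ?thesis using pq c by auto
        next
          case (c' C')
            then have "x \<in> C" "x \<in> C'" using pq(3,4) c(2) z by simp_all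
            then show ?thesis using CC[OF c(1) c'(1), of x] c(2) c'(2) by simp
        qed
      qed
    qed
    then show "disjnt p q" if "p \<in> ?S" "q \<in> ?S" "p \<noteq> q" for p q
      using that unfolding disjnt_iff by metis
  qed
  \<comment> \<open>One witness serves the copies of \<open>C\<close> on all levels, so that the
    blocks spanning two levels are covered as well.\<close>
  have sub: "\<exists>T\<in>?S. {Suc 0} \<times> C \<subseteq> T \<and> (C \<in> P \<longrightarrow> {0} \<times> C \<subseteq> T) \<and> (C \<in> Q \<longrightarrow> {2} \<times> C \<subseteq> T)"
    if C: "C \<in> d1 \<or> C \<in> d2" for C
  proof -
    obtain K where K: "K \<in> join" "C \<subseteq> K" using Pj Qj C by blast
    then have "{Suc 0} \<times> C \<subseteq> stack_component K" "C \<in> P \<longrightarrow> {0} \<times> C \<subseteq> stack_component K" "C \<in> Q \<longrightarrow> {2} \<times> C \<subseteq> stack_component K"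
      unfolding stack_component_def by auto
    then show ?thesis using K(1) by blast
  qed
  show "refined_by ?S ?pb"
    unfolding refined_by_def
  proof
    fix T assume "T \<in> ?pb"
    then consider C where "C \<in> P" "T = {0, Suc 0} \<times> C" | C where "C \<in> d1 - P" "T = {0} \<times> C" | C where "C \<in> d1" "T = {Suc 0} \<times> C"
      | C where "C \<in> Q" "T = {Suc 0, 2} \<times> C" | C where "C \<in> d2" "T = {Suc 0} \<times> C" | C where "C \<in> d2 - Q" "T = {2} \<times> C"
      unfolding pb by blast
    then show "\<exists>T'\<in>?S. T \<subseteq> T'"
    proof cases
      case (1 C)
      then have "T = {Suc 0} \<times> C \<union> {0} \<times> C" by auto
      have "C \<in> d1 \<or> C \<in> d2" using 1(1) PQ(1) by auto
      from sub[OF this] obtain T' where T': "T' \<in> ?S"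
        "{Suc 0} \<times> C \<subseteq> T' \<and> (C \<in> P \<longrightarrow> {0} \<times> C \<subseteq> T') \<and> (C \<in> Q \<longrightarrow> {2} \<times> C \<subseteq> T')"
        by (rule bexE)
      have "T \<subseteq> T'" unfolding \<open>T = _ \<union> _\<close> using T'(2) 1(1) by (simp only: Un_subset_iff simp_thms)
      then show ?thesis using T'(1) by (rule bexI)
    next
      case (4 C)
      then have "T = {Suc 0} \<times> C \<union> {2} \<times> C" by auto
      have "C \<in> d1 \<or> C \<in> d2" using 4(1) PQ(2) by auto
      from sub[OF this] obtain T' where T': "T' \<in> ?S"
        "{Suc 0} \<times> C \<subseteq> T' \<and> (C \<in> P \<longrightarrow> {0} \<times> C \<subseteq> T') \<and> (C \<in> Q \<longrightarrow> {2} \<times> C \<subseteq> T')"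
        by (rule bexE)
      have "T \<subseteq> T'" unfolding \<open>T = _ \<union> _\<close> using T'(2) 4(1) by (simp only: Un_subset_iff simp_thms)
      then show ?thesis using T'(1) by (rule bexI)
    next
      case (3 C)
      then have "C \<in> d1 \<or> C \<in> d2" by simp
      from sub[OF this] show ?thesis unfolding 3(2) by (rule bexE) (rule bexI, elim conjE)
    next
      case (5 C)
      then have "C \<in> d1 \<or> C \<in> d2" by simp
      from sub[OF this] show ?thesis unfolding 5(2) by (rule bexE) (rule bexI, elim conjE)
    next
      case (2 C)
      then have "T \<in> ?S" by blast
      then show ?thesis by (rule bexI[rotated]) (rule subset_refl)
    next
      case (6 C)
      then have "T \<in> ?S" by blast
      then show ?thesis by (rule bexI[rotated]) (rule subset_refl)
    qed
  qed
  \<comment> \<open>Every block of \<open>d1\<close> or \<open>d2\<close>, through or horizontal,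
    has a copy in the middle row, so paths in the join carry over to the stack.\<close>
  have mid: "((Suc 0, u), (Suc 0, v)) \<in> connected_in ?pb" if uv: "(u, v) \<in> connected_in (d1 \<union> d2)" for u v
  proof (rule connected_in_map[OF uv])
    fix C assume "C \<in> d1 \<union> d2"
    then consider "C \<in> P" | "C \<in> d1 - P" | "C \<in> Q" | "C \<in> d2 - Q" by blast
    then show "\<exists>C'\<in>?pb. Pair (Suc 0) ` C \<subseteq> C'"
    proof cases
      case 1
      then have "{0, Suc 0} \<times> C \<in> ?pb" unfolding pb by blast
      then show ?thesis by (rule bexI[rotated]) auto
    next
      case 2
      then have "{Suc 0} \<times> C \<in> ?pb" unfolding pb by blast
      then show ?thesis by (rule bexI[rotated]) auto
    next
      case 3
      then have "{Suc 0, 2} \<times> C \<in> ?pb" unfolding pb by blast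
      then show ?thesis by (rule bexI[rotated]) auto
    next
      case 4
      then have "{Suc 0} \<times> C \<in> ?pb" unfolding pb by blast
      then show ?thesis by (rule bexI[rotated]) auto
    qed
  qed
  \<comment> \<open>An outer point of the component lies in a through block, which also contains the
    same node of the middle row.\<close>
  have to_mid: "\<exists>w\<in>K. (z, (Suc 0, w)) \<in> connected_in ?pb" if z: "z \<in> stack_component K" for z K
  proof -
    obtain n x where zx: "z = (n, x)" by (cases z)
    consider "n = 0" | "n = Suc 0" | "n = 2" using stack_component_levels[OF z] zx by auto
    then show ?thesis
    proof cases
      case 1
      then obtain C where C: "C \<in> P" "C \<subseteq> K" "x \<in> C" using z unfolding zx 1 stack_component_mem by blast
      then have "{0, Suc 0} \<times> C \<in> ?pb" unfolding pb by blast
      then have "(z, (Suc 0, x)) \<in> connected_in ?pb" unfolding zx 1 by (rule connected_in_block) (use C in simp_all)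
      then show ?thesis using C by blast
    next
      case 2
      then show ?thesis using z unfolding zx 2 stack_component_mem by blast
    next
      case 3
      then obtain C where C: "C \<in> Q" "C \<subseteq> K" "x \<in> C" using z unfolding zx 3 stack_component_mem by blast
      then have "{Suc 0, 2} \<times> C \<in> ?pb" unfolding pb by blast
      then have "(z, (Suc 0, x)) \<in> connected_in ?pb" unfolding zx 3 by (rule connected_in_block) (use C in simp_all)
      then show ?thesis using C by blast
    qed
  qed
  show "(u, v) \<in> connected_in ?pb" if T: "T \<in> ?S" "u \<in> T" "v \<in> T" for T u v
  proof -
    from T(1) consider (a) K where "K \<in> join" "T = stack_component K" | (b) C where "C \<in> d1 - P" "T = {0} \<times> C"
      | (c) C where "C \<in> d2 - Q" "T = {2} \<times> C" by blast
    then show ?thesis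
    proof cases
      case a
      obtain w w' where w: "w \<in> K" "(u, (Suc 0, w)) \<in> connected_in ?pb" "w' \<in> K" "(v, (Suc 0, w')) \<in> connected_in ?pb"
        using to_mid[of u K] to_mid[of v K] T a by blast
      have "((Suc 0, w), (Suc 0, w')) \<in> connected_in ?pb"
        using mid component_mem[OF a(1) w(1)] w(3) by blast
      then show ?thesis using w(2) connected_in_sym[OF w(4)] by (meson rtrancl_trans)
    next
      case b
      then have "T \<in> ?pb" unfolding pb by blast
      then show ?thesis using T(2,3) by (rule connected_in_block)
    next
      case c
      then have "T \<in> ?pb" unfolding pb by blast
      then show ?thesis using T(2,3) by (rule connected_in_block)
    qed
  qed
qed

lemma stack_component_inj: "inj_on stack_component join"
proof (rule inj_onI)
  fix K K' assume "stack_component K = stack_component K'"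
  then have "x \<in> K \<longleftrightarrow> x \<in> K'" for x
    using stack_component_mem(2)[of x K] stack_component_mem(2)[of x K'] by (simp only:)
  then show "K = K'" by blast
qed

lemma stack_component_fst:
  assumes "K \<in> join"
  shows "0 \<in> fst ` stack_component K \<longleftrightarrow> K \<in> lift join P" "2 \<in> fst ` stack_component K \<longleftrightarrow> K \<in> lift join Q"
    "Suc 0 \<in> fst ` stack_component K"
proof -
  have P: "\<exists>x. x \<in> C" if "C \<in> P" for C using that PQ(1) partition_onD3[OF d1] by (metis ex_in_conv subsetD)
  have Q: "\<exists>x. x \<in> C" if "C \<in> Q" for C using that PQ(2) partition_onD3[OF d2] by (metis ex_in_conv subsetD)
  have K: "\<exists>x. x \<in> K" using assms partition_onD3[OF join_partition] by (metis ex_in_conv)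
  have f: "n \<in> fst ` stack_component K \<longleftrightarrow> (\<exists>x. (n, x) \<in> stack_component K)" for n by force
  show "0 \<in> fst ` stack_component K \<longleftrightarrow> K \<in> lift join P" "2 \<in> fst ` stack_component K \<longleftrightarrow> K \<in> lift join Q"
    "Suc 0 \<in> fst ` stack_component K"
  proof -
    have "(\<exists>x. \<exists>C\<in>P. C \<subseteq> K \<and> x \<in> C) \<longleftrightarrow> (\<exists>C\<in>P. C \<subseteq> K)" using P by blast
    then show "0 \<in> fst ` stack_component K \<longleftrightarrow> K \<in> lift join P"
      unfolding f stack_component_mem lift_def using assms by simp
    have "(\<exists>x. \<exists>C\<in>Q. C \<subseteq> K \<and> x \<in> C) \<longleftrightarrow> (\<exists>C\<in>Q. C \<subseteq> K)" using Q by blast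
    then show "2 \<in> fst ` stack_component K \<longleftrightarrow> K \<in> lift join Q"
      unfolding f stack_component_mem lift_def using assms by simp
    show "Suc 0 \<in> fst ` stack_component K"
      unfolding f stack_component_mem by (rule K)
  qed
qed

lemma propagating_number_eq: "propagating_number (d1, P) (d2, Q) = card (lift join P \<inter> lift join Q)"
proof -
  have "{c \<in> stacked (d1, P) (d2, Q). 0 \<in> fst ` c \<and> 2 \<in> fst ` c} = stack_component ` {K \<in> join. K \<in> lift join P \<inter> lift join Q}"
    (is "?L = ?R")
  proof (intro equalityI subsetI)
    fix c assume c: "c \<in> ?L"
    then have "c \<in> stack_component ` join" unfolding stacked_eq by auto
    then obtain K where K: "K \<in> join" "c = stack_component K" by auto
    then show "c \<in> ?R" using c stack_component_fst[OF K(1)] by auto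
  next
    fix c assume "c \<in> ?R"
    then obtain K where "K \<in> join" "c = stack_component K" "K \<in> lift join P \<inter> lift join Q" by auto
    then show "c \<in> ?L" using stack_component_fst[of K] unfolding stacked_eq by auto
  qed
  moreover have "{K \<in> join. K \<in> lift join P \<inter> lift join Q} = lift join P \<inter> lift join Q" by (auto simp: lift_def)
  moreover have "inj_on stack_component (lift join P \<inter> lift join Q)"
    by (rule inj_on_subset[OF stack_component_inj]) (auto simp: lift_def)
  ultimately show ?thesis unfolding propagating_number_def by (simp add: card_image)
qed

lemma middle_components_eq: "middle_components (d1, P) (d2, Q) = card (join - lift join P - lift join Q)"
proof -
  have "{c \<in> stacked (d1, P) (d2, Q). fst ` c = {1}} = stack_component ` (join - lift join P - lift join Q)"
    (is "?L = ?R")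
  proof (intro equalityI subsetI)
    fix c assume c: "c \<in> ?L"
    then have "c \<in> stack_component ` join" unfolding stacked_eq by auto
    then obtain K where K: "K \<in> join" "c = stack_component K" by auto
    then have "0 \<notin> fst ` stack_component K" "2 \<notin> fst ` stack_component K" using c by auto
    then show "c \<in> ?R" using K stack_component_fst[OF K(1)] by auto
  next
    fix c assume "c \<in> ?R"
    then obtain K where K: "K \<in> join" "c = stack_component K" "K \<notin> lift join P" "K \<notin> lift join Q" by auto
    have "fst ` stack_component K = {1}"
    proof (intro equalityI subsetI)
      fix n assume n: "n \<in> fst ` stack_component K"
      then obtain z where "z \<in> stack_component K" "n = fst z" by (rule imageE)
      then have "n = 0 \<or> n = Suc 0 \<or> n = 2" using stack_component_levels[of z K] by simp
      then show "n \<in> {1}" using n stack_component_fst[OF K(1)] K(3,4) by auto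
    qed (use stack_component_fst[OF K(1)] in auto)
    then show "c \<in> ?L" using K unfolding stacked_eq by auto
  qed
  moreover have "inj_on stack_component (join - lift join P - lift join Q)"
    by (rule inj_on_subset[OF stack_component_inj]) auto
  ultimately show ?thesis unfolding middle_components_def by (simp add: card_image)
qed

text \<open>Either lift has at most 2 s1 + s2 members. Their intersection can have that size only if
  both lifts are full and equal, and by \<open>card_lift_eq_iff\<close> full means unmerged.\<close>

lemma gram_entry_eq:
  assumes "finite V" "card P = 2 * s1 + s2" "card Q = 2 * s1 + s2"
  shows "gram_entry s1 s2 (d1, P) (d2, Q) =
    (if unmerged join P \<and> unmerged join Q \<and> lift join P = lift join Q then var_x ^ card (join - lift join P) else 0)"
proof -
  note p = card_lift_eq_iff[OF assms(1) join_partition d1 join_refined(1) PQ(1)]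
  note q = card_lift_eq_iff[OF assms(1) join_partition d2 join_refined(2) PQ(2)]
  have fin: "finite (lift join P)" "finite (lift join Q)"
    using finite_elements[OF assms(1) join_partition] by (auto simp: lift_def)
  have "card (lift join P \<inter> lift join Q) = 2 * s1 + s2 \<longleftrightarrow> unmerged join P \<and> unmerged join Q \<and> lift join P = lift join Q"
  proof
    assume c: "card (lift join P \<inter> lift join Q) = 2 * s1 + s2"
    have "card (lift join P \<inter> lift join Q) \<le> card (lift join P)" "card (lift join P \<inter> lift join Q) \<le> card (lift join Q)"
      using fin by (auto intro: card_mono)
    then have "card (lift join P) = card P" "card (lift join Q) = card Q" using p(1) q(1) c assms by linarith+
    moreover from this have "lift join P \<inter> lift join Q = lift join P" "lift join P \<inter> lift join Q = lift join Q"
      using c assms fin card_subset_eq[OF fin(1) Int_lower1] card_subset_eq[OF fin(2) Int_lower2] by simp_all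
    ultimately show "unmerged join P \<and> unmerged join Q \<and> lift join P = lift join Q"
      using p(2) q(2) by blast
  next
    assume "unmerged join P \<and> unmerged join Q \<and> lift join P = lift join Q"
    then show "card (lift join P \<inter> lift join Q) = 2 * s1 + s2" using p(2) assms by simp
  qed
  then show ?thesis
    unfolding gram_entry_def propagating_number_eq middle_components_eq by auto
qed

end

section \<open>Unitriangular congruence\<close>

text \<open>A rank function takes the place of an ordering of the indices. A permutation with
  nonzero contribution never lowers the rank; as the sum of the ranks is invariant under
  permutations, it never raises it either and is the identity.\<close>

lemma det_unitriangular:
  fixes A :: "'a::comm_ring_1 mat"
  assumes A: "A \<in> carrier_mat n n"
    and diag: "\<And>i. i < n \<Longrightarrow> A $$ (i, i) = 1"
    and tri: "\<And>i j. i < n \<Longrightarrow> j < n \<Longrightarrow> A $$ (i, j) \<noteq> 0 \<Longrightarrow> i = j \<or> rank i < (rank j :: nat)"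
  shows "det A = 1"
proof -
  let ?S = "{p. p permutes {0..<n}}" and ?f = "\<lambda>p. signof p * (\<Prod>i = 0..<n. A $$ (i, p i)) :: 'a"
  have "det A = sum ?f ?S"
    using A by (simp add: det_def)
  also have "\<dots> = sum ?f {id}"
  proof (rule sum.mono_neutral_right)
    show "finite ?S" by (simp add: finite_permutations)
    show "{id} \<subseteq> ?S" by (simp add: permutes_id)
    show "\<forall>p\<in>?S - {id}. ?f p = 0"
    proof
      fix p assume p: "p \<in> ?S - {id}"
      then have per: "p permutes {0..<n}" by simp
      have lt: "p i < n" if "i < n" for i using permutes_in_image[OF per, of i] that by simp
      have "\<exists>i<n. A $$ (i, p i) = 0"
      proof (rule ccontr)
        assume "\<not> ?thesis"
        then have le: "i = p i \<or> rank i < rank (p i)" if "i < n" for i using tri that lt by blast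
        obtain k where k: "k < n" "p k \<noteq> k"
        proof (rule ccontr)
          assume "\<not> thesis"
          then have "p k = k" if "k < n" for k using that \<open>\<And>k. k < n \<Longrightarrow> p k \<noteq> k \<Longrightarrow> thesis\<close> by blast
          then have "p x = x" for x using permutes_not_in[OF per, of x] by (cases "x < n") auto
          then have "p = id" by auto
          then show False using p by simp
        qed
        have "(\<Sum>i\<in>{0..<n}. rank i) < (\<Sum>i\<in>{0..<n}. rank (p i))"
        proof (rule sum_strict_mono_ex1)
          show "\<forall>i\<in>{0..<n}. rank i \<le> rank (p i)" using le by (metis atLeastLessThan_iff le_refl less_imp_le)
          show "\<exists>i\<in>{0..<n}. rank i < rank (p i)" using le[OF k(1)] k by force
        qed simp
        also have "\<dots> = (\<Sum>i\<in>{0..<n}. rank i)" using sum.permute[OF per, of rank] by (simp add: o_def)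
        finally show False by simp
      qed
      then obtain i where i: "i < n" "A $$ (i, p i) = 0" by blast
      have "(\<Prod>i = 0..<n. A $$ (i, p i)) = 0"
        by (rule prod_zero) (use i in auto)
      then show "?f p = 0" by simp
    qed
  qed
  also have "\<dots> = 1" using diag by (simp add: permutes_id)
  finally show ?thesis .
qed

lemma matrix_of_mult:
  assumes "distinct ix"
  shows "matrix_of ix M * matrix_of ix N = matrix_of ix (\<lambda>p q. \<Sum>r\<in>set ix. M p r * (N r q :: 'a::comm_ring_1))"
proof (rule eq_matI)
  fix a b assume "a < dim_row (matrix_of ix (\<lambda>p q. \<Sum>r\<in>set ix. M p r * N r q))"
    "b < dim_col (matrix_of ix (\<lambda>p q. \<Sum>r\<in>set ix. M p r * N r q))"
  then have ab: "a < length ix" "b < length ix" by (auto simp: matrix_of_def)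
  have "(\<Sum>c<length ix. M (ix ! a) (ix ! c) * N (ix ! c) (ix ! b)) = (\<Sum>r\<in>set ix. M (ix ! a) r * N r (ix ! b))"
    by (rule sum.reindex_bij_betw[OF bij_betw_nth[OF assms refl refl]])
  then show "(matrix_of ix M * matrix_of ix N) $$ (a, b) = matrix_of ix (\<lambda>p q. \<Sum>r\<in>set ix. M p r * N r q) $$ (a, b)"
    using ab by (simp add: matrix_of_def scalar_prod_def atLeast0LessThan)
qed (auto simp: matrix_of_def)

lemma transpose_matrix_of: "transpose_mat (matrix_of ix M) = matrix_of ix (\<lambda>p q. M q p)"
  by (rule eq_matI) (auto simp: matrix_of_def)

lemma matrix_of_cong:
  "(\<And>p q. p \<in> set ix \<Longrightarrow> q \<in> set ix \<Longrightarrow> M p q = N p q) \<Longrightarrow> matrix_of ix M = matrix_of ix N"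
  by (rule eq_matI) (auto simp: matrix_of_def)

lemma matrix_of_carrier [simp]: "matrix_of ix M \<in> carrier_mat (length ix) (length ix)"
  by (simp add: matrix_of_def)

text \<open>The congruence is by the inverse of the zeta matrix of \<open>below\<close>, cut down to \<open>L\<close> off the diagonal, since an
  element above one of \<open>I\<close> need not belong to \<open>I\<close> if it lies outside \<open>L\<close>.\<close>

lemma zeta_congruence:
  fixes G R :: "'i \<Rightarrow> 'i \<Rightarrow> 'a::comm_ring_1" and rank :: "'i \<Rightarrow> nat"
  assumes ix: "enumerates ix I" and fin: "finite J" and LI: "L \<subseteq> I" and IJ: "I \<subseteq> J"
    and refl: "\<And>p. p \<in> J \<Longrightarrow> below p p"
    and rank: "\<And>p q. p \<in> I \<Longrightarrow> q \<in> I \<Longrightarrow> below p q \<Longrightarrow> p = q \<or> rank q < rank p"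
    and up: "\<And>p q. p \<in> L \<Longrightarrow> q \<in> J \<Longrightarrow> below p q \<Longrightarrow> q \<in> L"
    and R0: "\<And>p q. p \<in> J \<Longrightarrow> q \<in> J \<Longrightarrow> p \<in> L \<longleftrightarrow> q \<notin> L \<Longrightarrow> R p q = 0"
    and G: "\<And>p q. p \<in> I \<Longrightarrow> q \<in> I \<Longrightarrow> G p q = (\<Sum>p' | p' \<in> J \<and> below p p'. \<Sum>q' | q' \<in> J \<and> below q q'. R p' q')"
  shows "\<exists>U \<in> carrier_mat (length ix) (length ix). det U = 1 \<and>
    (\<forall>a < length ix. \<forall>b < length ix. ix ! a \<in> L \<longrightarrow>
      (transpose_mat U * matrix_of ix G * U) $$ (a, b) = R (ix ! a) (ix ! b))"
proof -
  have dist: "distinct ix" and set: "set ix = I" using ix by (auto simp: enumerates_def)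
  have finI: "finite I" using fin IJ finite_subset by blast
  let ?n = "length ix"
  \<comment> \<open>The row index is the upper element, so that \<open>Z\<^sup>T R' Z\<close> sums
    over the elements above the two indices. Outside \<open>L\<close> only the diagonal is
    kept.\<close>
  define z where "z p q = (if below q p \<and> (p \<in> L \<or> p = q) then 1 else 0 :: 'a)" for p q
  \<comment> \<open>What is cut off from the zeta matrix goes into \<open>R'\<close>: an entry with
    both indices outside \<open>L\<close> collects all contributions of upper elements outside
    \<open>L\<close>, including those that are not in \<open>I\<close>. Entries that touch
    \<open>L\<close> are those of \<open>R\<close>.\<close>
  define R' where "R' p q = (if p \<in> L \<or> q \<in> L then R p q
    else \<Sum>p' | p' \<in> J \<and> below p p' \<and> p' \<notin> L. \<Sum>q' | q' \<in> J \<and> below q q' \<and> q' \<notin> L. R p' q')" for p q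
  let ?Z = "matrix_of ix z"
  have Z: "?Z \<in> carrier_mat ?n ?n" by simp
  have detZ: "det ?Z = 1"
  proof (rule det_unitriangular[OF Z, where rank = "\<lambda>i. rank (ix ! i)"])
    fix i assume i: "i < ?n"
    then have "ix ! i \<in> I" using set nth_mem by blast
    then show "?Z $$ (i, i) = 1" using i refl IJ by (auto simp: matrix_of_def z_def)
  next
    fix i j assume ij: "i < ?n" "j < ?n" "?Z $$ (i, j) \<noteq> 0"
    then have "ix ! i \<in> I" "ix ! j \<in> I" using set nth_mem by blast+
    moreover have "below (ix ! j) (ix ! i)" using ij by (auto simp: matrix_of_def z_def split: if_splits)
    ultimately have "ix ! i = ix ! j \<or> rank (ix ! i) < rank (ix ! j)" using rank by metis
    then show "i = j \<or> rank (ix ! i) < rank (ix ! j)"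
      using dist ij by (simp add: nth_eq_iff_index_eq)
  qed
  \<comment> \<open>The adjugate is the inverse because the determinant is 1; thus the congruence is
    defined over the ring itself.\<close>
  define U where "U = adj_mat ?Z"
  have U: "U \<in> carrier_mat ?n ?n" and ZU: "?Z * U = 1\<^sub>m ?n"
    using adj_mat[OF Z] detZ by (auto simp: U_def intro!: eq_matI)
  have detU: "det U = 1"
    using det_mult[OF Z U] ZU detZ by simp
  have GZ: "G p q = (\<Sum>p'\<in>I. \<Sum>q'\<in>I. z p' p * R' p' q' * z q' q)" if pq: "p \<in> I" "q \<in> I" for p q
  proof -
    let ?Up = "\<lambda>p. {p' \<in> J. below p p'}" and ?UL = "\<lambda>p. {p' \<in> J. below p p' \<and> p' \<in> L}" and ?UN = "\<lambda>p. {p' \<in> J. below p p' \<and> p' \<notin> L}"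
    have finU: "finite (?UL p)" "finite (?UN p)" for p using fin by simp_all
    \<comment> \<open>Pairing with a column of \<open>z\<close> gives the elements of
      \<open>L\<close> above \<open>p\<close>, and \<open>p\<close> itself in addition if it is
      outside \<open>L\<close>; inside \<open>L\<close> reflexivity already counts it.\<close>
    have expand: "(\<Sum>p'\<in>I. z p' p * f p') = (\<Sum>p'\<in>?UL p. f p') + (if p \<in> L then 0 else f p)" if p: "p \<in> I" for p and f :: "'i \<Rightarrow> 'a"
    proof -
      have "(\<Sum>p'\<in>I. z p' p * f p') = (\<Sum>p'\<in>I. (if below p p' \<and> p' \<in> L then f p' else 0) + (if p' = p then (if p \<in> L then 0 else f p) else 0))"
        using p refl IJ by (intro sum.cong) (auto simp: z_def)
      also have "\<dots> = (\<Sum>p'\<in>{p' \<in> I. below p p' \<and> p' \<in> L}. f p') + (if p \<in> L then 0 else f p)"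
        using p finI by (simp add: sum.distrib sum.inter_filter)
      also have "{p' \<in> I. below p p' \<and> p' \<in> L} = ?UL p" using LI IJ by auto
      finally show ?thesis .
    qed
    have "(\<Sum>p'\<in>I. \<Sum>q'\<in>I. z p' p * R' p' q' * z q' q) = (\<Sum>p'\<in>I. z p' p * (\<Sum>q'\<in>I. z q' q * R' p' q'))"
      by (simp add: sum_distrib_left mult_ac)
    also have "\<dots> = (\<Sum>p'\<in>?UL p. (\<Sum>q'\<in>?UL q. R' p' q') + (if q \<in> L then 0 else R' p' q)) +
        (if p \<in> L then 0 else (\<Sum>q'\<in>?UL q. R' p q') + (if q \<in> L then 0 else R' p q))"
      unfolding expand[OF pq(1)] expand[OF pq(2)] ..
    also have "\<dots> = (\<Sum>p'\<in>?UL p. \<Sum>q'\<in>?UL q. R p' q') + (\<Sum>p'\<in>?UN p. \<Sum>q'\<in>?UN q. R p' q')"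
    proof -
      have J: "p \<in> J" "q \<in> J" using pq IJ by auto
      have "(\<Sum>p'\<in>?UL p. (\<Sum>q'\<in>?UL q. R' p' q') + (if q \<in> L then 0 else R' p' q)) = (\<Sum>p'\<in>?UL p. \<Sum>q'\<in>?UL q. R p' q')"
        using J R0 by (intro sum.cong) (auto simp: R'_def)
      moreover have "(if p \<in> L then 0 else (\<Sum>q'\<in>?UL q. R' p q') + (if q \<in> L then 0 else R' p q)) = (\<Sum>p'\<in>?UN p. \<Sum>q'\<in>?UN q. R p' q')"
      proof (cases "p \<in> L")
        case True
        then have "?UN p = {}" using up by auto
        then show ?thesis using True by (simp only: sum.empty if_True)
      next
        case pL: False
        have "(\<Sum>q'\<in>?UL q. R' p q') = 0" using J R0 pL by (intro sum.neutral) (auto simp: R'_def)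
        moreover have "(if q \<in> L then 0 else R' p q) = (\<Sum>p'\<in>?UN p. \<Sum>q'\<in>?UN q. R p' q')"
        proof (cases "q \<in> L")
          case True
          then have "?UN q = {}" using up by auto
          then show ?thesis using True by (simp only: sum.empty sum.neutral_const if_True)
        next
          case False
          then show ?thesis using pL by (simp add: R'_def)
        qed
        ultimately show ?thesis using pL by simp
      qed
      ultimately show ?thesis by simp
    qed
    \<comment> \<open>The upper sets are split by membership in \<open>L\<close>; the mixed terms
      vanish by \<open>R0\<close>, so the two remaining sums make up the full double sum.\<close>
    also have "\<dots> = (\<Sum>p'\<in>?Up p. \<Sum>q'\<in>?Up q. R p' q')"
    proof -
      have split: "sum f (?Up p) = sum f (?UL p) + sum f (?UN p)" for p and f :: "'i \<Rightarrow> 'a"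
        using fin by (subst sum.union_disjoint[symmetric]) (auto intro!: sum.cong)
      have "(\<Sum>q'\<in>?UN q. R p' q') = 0" if "p' \<in> ?UL p" for p'
        using that R0 by (intro sum.neutral) auto
      moreover have "(\<Sum>q'\<in>?UL q. R p' q') = 0" if "p' \<in> ?UN p" for p'
        using that R0 by (intro sum.neutral) auto
      ultimately show ?thesis unfolding split by (simp add: sum.distrib)
    qed
    finally show ?thesis using G[OF pq] by simp
  qed
  have "matrix_of ix G = transpose_mat ?Z * matrix_of ix R' * ?Z"
    unfolding transpose_matrix_of matrix_of_mult[OF dist] set
    by (rule matrix_of_cong) (auto simp: GZ set sum_distrib_right intro: sum.swap)
  then have "transpose_mat U * matrix_of ix G * U =
      transpose_mat U * (transpose_mat ?Z * matrix_of ix R' * ?Z) * U" by simp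
  also have "\<dots> = (transpose_mat U * transpose_mat ?Z) * matrix_of ix R' * (?Z * U)"
    using U by (simp add: assoc_mult_mat[of _ ?n ?n _ ?n _ ?n] mult_carrier_mat[of _ ?n ?n _ ?n])
  also have "transpose_mat U * transpose_mat ?Z = 1\<^sub>m ?n"
    using transpose_mult[OF Z U] ZU by simp
  finally have "transpose_mat U * matrix_of ix G * U = matrix_of ix R'"
    unfolding ZU by (simp only: left_mult_one_mat[OF matrix_of_carrier] right_mult_one_mat[OF matrix_of_carrier])
  then have "(transpose_mat U * matrix_of ix G * U) $$ (a, b) = R (ix ! a) (ix ! b)"
    if "a < ?n" "b < ?n" "ix ! a \<in> L" for a b
    using that by (simp add: matrix_of_def R'_def)
  then show ?thesis using U detU by blast
qed

section \<open>Eigenvalues in the Johnson scheme\<close>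

lemma subsets_of_card_finite: "finite A \<Longrightarrow> finite (subsets_of_card s A)"
  unfolding subsets_of_card_def by simp

text \<open>Products of the factors [a in S] - [b in S], built one pair at a time; \<open>l\<close>
  is the number of pairs. The vector \<open>v\<close> lives on the subsets of
  \<open>A - {a, b}\<close>, so the element of the pair that lies in \<open>S\<close> is removed
  before \<open>v\<close> is applied.\<close>

inductive johnson_vector :: "'a set \<Rightarrow> nat \<Rightarrow> nat \<Rightarrow> nat \<Rightarrow> ('a set \<Rightarrow> 'b::comm_ring_1) \<Rightarrow> bool" where
  const: "finite A \<Longrightarrow> card A = s + r \<Longrightarrow> johnson_vector A s r 0 (\<lambda>S. 1)"
| swap: "johnson_vector (A - {a, b}) s r l v \<Longrightarrow> a \<in> A \<Longrightarrow> b \<in> A \<Longrightarrow> a \<noteq> b \<Longrightarrow>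
    johnson_vector A (Suc s) (Suc r) (Suc l)
      (\<lambda>S. if a \<in> S \<and> b \<notin> S then v (S - {a}) else if b \<in> S \<and> a \<notin> S then - v (S - {b}) else 0)"

lemma johnson_vector_card:
  "johnson_vector A s r l v \<Longrightarrow> finite A \<and> card A = s + r \<and> l \<le> min s r"
proof (induction rule: johnson_vector.induct)
  case (swap A a b s r l v)
  then have "finite A" by simp
  moreover have "card (A - {a, b}) = card A - 2"
    using swap.hyps by (subst card_Diff_subset) auto
  moreover have "2 \<le> card A" using swap calculation(1) card_mono[of A "{a, b}"] by simp
  ultimately show ?case using swap by auto
qed simp

text \<open>Only the subsets with exactly one of \<open>a\<close> and \<open>b\<close> contribute,
  and they are \<open>insert a T\<close> and \<open>insert b T\<close> with \<open>T\<close>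
  avoiding both. This reduces each claim about subsets of size s + 1 to one about subsets of size s
  of a smaller set.\<close>

lemma sum_swap:
  assumes "finite A" "a \<in> A" "b \<in> A" "a \<noteq> b"
  shows "(\<Sum>T\<in>subsets_of_card (Suc s) A. f T *
      (if a \<in> T \<and> b \<notin> T then v (T - {a}) else if b \<in> T \<and> a \<notin> T then - v (T - {b}) else 0)) =
    (\<Sum>T\<in>subsets_of_card s (A - {a, b}). (f (insert a T) - f (insert b T)) * (v T :: 'b::comm_ring_1))"
    (is "(\<Sum>T\<in>?S. f T * ?w T) = ?rhs")
proof -
  let ?B = "subsets_of_card s (A - {a, b})"
  have fin: "finite ?S" using subsets_of_card_finite[OF assms(1)] .
  have part: "(\<Sum>T | T \<in> ?S \<and> x \<in> T \<and> y \<notin> T. g T) = (\<Sum>T\<in>?B. g (insert x T))"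
    if "{x, y} = {a, b}" for g :: "'a set \<Rightarrow> 'b" and x y
  proof (rule sum.reindex_bij_witness[where i = "insert x" and j = "\<lambda>T. T - {x}"])
    fix T assume T: "T \<in> {T. T \<in> ?S \<and> x \<in> T \<and> y \<notin> T}"
    then show "insert x (T - {x}) = T" by auto
    then show "g (insert x (T - {x})) = g T" by simp
    have "finite T" using T assms(1) finite_subset by (auto simp: subsets_of_card_def)
    then show "T - {x} \<in> ?B" using T that by (auto simp: subsets_of_card_def doubleton_eq_iff)
  next
    fix T assume T: "T \<in> ?B"
    have "finite T" using T assms(1) finite_subset[of T "A - {a, b}"] by (auto simp: subsets_of_card_def)
    moreover have "x \<notin> T" "y \<notin> T" using T that by (auto simp: subsets_of_card_def doubleton_eq_iff)
    moreover have "x \<noteq> y" "x \<in> A" using that assms by (auto simp: doubleton_eq_iff)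
    ultimately show "insert x T - {x} = T" "insert x T \<in> {T. T \<in> ?S \<and> x \<in> T \<and> y \<notin> T}"
      using T by (auto simp: subsets_of_card_def)
  qed
  have "(\<Sum>T\<in>?S. f T * ?w T) = (\<Sum>T\<in>?S. (if a \<in> T \<and> b \<notin> T then f T * v (T - {a}) else 0) +
      (if b \<in> T \<and> a \<notin> T then f T * - v (T - {b}) else 0))"
    by (intro sum.cong) auto
  also have "\<dots> = (\<Sum>T | T \<in> ?S \<and> a \<in> T \<and> b \<notin> T. f T * v (T - {a})) +
      (\<Sum>T | T \<in> ?S \<and> b \<in> T \<and> a \<notin> T. f T * - v (T - {b}))"
    by (simp only: sum.distrib sum.inter_filter[OF fin])
  also have "\<dots> = (\<Sum>T\<in>?B. f (insert a T) * v (insert a T - {a})) + (\<Sum>T\<in>?B. f (insert b T) * - v (insert b T - {b}))"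
    using part[of a b "\<lambda>T. f T * v (T - {a})"] part[of b a "\<lambda>T. f T * - v (T - {b})"] by (simp add: insert_commute)
  also have "\<dots> = ?rhs"
    unfolding sum.distrib[symmetric]
  proof (rule sum.cong[OF refl])
    fix T assume "T \<in> ?B"
    then have "insert a T - {a} = T" "insert b T - {b} = T" by (auto simp: subsets_of_card_def)
    then show "f (insert a T) * v (insert a T - {a}) + f (insert b T) * - v (insert b T - {b}) =
        (f (insert a T) - f (insert b T)) * v T"
      by (simp add: algebra_simps)
  qed
  finally show ?thesis .
qed

text \<open>The Eberlein polynomial: the eigenvalue of the relation "at distance t" on the l-th
  eigenspace of the Johnson scheme of s-subsets of a set with s + r elements.\<close>

definition johnson_value :: "nat \<Rightarrow> nat \<Rightarrow> nat \<Rightarrow> nat \<Rightarrow> int" where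
  "johnson_value s r t l = (\<Sum>j = 0..l. if j \<le> t
     then (- 1) ^ j * int (l choose j) * int ((s - l) choose (t - j)) * int ((r - l) choose (t - j)) else 0)"

text \<open>The summation bound no longer depends on \<open>l\<close>, since the binomial
  coefficient vanishes beyond it. This is the form in which Pascal's rule can be applied.\<close>

lemma johnson_value_alt:
  "johnson_value s r t l =
    (\<Sum>j\<le>t. (- 1) ^ j * int (l choose j) * (int ((s - l) choose (t - j)) * int ((r - l) choose (t - j))))"
proof -
  have "johnson_value s r t l = (\<Sum>j\<in>{j\<in>{0..l}. j \<le> t}. (- 1) ^ j * int (l choose j) * (int ((s - l) choose (t - j)) * int ((r - l) choose (t - j))))"
    unfolding johnson_value_def by (subst sum.inter_filter) (auto intro!: sum.cong simp: mult.assoc)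
  also have "\<dots> = (\<Sum>j\<le>t. (- 1) ^ j * int (l choose j) * (int ((s - l) choose (t - j)) * int ((r - l) choose (t - j))))"
    by (rule sum.mono_neutral_left) (auto simp: binomial_eq_0)
  finally show ?thesis .
qed

lemma johnson_value_Suc_0: "johnson_value (Suc s) (Suc r) 0 (Suc l) = johnson_value s r 0 l"
  by (simp add: johnson_value_alt)

text \<open>Pascal's rule for the coefficients of \<open>Suc l\<close>; the remaining factors do not
  change, because all of s, r and l grow by one.\<close>

lemma johnson_value_Suc:
  "johnson_value (Suc s) (Suc r) (Suc t) (Suc l) = johnson_value s r (Suc t) l - johnson_value s r t l"
proof -
  define h where "h m = int ((s - l) choose m) * int ((r - l) choose m)" for m
  have "(\<Sum>j\<le>Suc t. (- 1) ^ j * int (Suc l choose j) * h (Suc t - j)) =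
      (\<Sum>j\<le>Suc t. (- 1) ^ j * int (l choose j) * h (Suc t - j)) - (\<Sum>j\<le>t. (- 1) ^ j * int (l choose j) * h (t - j))"
    unfolding sum.atMost_Suc_shift by (simp add: algebra_simps sum.distrib sum_subtractf sum_negf)
  then show ?thesis
    unfolding johnson_value_alt h_def by simp
qed

text \<open>\<open>T\<close> is determined by the removed elements \<open>S - T\<close> and the
  added elements \<open>T - S\<close>, two independent choices of \<open>t\<close> elements.\<close>

lemma card_at_distance:
  assumes "finite A" "card A = s + r" "S \<in> subsets_of_card s A"
  shows "card {T \<in> subsets_of_card s A. card (S - T) = t} = (s choose t) * (r choose t)"
proof -
  have S: "S \<subseteq> A" "card S = s" "finite S" using assms finite_subset by (auto simp: subsets_of_card_def)
  let ?X = "{E. E \<subseteq> S \<and> card E = t}" and ?Y = "{E. E \<subseteq> A - S \<and> card E = t}"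
  have "bij_betw (\<lambda>T. (S - T, T - S)) {T \<in> subsets_of_card s A. card (S - T) = t} (?X \<times> ?Y)"
  proof (rule bij_betw_byWitness[where f' = "\<lambda>(E, F). (S - E) \<union> F"])
    show "\<forall>T\<in>{T \<in> subsets_of_card s A. card (S - T) = t}. (\<lambda>(E, F). (S - E) \<union> F) (S - T, T - S) = T"
      by auto
    show "\<forall>p\<in>?X \<times> ?Y. (\<lambda>T. (S - T, T - S)) ((\<lambda>(E, F). (S - E) \<union> F) p) = p"
      using S by auto
    have "card (T - S) = card (S - T)" if "T \<in> subsets_of_card s A" for T
    proof -
      have "finite T" "card T = s" using that assms(1) finite_subset by (auto simp: subsets_of_card_def)
      then show ?thesis
        using S card_Diff_subset_Int[of T S] card_Diff_subset_Int[of S T] by (simp add: Int_commute)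
    qed
    then show "(\<lambda>T. (S - T, T - S)) ` {T \<in> subsets_of_card s A. card (S - T) = t} \<subseteq> ?X \<times> ?Y"
      by (auto simp: subsets_of_card_def)
    show "(\<lambda>(E, F). (S - E) \<union> F) ` (?X \<times> ?Y) \<subseteq> {T \<in> subsets_of_card s A. card (S - T) = t}"
    proof clarify
      fix E F assume E: "E \<subseteq> S" "t = card E" and F: "F \<subseteq> A - S" "card F = card E"
      have fin: "finite E" "finite F" using E F S assms(1) finite_subset by blast+
      have "card ((S - E) \<union> F) = card (S - E) + card F" using fin S F by (intro card_Un_disjoint) auto
      then have "card ((S - E) \<union> F) = s" using E F S fin card_mono[of S E] by (simp add: card_Diff_subset)
      moreover have "S - ((S - E) \<union> F) = E" using E F by auto
      ultimately show "S - E \<union> F \<in> subsets_of_card s A \<and> card (S - (S - E \<union> F)) = card E"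
        using S F by (auto simp: subsets_of_card_def)
    qed
  qed
  then have "card {T \<in> subsets_of_card s A. card (S - T) = t} = card ?X * card ?Y"
    by (simp add: bij_betw_same_card card_cartesian_product)
  also have "card ?X = s choose t" using n_subsets[OF S(3)] S by simp
  also have "card ?Y = r choose t" using n_subsets[of "A - S" t] S assms by (simp add: card_Diff_subset)
  finally show ?thesis .
qed

text \<open>After \<open>sum_swap\<close> only the difference of the indicators at
  \<open>insert a T\<close> and \<open>insert b T\<close> matters. If \<open>S\<close> contains both
  or neither of \<open>a\<close> and \<open>b\<close>, the two distances agree and both sides
  vanish. Otherwise the distances differ by one, and the induction hypothesis for two neighbouring
  distances gives the recursion \<open>johnson_value_Suc\<close>.\<close>

lemma johnson_eigenvector:
  "johnson_vector A s r l (v :: 'a set \<Rightarrow> 'b::comm_ring_1) \<Longrightarrow> S \<in> subsets_of_card s A \<Longrightarrow>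
    (\<Sum>T\<in>subsets_of_card s A. (if card (S - T) = t then 1 else 0) * v T) = of_int (johnson_value s r t l) * v S"
proof (induction arbitrary: S t rule: johnson_vector.induct)
  case (const A s r)
  then show ?case
    using card_at_distance[OF const.hyps const.prems, of t] subsets_of_card_finite[OF const(1), of s]
    by (simp add: johnson_value_def sum.inter_filter[symmetric])
next
  case (swap A a b s r l v)
  let ?B = "subsets_of_card s (A - {a, b})"
  have finA: "finite A" using johnson_vector_card[OF swap.hyps(1)] by simp
  have S: "S \<subseteq> A" "card S = Suc s" "finite S" using swap.prems finA finite_subset by (auto simp: subsets_of_card_def)
  let ?d = "\<lambda>T. (if card (S - T) = t then 1 else 0) :: 'b"
  have T: "a \<notin> T" "b \<notin> T" if "T \<in> ?B" for T using that by (auto simp: subsets_of_card_def)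
  have main: "(\<Sum>T\<in>?B. ((if card (S' - T) = t then 1 else 0) - (if Suc (card (S' - T)) = t then 1 else 0)) * v T) =
      of_int (johnson_value (Suc s) (Suc r) t (Suc l)) * v S'" if "S' \<in> ?B" for S'
  proof (cases t)
    case 0
    then show ?thesis using swap.IH[OF that, of 0] by (simp add: johnson_value_Suc_0)
  next
    case (Suc t')
    then show ?thesis using swap.IH[OF that, of t] swap.IH[OF that, of t']
      by (simp add: johnson_value_Suc left_diff_distrib sum_subtractf)
  qed
  have ins: "card (S - insert a T) = card (S - {a, b} - T) + (if b \<in> S then 1 else 0)"
    "card (S - insert b T) = card (S - {a, b} - T) + (if a \<in> S then 1 else 0)" if "T \<in> ?B" for T
  proof -
    have "S - insert a T = (S - {a, b} - T) \<union> (if b \<in> S then {b} else {})"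
      "S - insert b T = (S - {a, b} - T) \<union> (if a \<in> S then {a} else {})"
      using T[OF that] swap.hyps(4) by auto
    then show "card (S - insert a T) = card (S - {a, b} - T) + (if b \<in> S then 1 else 0)"
      "card (S - insert b T) = card (S - {a, b} - T) + (if a \<in> S then 1 else 0)"
      using S(3) by auto
  qed
  have "(\<Sum>T\<in>?B. (?d (insert a T) - ?d (insert b T)) * v T) = of_int (johnson_value (Suc s) (Suc r) t (Suc l)) *
        (if a \<in> S \<and> b \<notin> S then v (S - {a}) else if b \<in> S \<and> a \<notin> S then - v (S - {b}) else 0)"
  proof (cases "a \<in> S \<longleftrightarrow> b \<in> S")
    case True
    then have "(\<Sum>T\<in>?B. (?d (insert a T) - ?d (insert b T)) * v T) = 0"
      using ins by (intro sum.neutral) simp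
    then show "(\<Sum>T\<in>?B. (?d (insert a T) - ?d (insert b T)) * v T) = of_int (johnson_value (Suc s) (Suc r) t (Suc l)) *
        (if a \<in> S \<and> b \<notin> S then v (S - {a}) else if b \<in> S \<and> a \<notin> S then - v (S - {b}) else 0)"
      using True by simp
  next
    case False
    show "(\<Sum>T\<in>?B. (?d (insert a T) - ?d (insert b T)) * v T) = of_int (johnson_value (Suc s) (Suc r) t (Suc l)) *
        (if a \<in> S \<and> b \<notin> S then v (S - {a}) else if b \<in> S \<and> a \<notin> S then - v (S - {b}) else 0)"
    proof (cases "a \<in> S")
      case aS: True
      then have Sa: "S - {a, b} = S - {a}" "S - {a} \<in> ?B" using False S by (auto simp: subsets_of_card_def)
      have "(\<Sum>T\<in>?B. (?d (insert a T) - ?d (insert b T)) * v T) =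
          (\<Sum>T\<in>?B. ((if card (S - {a} - T) = t then 1 else 0) - (if Suc (card (S - {a} - T)) = t then 1 else 0)) * v T)"
        using ins False aS by (intro sum.cong) (auto simp: Sa(1))
      then show ?thesis using main[OF Sa(2)] False aS by simp
    next
      case aS: False
      then have Sa: "S - {a, b} = S - {b}" "S - {b} \<in> ?B" using False S by (auto simp: subsets_of_card_def)
      have "(\<Sum>T\<in>?B. (?d (insert a T) - ?d (insert b T)) * v T) =
          - (\<Sum>T\<in>?B. ((if card (S - {b} - T) = t then 1 else 0) - (if Suc (card (S - {b} - T)) = t then 1 else 0)) * v T)"
        unfolding sum_negf[symmetric] using ins False aS by (intro sum.cong) (auto simp: Sa(1) algebra_simps)
      then show ?thesis using main[OF Sa(2)] False aS by simp
    qed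
  qed
  then show ?case
    by (simp only: sum_swap[OF finA swap.hyps(2-4), where s = s and f = ?d and v = v])
qed

lemma johnson_vector_nonzero:
  "johnson_vector A s r l (v :: 'a set \<Rightarrow> 'b::comm_ring_1) \<Longrightarrow> \<exists>S\<in>subsets_of_card s A. v S \<noteq> 0"
proof (induction rule: johnson_vector.induct)
  case (const A s r)
  then obtain S where "S \<subseteq> A" "card S = s" by (metis le_add1 obtain_subset_with_card_n)
  then show ?case by (auto simp: subsets_of_card_def)
next
  case (swap A a b s r l v)
  then obtain S where S: "S \<subseteq> A - {a, b}" "card S = s" "v S \<noteq> 0" by (auto simp: subsets_of_card_def)
  have "finite S" using johnson_vector_card[OF swap.hyps(1)] S finite_subset by blast
  moreover have "a \<notin> S" using S by auto
  ultimately have "insert a S \<in> subsets_of_card (Suc s) A" using S swap by (auto simp: subsets_of_card_def)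
  moreover have "insert a S - {a} = S" "b \<notin> insert a S" using S swap by auto
  ultimately show ?case using S(3) by (intro bexI[of _ "insert a S"]) auto
qed

lemma johnson_vector_exists:
  "finite A \<Longrightarrow> card A = s + r \<Longrightarrow> l \<le> min s r \<Longrightarrow> \<exists>v :: 'a set \<Rightarrow> 'b::comm_ring_1. johnson_vector A s r l v"
proof (induction l arbitrary: A s r)
  case 0
  then show ?case using johnson_vector.const by blast
next
  case (Suc l)
  then obtain s' r' where sr: "s = Suc s'" "r = Suc r'" by (metis Suc_le_D min.bounded_iff)
  then have "2 \<le> card A" using Suc.prems by simp
  then obtain B where "B \<subseteq> A" "card B = 2" by (metis obtain_subset_with_card_n)
  then obtain a b where ab: "a \<in> A" "b \<in> A" "a \<noteq> b" by (auto simp: card_2_iff)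
  have "card (A - {a, b}) = s' + r'" using ab Suc.prems sr by (simp add: card_Diff_subset)
  then obtain v :: "'a set \<Rightarrow> 'b" where "johnson_vector (A - {a, b}) s' r' l v"
    using Suc.IH[of "A - {a, b}" s' r'] Suc.prems sr by auto
  then show ?case using johnson_vector.swap[OF _ ab] sr by blast
qed

text \<open>Completeness, stated through orthogonality. By \<open>sum_swap\<close> the function
  \<open>u (insert a T) - u (insert b T)\<close> is orthogonal to all Johnson vectors of the smaller
  set, so it vanishes by induction. Thus \<open>u\<close> is invariant under exchanges, hence
  constant, and orthogonality to the constant vector gives 0 because the number of subsets is
  invertible in characteristic zero.\<close>

lemma johnson_vectors_total:
  assumes "\<And>n. n \<noteq> 0 \<Longrightarrow> of_nat n \<noteq> (0 :: 'b)" "finite A" "card A = s + r"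
    and "\<And>l v. johnson_vector A s r l v \<Longrightarrow> (\<Sum>T\<in>subsets_of_card s A. u T * v T) = 0"
    and "S \<in> subsets_of_card s A"
  shows "u S = (0 :: 'b::field)"
  using assms(2-)
proof (induction s arbitrary: A r u S)
  case 0
  have "subsets_of_card 0 A = {{}}" using 0 finite_subset[OF _ 0(1)] by (auto simp: subsets_of_card_def)
  then show ?case using 0(3)[OF johnson_vector.const[OF 0(1,2)]] 0(4) by simp
next
  case (Suc s)
  show ?case
  proof (cases r)
    case 0
    have "subsets_of_card (Suc s) A = {A}"
      using Suc.prems(1,2) 0 card_subset_eq[of A] by (auto simp: subsets_of_card_def)
    then show ?thesis using Suc.prems(3)[OF johnson_vector.const[OF Suc.prems(1,2)]] Suc.prems(4) by simp
  next
    case (Suc r')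
    have exch: "u (insert a T) = u (insert b T)"
      if "a \<in> A" "b \<in> A" "a \<noteq> b" "T \<in> subsets_of_card s (A - {a, b})" for a b T
    proof -
      have "u (insert a T) - u (insert b T) = 0"
      proof (rule Suc.IH[of "A - {a, b}" r' "\<lambda>T. u (insert a T) - u (insert b T)"])
        show "finite (A - {a, b})" using Suc.prems by simp
        show "card (A - {a, b}) = s + r'" using that Suc.prems Suc by (simp add: card_Diff_subset)
        fix l v assume "johnson_vector (A - {a, b}) s r' l (v :: 'a set \<Rightarrow> 'b)"
        from johnson_vector.swap[OF this that(1-3)]
        show "(\<Sum>T\<in>subsets_of_card s (A - {a, b}). (u (insert a T) - u (insert b T)) * v T) = 0"
          using Suc.prems(3) sum_swap[OF Suc.prems(1) that(1-3), where s = s and f = u and v = v] Suc by simp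
      qed (use that in simp)
      then show ?thesis by simp
    qed
    have const: "u T = u S" if "T \<in> subsets_of_card (Suc s) A" for T
      using that
    proof (induction "card (T - S)" arbitrary: T)
      case 0
      then have "finite T" using Suc.prems(1) finite_subset by (auto simp: subsets_of_card_def)
      with 0 have "T \<subseteq> S" by auto
      moreover have "finite S" using Suc.prems(1,4) finite_subset by (auto simp: subsets_of_card_def)
      ultimately show ?case using 0 Suc.prems(4) card_subset_eq[of S T] by (auto simp: subsets_of_card_def)
    next
      case (Suc n)
      then have T: "T \<subseteq> A" "card T = Suc s" "finite T" using \<open>finite A\<close> finite_subset by (auto simp: subsets_of_card_def)
      have S: "S \<subseteq> A" "card S = Suc s" "finite S" using \<open>S \<in> _\<close> \<open>finite A\<close> finite_subset by (auto simp: subsets_of_card_def)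
      obtain a where a: "a \<in> T" "a \<notin> S" using Suc(2) by (metis DiffE card_gt_0_iff ex_in_conv zero_less_Suc)
      have "\<not> S \<subseteq> T" using a S T card_subset_eq[of T S] by auto
      then obtain b where b: "b \<in> S" "b \<notin> T" by auto
      have "T - {a} \<in> subsets_of_card s (A - {a, b})" using a b T by (auto simp: subsets_of_card_def)
      then have "u T = u (insert b (T - {a}))"
        using exch[of a b "T - {a}"] a b S T by (auto simp: insert_absorb)
      also have "\<dots> = u S"
      proof (rule Suc.hyps(1))
        have "insert b (T - {a}) - S = (T - S) - {a}" using b by auto
        then show "n = card (insert b (T - {a}) - S)" using Suc(2) a T by simp
        show "insert b (T - {a}) \<in> subsets_of_card (Suc s) A" using a b S T by (auto simp: subsets_of_card_def)
      qed
      finally show ?case .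
    qed
    have "(\<Sum>T\<in>subsets_of_card (Suc s) A. u T * 1) = 0"
      using Suc.prems(3)[OF johnson_vector.const[OF Suc.prems(1,2)]] .
    then have "of_nat (card (subsets_of_card (Suc s) A)) * u S = 0"
      using const by simp
    moreover have "card (subsets_of_card (Suc s) A) \<noteq> 0"
      using Suc.prems(4) subsets_of_card_finite[OF Suc.prems(1), of "Suc s"] by auto
    ultimately show ?thesis using assms(1) by simp
  qed
qed

section \<open>Spectra from a total family of eigenvectors\<close>

lemma mult_mat_vec_matrix_of:
  fixes u :: "'b::comm_ring_1 vec"
  assumes "distinct ix" "u \<in> carrier_vec (length ix)" "\<And>a. a < length ix \<Longrightarrow> u $ a = f (ix ! a)" "a < length ix"
  shows "(matrix_of ix M *\<^sub>v u) $ a = (\<Sum>q\<in>set ix. M (ix ! a) q * f q)"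
proof -
  have "(matrix_of ix M *\<^sub>v u) $ a = (\<Sum>b<length ix. M (ix ! a) (ix ! b) * f (ix ! b))"
    using assms by (auto simp: matrix_of_def scalar_prod_def atLeast0LessThan intro!: sum.cong)
  also have "\<dots> = (\<Sum>q\<in>set ix. M (ix ! a) q * f q)"
    by (rule sum.reindex_bij_betw[OF bij_betw_nth[OF assms(1) refl refl]])
  finally show ?thesis .
qed

text \<open>\<open>B\<close> pairs eigenvectors with their values. The pairing is bilinear and not
  an inner product, so completeness enters as \<open>total\<close>: by symmetry an eigenvector for a
  value outside \<open>snd\<close> would be orthogonal to every vector of \<open>B\<close>, hence
  zero.\<close>

lemma spectrum_matrix_of:
  fixes M :: "'i \<Rightarrow> 'i \<Rightarrow> 'f::field"
  assumes ix: "enumerates ix I"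
    and sym: "\<And>p q. p \<in> I \<Longrightarrow> q \<in> I \<Longrightarrow> M p q = M q p"
    and eigen: "\<And>v e p. (v, e) \<in> B \<Longrightarrow> p \<in> I \<Longrightarrow> (\<Sum>q\<in>I. M p q * v q) = e * v p"
    and nonzero: "\<And>v e. (v, e) \<in> B \<Longrightarrow> \<exists>p\<in>I. v p \<noteq> 0"
    and total: "\<And>u p. (\<And>v e. (v, e) \<in> B \<Longrightarrow> (\<Sum>q\<in>I. u q * v q) = 0) \<Longrightarrow> p \<in> I \<Longrightarrow> u p = 0"
  shows "spectrum (matrix_of ix M) = snd ` B"
proof
  let ?n = "length ix" and ?M = "matrix_of ix M"
  have dist: "distinct ix" and set: "set ix = I" using ix by (auto simp: enumerates_def)
  have dim: "dim_row ?M = ?n" by (simp add: matrix_of_def)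
  show "snd ` B \<subseteq> spectrum ?M"
  proof
    fix e assume "e \<in> snd ` B"
    then obtain v where v: "(v, e) \<in> B" by auto
    let ?u = "vec ?n (\<lambda>a. v (ix ! a))"
    obtain p where "p \<in> I" "v p \<noteq> 0" using nonzero[OF v] by auto
    then obtain a where a: "a < ?n" "v (ix ! a) \<noteq> 0" using set by (metis in_set_conv_nth)
    have "?M *\<^sub>v ?u = e \<cdot>\<^sub>v ?u"
    proof (rule eq_vecI)
      fix i assume "i < dim_vec (e \<cdot>\<^sub>v ?u)"
      then have i: "i < ?n" by simp
      moreover have "ix ! i \<in> I" using i set nth_mem by blast
      ultimately show "(?M *\<^sub>v ?u) $ i = (e \<cdot>\<^sub>v ?u) $ i"
        using mult_mat_vec_matrix_of[OF dist, of ?u v i M] eigen[OF v, of "ix ! i"] set by simp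
    qed (simp add: dim)
    moreover have "?u \<noteq> 0\<^sub>v ?n" using a by (metis index_vec index_zero_vec(1))
    ultimately have "eigenvector ?M ?u e" by (simp add: eigenvector_def dim)
    then show "e \<in> spectrum ?M" by (auto simp: spectrum_def eigenvalue_def)
  qed
  show "spectrum ?M \<subseteq> snd ` B"
  proof
    fix e assume "e \<in> spectrum ?M"
    then obtain w where w: "w \<in> carrier_vec ?n" "w \<noteq> 0\<^sub>v ?n" "?M *\<^sub>v w = e \<cdot>\<^sub>v w"
      by (auto simp: spectrum_def eigenvalue_def eigenvector_def dim)
    define u where "u p = w $ (the_inv_into {..<?n} ((!) ix) p)" for p
    have u: "w $ a = u (ix ! a)" if "a < ?n" for a
      using that dist by (simp add: u_def the_inv_into_f_f inj_on_nth)
    have Mu: "(\<Sum>q\<in>I. M p q * u q) = e * u p" if "p \<in> I" for p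
    proof -
      have "p \<in> set ix" using that set by simp
      then obtain a where a: "a < ?n" "p = ix ! a" unfolding in_set_conv_nth by blast
      have "(?M *\<^sub>v w) $ a = e * w $ a" unfolding w(3) using w(1) a(1) by simp
      then have "(\<Sum>q\<in>I. M (ix ! a) q * u q) = e * w $ a"
        using mult_mat_vec_matrix_of[OF dist w(1) u a(1), of M] set by simp
      then show ?thesis unfolding a(2) u[OF a(1)] .
    qed
    show "e \<in> snd ` B"
    proof (rule ccontr)
      assume e: "e \<notin> snd ` B"
      have "(\<Sum>q\<in>I. u q * v q) = 0" if v: "(v, e') \<in> B" for v e'
      proof -
        have "e * (\<Sum>q\<in>I. u q * v q) = (\<Sum>q\<in>I. (\<Sum>p\<in>I. M q p * u p) * v q)"
          unfolding sum_distrib_left by (intro sum.cong) (simp_all add: Mu)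
        also have "\<dots> = (\<Sum>q\<in>I. \<Sum>p\<in>I. M q p * u p * v q)"
          by (simp add: sum_distrib_right)
        also have "\<dots> = (\<Sum>p\<in>I. \<Sum>q\<in>I. M q p * u p * v q)"
          by (rule sum.swap)
        also have "\<dots> = (\<Sum>p\<in>I. u p * (\<Sum>q\<in>I. M p q * v q))"
          unfolding sum_distrib_left by (intro sum.cong) (auto simp: sym)
        also have "\<dots> = (\<Sum>p\<in>I. u p * (e' * v p))"
          by (intro sum.cong) (simp_all add: eigen[OF v])
        also have "\<dots> = e' * (\<Sum>q\<in>I. u q * v q)"
          by (simp add: sum_distrib_left mult.left_commute)
        finally have "(e - e') * (\<Sum>q\<in>I. u q * v q) = 0" by (simp add: left_diff_distrib)
        moreover have "e \<noteq> e'" using e v by force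
        ultimately show ?thesis by simp
      qed
      then have "u p = 0" if "p \<in> I" for p using total that by blast
      then have "w $ a = 0" if "a < ?n" for a using u[OF that] that set nth_mem by metis
      then have "w = 0\<^sub>v ?n" using w(1) by (intro eq_vecI) auto
      then show False using w(2) by simp
    qed
  qed
qed

lemma emb_hom [simp]:
  "emb 0 = 0" "emb 1 = 1" "emb (a + b) = emb a + emb b" "emb (a * b) = emb a * emb b"
  "emb (of_int i) = of_int i"
proof -
  show h: "emb 0 = 0" "emb 1 = 1" "emb (a + b) = emb a + emb b" "emb (a * b) = emb a * emb b" for a b
    by (simp_all add: emb_def)
  have m: "emb (- a) = - emb a" for a by (simp add: emb_def)
  have n: "emb (of_nat n) = of_nat n" for n by (induction n) (simp_all add: h)
  show "emb (of_int i) = of_int i"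
    by (cases i rule: int_cases2) (simp_all add: n m)
qed

lemma emb_sum [simp]: "emb (sum f A) = (\<Sum>a\<in>A. emb (f a))"
  by (induction A rule: infinite_finite_induct) simp_all

lemma emb_0_iff [simp]: "emb a = 0 \<longleftrightarrow> a = 0"
  by (simp add: emb_def)

lemma of_nat_closure_nonzero: "n \<noteq> 0 \<Longrightarrow> of_nat n \<noteq> (0 :: complex poly fract alg_closure)"
  using emb_hom(5)[of "int n"] emb_0_iff[of "of_nat n"] by (metis of_int_of_nat_eq of_nat_eq_0_iff)

lemma card_Diff_commute:
  assumes "finite A" "S \<in> subsets_of_card s A" "T \<in> subsets_of_card s A"
  shows "card (S - T) = card (T - S)"
proof -
  have "finite S" "finite T" using assms finite_subset by (auto simp: subsets_of_card_def)
  then show ?thesis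
    using assms card_Diff_subset_Int[of T S] card_Diff_subset_Int[of S T]
    by (simp add: Int_commute subsets_of_card_def)
qed

text \<open>Keeps the truncated index \<open>min s r - card (S - T)\<close> of
  \<open>factor_entry\<close> faithful.\<close>

lemma card_Diff_le_min:
  assumes A: "finite A" "card A = s + r" and S: "S \<in> subsets_of_card s A" and T: "T \<in> subsets_of_card s A"
  shows "card (S - T) \<le> min s r"
proof -
  have fin: "finite S" "finite T" using A S T finite_subset by (auto simp: subsets_of_card_def)
  have "card (T - S) \<le> card (A - S)" using A T by (intro card_mono) (auto simp: subsets_of_card_def)
  also have "\<dots> = r" using A S fin by (simp add: card_Diff_subset subsets_of_card_def)
  finally show ?thesis
    using card_Diff_commute[OF A(1) S T] card_mono[OF fin(1), of "S - T"] S by (auto simp: subsets_of_card_def)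
qed

lemma factor_entry_sym:
  "finite A \<Longrightarrow> S \<in> subsets_of_card s A \<Longrightarrow> T \<in> subsets_of_card s A \<Longrightarrow>
    factor_entry entry s r S T = factor_entry entry s r T S"
  using card_Diff_commute by (metis factor_entry_def)

text \<open>Sorting the columns by their distance from \<open>S\<close> writes the factor as a
  combination of the distance relations, which have the Johnson vectors as common
  eigenvectors.\<close>

lemma factor_eigenvector:
  fixes v :: "'a set \<Rightarrow> complex poly fract alg_closure"
  assumes v: "johnson_vector A s r l v" and S: "S \<in> subsets_of_card s A"
  shows "(\<Sum>T\<in>subsets_of_card s A. emb (factor_entry entry s r S T) * v T) = emb (eigenvalue_formula entry s r l) * v S"
proof -
  have A: "finite A" "card A = s + r" using johnson_vector_card[OF v] by auto
  have le: "card (S - T) \<le> min s r" if "T \<in> subsets_of_card s A" for T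
    by (rule card_Diff_le_min[OF A S that])
  have "(\<Sum>T\<in>subsets_of_card s A. emb (factor_entry entry s r S T) * v T) =
    (\<Sum>T\<in>subsets_of_card s A. \<Sum>t=0..min s r. (if card (S - T) = t then emb (entry s r (min s r - t)) * v T else 0))"
    using le by (intro sum.cong) (auto simp: factor_entry_def)
  also have "\<dots> = (\<Sum>t=0..min s r. \<Sum>T\<in>subsets_of_card s A. (if card (S - T) = t then emb (entry s r (min s r - t)) * v T else 0))"
    by (rule sum.swap)
  also have "\<dots> = (\<Sum>t=0..min s r. emb (entry s r (min s r - t)) * (\<Sum>T\<in>subsets_of_card s A. (if card (S - T) = t then 1 else 0) * v T))"
    unfolding sum_distrib_left by (intro sum.cong) auto
  also have "\<dots> = (\<Sum>t=0..min s r. emb (entry s r (min s r - t)) * (of_int (johnson_value s r t l) * v S))"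
    by (simp only: johnson_eigenvector[OF v S])
  also have "\<dots> = emb (eigenvalue_formula entry s r l) * v S"
    unfolding eigenvalue_formula_def johnson_value_def[symmetric] emb_sum sum_distrib_right
    by (intro sum.cong) (simp_all only: emb_hom mult_ac)
  finally show ?thesis .
qed

lemma map_mat_matrix_of: "map_mat f (matrix_of ix M) = matrix_of ix (\<lambda>p q. f (M p q))"
  by (rule eq_matI) (auto simp: matrix_of_def)

lemma factor_has_eigenvalue_set:
  assumes A: "finite A" "card A = s + r"
  shows "has_eigenvalue_set (subsets_of_card s A) (factor_entry entry s r) (eigenvalue_list entry s r)"
  unfolding has_eigenvalue_set_def
proof (intro conjI allI impI)
  show "finite (subsets_of_card s A)" by (rule subsets_of_card_finite[OF A(1)])
  fix ix assume ix: "enumerates ix (subsets_of_card s A)"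
  let ?B = "{(v :: 'a set \<Rightarrow> complex poly fract alg_closure, emb (eigenvalue_formula entry s r l)) |v l. johnson_vector A s r l v}"
  have "spectrum (matrix_of ix (\<lambda>p q. emb (factor_entry entry s r p q))) = snd ` ?B"
  proof (rule spectrum_matrix_of[OF ix])
    show "\<And>p q. p \<in> subsets_of_card s A \<Longrightarrow> q \<in> subsets_of_card s A \<Longrightarrow>
      emb (factor_entry entry s r p q) = emb (factor_entry entry s r q p)"
      using factor_entry_sym[OF A(1)] by metis
    show "\<And>v e p. (v, e) \<in> ?B \<Longrightarrow> p \<in> subsets_of_card s A \<Longrightarrow>
      (\<Sum>q\<in>subsets_of_card s A. emb (factor_entry entry s r p q) * v q) = e * v p"
      using factor_eigenvector by blast
    show "\<And>v e. (v, e) \<in> ?B \<Longrightarrow> \<exists>p\<in>subsets_of_card s A. v p \<noteq> 0"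
      using johnson_vector_nonzero by blast
    show "u p = 0" if "\<And>v e. (v, e) \<in> ?B \<Longrightarrow> (\<Sum>q\<in>subsets_of_card s A. u q * v q) = 0" "p \<in> subsets_of_card s A" for u p
    proof (rule johnson_vectors_total[OF of_nat_closure_nonzero A _ that(2)])
      fix l v assume "johnson_vector A s r l (v :: 'a set \<Rightarrow> complex poly fract alg_closure)"
      then have "(v, emb (eigenvalue_formula entry s r l)) \<in> ?B" by blast
      then show "(\<Sum>T\<in>subsets_of_card s A. u T * v T) = 0" by (rule that(1))
    qed
  qed
  also have "snd ` ?B = emb ` eigenvalue_list entry s r"
  proof (intro equalityI subsetI)
    fix e assume "e \<in> snd ` ?B"
    then obtain v :: "'a set \<Rightarrow> complex poly fract alg_closure" and l
      where v: "johnson_vector A s r l v" and e: "e = emb (eigenvalue_formula entry s r l)" by auto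
    then show "e \<in> emb ` eigenvalue_list entry s r"
      using johnson_vector_card[OF v] unfolding eigenvalue_list_def by blast
  next
    fix e assume "e \<in> emb ` eigenvalue_list entry s r"
    then obtain l where l: "l \<le> min s r" and e: "e = emb (eigenvalue_formula entry s r l)"
      unfolding eigenvalue_list_def by blast
    obtain v :: "'a set \<Rightarrow> complex poly fract alg_closure" where "johnson_vector A s r l v"
      using johnson_vector_exists[OF A l] by blast
    then have "(v, e) \<in> ?B" using e by blast
    then show "e \<in> snd ` ?B" by force
  qed
  finally show "spectrum (map_mat emb (matrix_of ix (factor_entry entry s r))) = emb ` eigenvalue_list entry s r"
    by (simp add: map_mat_matrix_of)
qed

text \<open>A block diagonal matrix with one block for each value of \<open>\<delta>\<close>; within
  a block \<open>\<epsilon>\<close> and \<open>\<zeta>\<close> are the two tensor coordinates. The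
  eigenvectors are products of Johnson vectors, extended by zero to the other blocks.\<close>

lemma tensor_has_eigenvalue_set:
  fixes \<delta> :: "'i \<Rightarrow> 'd" and \<epsilon> :: "'i \<Rightarrow> 'a set" and \<zeta> :: "'i \<Rightarrow> 'b set"
  assumes fin: "finite I"
    and A: "\<And>d. d \<in> \<delta> ` I \<Longrightarrow> finite (A d) \<and> card (A d) = s1 + r1 d"
    and B: "\<And>d. d \<in> \<delta> ` I \<Longrightarrow> finite (B d) \<and> card (B d) = s2 + r2 d"
    and bij: "\<And>d. d \<in> \<delta> ` I \<Longrightarrow>
      bij_betw (\<lambda>p. (\<epsilon> p, \<zeta> p)) {p \<in> I. \<delta> p = d} (subsets_of_card s1 (A d) \<times> subsets_of_card s2 (B d))"
    and M: "\<And>p q. p \<in> I \<Longrightarrow> q \<in> I \<Longrightarrow> M p q = (if \<delta> p = \<delta> q then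
      factor_entry E1 s1 (r1 (\<delta> p)) (\<epsilon> p) (\<epsilon> q) * factor_entry E2 s2 (r2 (\<delta> p)) (\<zeta> p) (\<zeta> q) else 0)"
  shows "has_eigenvalue_set I M
    (\<Union>d\<in>\<delta> ` I. products (eigenvalue_list E1 s1 (r1 d)) (eigenvalue_list E2 s2 (r2 d)))"
  unfolding has_eigenvalue_set_def
proof (intro conjI allI impI)
  show "finite I" by (rule fin)
  fix ix assume ix: "enumerates ix I"
  let ?J1 = "\<lambda>d l (v :: 'a set \<Rightarrow> complex poly fract alg_closure). johnson_vector (A d) s1 (r1 d) l v"
  let ?J2 = "\<lambda>d m (w :: 'b set \<Rightarrow> complex poly fract alg_closure). johnson_vector (B d) s2 (r2 d) m w"
  let ?S1 = "\<lambda>d. subsets_of_card s1 (A d)" and ?S2 = "\<lambda>d. subsets_of_card s2 (B d)"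
  let ?t = "\<lambda>d (v :: 'a set \<Rightarrow> complex poly fract alg_closure) w p. if \<delta> p = d then v (\<epsilon> p) * w (\<zeta> p) else 0"
  let ?ev = "\<lambda>d l m. emb (eigenvalue_formula E1 s1 (r1 d) l * eigenvalue_formula E2 s2 (r2 d) m)"
  let ?B = "{(?t d v w, ?ev d l m) |d v l w m. d \<in> \<delta> ` I \<and> ?J1 d l v \<and> ?J2 d m w}"
  have mem: "\<epsilon> p \<in> ?S1 (\<delta> p)" "\<zeta> p \<in> ?S2 (\<delta> p)" if "p \<in> I" for p
    using bij_betwE[OF bij[of "\<delta> p"]] that by auto
  have sum: "(\<Sum>q\<in>I. if \<delta> q = d then F (\<epsilon> q) (\<zeta> q) else 0) = (\<Sum>S\<in>?S1 d. \<Sum>T\<in>?S2 d. F S T)"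
    if "d \<in> \<delta> ` I" for d and F :: "'a set \<Rightarrow> 'b set \<Rightarrow> complex poly fract alg_closure"
  proof -
    have "(\<Sum>q\<in>I. if \<delta> q = d then F (\<epsilon> q) (\<zeta> q) else 0) = (\<Sum>q\<in>{p \<in> I. \<delta> p = d}. (\<lambda>(S, T). F S T) (\<epsilon> q, \<zeta> q))"
      by (simp add: sum.inter_filter[OF fin])
    also have "\<dots> = (\<Sum>x\<in>?S1 d \<times> ?S2 d. (\<lambda>(S, T). F S T) x)"
      by (rule sum.reindex_bij_betw[OF bij[OF that]])
    finally show ?thesis by (simp add: sum.cartesian_product)
  qed
  have "spectrum (matrix_of ix (\<lambda>p q. emb (M p q))) = snd ` ?B"
  proof (rule spectrum_matrix_of[OF ix])
    fix p q assume pq: "p \<in> I" "q \<in> I"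
    show "emb (M p q) = emb (M q p)"
    proof (cases "\<delta> p = \<delta> q")
      case True
      have "d \<in> \<delta> ` I" if "d = \<delta> q" for d using that pq by auto
      then show ?thesis
        using M[OF pq] M[OF pq(2,1)] True mem[OF pq(1)] mem[OF pq(2)]
          factor_entry_sym[of "A (\<delta> q)" "\<epsilon> p" s1 "\<epsilon> q" E1 "r1 (\<delta> q)"] factor_entry_sym[of "B (\<delta> q)" "\<zeta> p" s2 "\<zeta> q" E2 "r2 (\<delta> q)"]
          A[of "\<delta> q"] B[of "\<delta> q"] by simp
    qed (simp add: M pq)
  next
    fix u e p assume "(u, e) \<in> ?B" and p: "p \<in> I"
    then obtain d v l w m where d: "d \<in> \<delta> ` I" and u: "u = ?t d v w" and e: "e = ?ev d l m"
      and v: "?J1 d l v" and w: "?J2 d m w" by blast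
    show "(\<Sum>q\<in>I. emb (M p q) * u q) = e * u p"
    proof (cases "\<delta> p = d")
      case True
      let ?F1 = "\<lambda>S. emb (factor_entry E1 s1 (r1 d) (\<epsilon> p) S) * v S"
      let ?F2 = "\<lambda>T. emb (factor_entry E2 s2 (r2 d) (\<zeta> p) T) * w T"
      have "(\<Sum>q\<in>I. emb (M p q) * u q) = (\<Sum>q\<in>I. if \<delta> q = d then ?F1 (\<epsilon> q) * ?F2 (\<zeta> q) else 0)"
        using p True by (intro sum.cong) (auto simp: M u)
      also have "\<dots> = (\<Sum>S\<in>?S1 d. \<Sum>T\<in>?S2 d. ?F1 S * ?F2 T)"
        by (rule sum[OF d])
      also have "\<dots> = (\<Sum>S\<in>?S1 d. ?F1 S) * (\<Sum>T\<in>?S2 d. ?F2 T)"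
        by (simp add: sum_product)
      also have "\<dots> = e * u p"
        using factor_eigenvector[OF v, of "\<epsilon> p"] factor_eigenvector[OF w, of "\<zeta> p"] mem[OF p] True
        by (simp add: e u)
      finally show ?thesis .
    next
      case False
      then have "emb (M p q) * u q = 0" if "q \<in> I" for q
        using that p by (auto simp: M u)
      then have "(\<Sum>q\<in>I. emb (M p q) * u q) = 0" by (intro sum.neutral) blast
      then show ?thesis using False by (simp add: u)
    qed
  next
    fix u e assume "(u, e) \<in> ?B"
    then obtain d v l w m where d: "d \<in> \<delta> ` I" and u: "u = ?t d v w"
      and v: "?J1 d l v" and w: "?J2 d m w" by blast
    obtain S T where ST: "S \<in> ?S1 d" "v S \<noteq> 0" "T \<in> ?S2 d" "w T \<noteq> 0"
      using johnson_vector_nonzero[OF v] johnson_vector_nonzero[OF w] by blast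
    then have "(S, T) \<in> (\<lambda>p. (\<epsilon> p, \<zeta> p)) ` {p \<in> I. \<delta> p = d}"
      using bij_betw_imp_surj_on[OF bij[OF d]] by auto
    then obtain p where "p \<in> I" "\<delta> p = d" "\<epsilon> p = S" "\<zeta> p = T" by auto
    then show "\<exists>p\<in>I. u p \<noteq> 0" using ST u by (intro bexI[of _ p]) auto
  next
    fix u p assume tot: "\<And>v e. (v, e) \<in> ?B \<Longrightarrow> (\<Sum>q\<in>I. u q * v q) = 0" and p: "p \<in> I"
    let ?d = "\<delta> p"
    have d: "?d \<in> \<delta> ` I" using p by simp
    note AB = A[OF d] B[OF d]
    \<comment> \<open>The inverse of the coordinates on the block of \<open>p\<close>, by which
      \<open>u\<close> becomes a function of two subsets.\<close>
    define pick where "pick = the_inv_into {p \<in> I. \<delta> p = ?d} (\<lambda>p. (\<epsilon> p, \<zeta> p))"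
    have pick: "pick (\<epsilon> q, \<zeta> q) = q" if "q \<in> I" "\<delta> q = ?d" for q
      using the_inv_into_f_f[OF bij_betw_imp_inj_on[OF bij[OF d]], of q] that by (simp add: pick_def)
    have 1: "(\<Sum>S\<in>?S1 ?d. (\<Sum>T\<in>?S2 ?d. u (pick (S, T)) * w T) * v S) = 0" if v: "?J1 ?d l v" and w: "?J2 ?d m w" for l v m w
    proof -
      have "(?t ?d v w, ?ev ?d l m) \<in> ?B"
        by (rule CollectI, intro exI conjI, rule refl, rule d, rule v, rule w)
      from tot[OF this] have "0 = (\<Sum>q\<in>I. u q * ?t ?d v w q)" by simp
      also have "\<dots> = (\<Sum>q\<in>I. if \<delta> q = ?d then u (pick (\<epsilon> q, \<zeta> q)) * (v (\<epsilon> q) * w (\<zeta> q)) else 0)"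
        by (intro sum.cong) (auto simp: pick)
      also have "\<dots> = (\<Sum>S\<in>?S1 ?d. \<Sum>T\<in>?S2 ?d. u (pick (S, T)) * (v S * w T))"
        by (rule sum[OF d])
      also have "\<dots> = (\<Sum>S\<in>?S1 ?d. (\<Sum>T\<in>?S2 ?d. u (pick (S, T)) * w T) * v S)"
        by (simp add: sum_distrib_left sum_distrib_right mult_ac)
      finally show ?thesis by simp
    qed
    \<comment> \<open>Totality is used in one factor at a time: for fixed \<open>w\<close> the sum
      over \<open>T\<close> is a function of \<open>S\<close> orthogonal to all Johnson vectors of
      the first factor, so it vanishes; the second factor is then treated in the same way.\<close>
    have 2: "(\<Sum>T\<in>?S2 ?d. u (pick (S, T)) * w T) = 0" if S: "S \<in> ?S1 ?d" and w: "?J2 ?d m w" for S m w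
    proof (rule johnson_vectors_total[where A = "A ?d" and r = "r1 ?d", OF of_nat_closure_nonzero _ _ _ S])
      show "finite (A ?d)" "card (A ?d) = s1 + r1 ?d" using AB by simp_all
    qed (assumption | rule 1[OF _ w])+
    have "u (pick (\<epsilon> p, \<zeta> p)) = 0"
    proof (rule johnson_vectors_total[where A = "B ?d" and r = "r2 ?d", OF of_nat_closure_nonzero _ _ _ mem(2)[OF p]])
      show "finite (B ?d)" "card (B ?d) = s2 + r2 ?d" using AB by simp_all
    qed (assumption | rule 2[OF mem(1)[OF p]])+
    then show "u p = 0" using pick[OF p] by simp
  qed
  also have "snd ` ?B = emb ` (\<Union>d\<in>\<delta> ` I. products (eigenvalue_list E1 s1 (r1 d)) (eigenvalue_list E2 s2 (r2 d)))"
  proof (intro equalityI subsetI)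
    fix e assume "e \<in> snd ` ?B"
    then obtain x where x: "x \<in> ?B" "e = snd x" by blast
    obtain d v l w m where xd: "x = (?t d v w, ?ev d l m)" and d: "d \<in> \<delta> ` I" and v: "?J1 d l v" and w: "?J2 d m w"
      using x(1) unfolding mem_Collect_eq by (elim exE conjE) (rule that)
    have "e = ?ev d l m" using x(2) xd by (simp only: snd_conv)
    with d v w show "e \<in> emb ` (\<Union>d\<in>\<delta> ` I. products (eigenvalue_list E1 s1 (r1 d)) (eigenvalue_list E2 s2 (r2 d)))"
      using johnson_vector_card[OF v] johnson_vector_card[OF w]
      unfolding products_def eigenvalue_list_def by blast
  next
    fix e assume "e \<in> emb ` (\<Union>d\<in>\<delta> ` I. products (eigenvalue_list E1 s1 (r1 d)) (eigenvalue_list E2 s2 (r2 d)))"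
    then obtain d l m where d: "d \<in> \<delta> ` I" and lm: "l \<le> min s1 (r1 d)" "m \<le> min s2 (r2 d)" and e: "e = ?ev d l m"
      unfolding products_def eigenvalue_list_def by blast
    obtain v w where v: "?J1 d l v" and w: "?J2 d m w"
      using johnson_vector_exists[of "A d" s1 "r1 d" l] johnson_vector_exists[of "B d" s2 "r2 d" m] A[OF d] B[OF d] lm by blast
    have "(?t d v w, ?ev d l m) \<in> ?B"
      by (rule CollectI, intro exI conjI, rule refl, rule d, rule v, rule w)
    then have "(?t d v w, e) \<in> ?B" unfolding e .
    then show "e \<in> snd ` ?B" by force
  qed
  finally show "spectrum (map_mat emb (matrix_of ix M)) =
      emb ` (\<Union>d\<in>\<delta> ` I. products (eigenvalue_list E1 s1 (r1 d)) (eigenvalue_list E2 s2 (r2 d)))"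
    by (simp add: map_mat_matrix_of)
qed

section \<open>Diagrams\<close>

interpretation flip: involution "act True"
  by unfold_locales (simp add: act_def)

text \<open>Invariance of the equivalence relation puts the image of a block inside a block, and
  applying the involution once more gives equality. So the relation is invariant exactly when the
  set of blocks is.\<close>

lemma stable_partition_iff: "stable_partition k d \<longleftrightarrow> d \<in> stable_partitions (act True) (nodes k)"
proof
  assume l: "stable_partition k d"
  then have part: "partition_on (nodes k) d" and st: "\<And>p q. same_block d p q \<Longrightarrow> same_block d (act True p) (act True q)"
    by (auto simp: stable_partition_def)
  have "act True ` C \<in> d" if C: "C \<in> d" for C
  proof -
    have "C \<noteq> {}" using C partition_onD3[OF part] by auto
    then obtain p where p: "p \<in> C" by blast
    have "same_block d (act True p) (act True p)" using st[of p p] p C by (auto simp: same_block_def)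
    then obtain B where B: "B \<in> d" "act True p \<in> B" by (auto simp: same_block_def)
    have "act True ` C = B"
    proof (intro equalityI subsetI)
      fix y assume "y \<in> act True ` C"
      then obtain q where "q \<in> C" "y = act True q" by blast
      then have "same_block d (act True p) y" using st[of p q] p C by (auto simp: same_block_def)
      then obtain B' where "B' \<in> d" "act True p \<in> B'" "y \<in> B'" by (auto simp: same_block_def)
      then show "y \<in> B" using partition_block_eq[OF part B(1), of B' "act True p"] B(2) by blast
    next
      fix y assume y: "y \<in> B"
      then have "same_block d p (act True y)" using st[of "act True p" y] B by (auto simp: same_block_def)
      then obtain B' where "B' \<in> d" "p \<in> B'" "act True y \<in> B'" by (auto simp: same_block_def)
      then have "act True y \<in> C" using partition_block_eq[OF part C, of B' p] p by blast
      then show "y \<in> act True ` C" by (simp add: flip.mem_image_iff)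
    qed
    then show ?thesis using B(1) by simp
  qed
  then show "d \<in> stable_partitions (act True) (nodes k)" using part by (simp add: stable_partitions_def)
next
  assume d: "d \<in> stable_partitions (act True) (nodes k)"
  have "same_block d (act h p) (act h q)" if pq: "same_block d p q" for h p q
  proof (cases h)
    case True
    obtain C where "C \<in> d" "p \<in> C" "q \<in> C" using pq by (auto simp: same_block_def)
    then have "act True ` C \<in> d" "act True p \<in> act True ` C" "act True q \<in> act True ` C"
      using flip.stable_partitionsD(2)[OF d] by simp_all
    then show ?thesis using True unfolding same_block_def by (metis (full_types))
  next
    case False
    then show ?thesis using pq by (simp add: act_def)
  qed
  then show "stable_partition k d" using flip.stable_partitionsD(1)[OF d] by (simp add: stable_partition_def)
qed

lemma e_pairs_eq: "e_pairs B = block_pairs (act True) B"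
  and z_classes_eq: "z_classes B = fix_blocks (act True) B"
  by (simp_all add: e_pairs_def block_pairs_def z_classes_def fix_blocks_def)

lemma finite_nodes: "finite (nodes k)"
  by (simp add: nodes_def)

lemma finite_stable: "stable_partition k d \<Longrightarrow> finite d"
  using flip.finite_block_set[OF finite_nodes] by (simp add: stable_partition_iff)

lemma e_pairs_mono: "P \<subseteq> d \<Longrightarrow> e_pairs P \<subseteq> e_pairs d"
  and z_classes_mono: "P \<subseteq> d \<Longrightarrow> z_classes P \<subseteq> z_classes d"
  by (auto simp: e_pairs_def z_classes_def)

lemma finite_e_pairs: "finite B \<Longrightarrow> finite (e_pairs B)"
  unfolding e_pairs_def Setcompr_eq_image by (auto intro!: finite_image_set)

lemma finite_z_classes: "finite B \<Longrightarrow> finite (z_classes B)"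
  by (simp add: z_classes_def)

text \<open>Since \<open>T\<close> is stable, a pair belongs to \<open>T\<close> as soon as one of
  its members does.\<close>

lemma e_pairs_diff:
  assumes "\<And>C. C \<in> T \<Longrightarrow> act True ` C \<in> T"
  shows "e_pairs S - e_pairs T = e_pairs (S - T)"
proof -
  have "C \<in> T" if C: "{C, act True ` C} \<in> e_pairs T" for C
  proof -
    obtain D where "D \<in> T" "{C, act True ` C} = {D, act True ` D}" using C unfolding e_pairs_def by blast
    then have "C = D \<or> C = act True ` D" by (auto simp: doubleton_eq_iff)
    then show ?thesis using \<open>D \<in> T\<close> assms by blast
  qed
  then have T: "{C, act True ` C} \<in> e_pairs T \<longleftrightarrow> C \<in> T" if "act True ` C \<noteq> C" for C
    using that unfolding e_pairs_def by blast
  show ?thesis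
  proof (intro equalityI subsetI)
    fix Q assume Q: "Q \<in> e_pairs S - e_pairs T"
    then obtain C where "C \<in> S" "act True ` C \<noteq> C" "Q = {C, act True ` C}" unfolding e_pairs_def by blast
    then show "Q \<in> e_pairs (S - T)" using Q T unfolding e_pairs_def[of "S - T"] by blast
  next
    fix Q assume "Q \<in> e_pairs (S - T)"
    then obtain C where "C \<in> S" "C \<notin> T" "act True ` C \<noteq> C" "Q = {C, act True ` C}" unfolding e_pairs_def by blast
    then show "Q \<in> e_pairs S - e_pairs T" using T unfolding e_pairs_def[of S] by blast
  qed
qed

lemma z_classes_diff: "z_classes S - z_classes T = z_classes (S - T)"
  by (auto simp: z_classes_def)

section \<open>Underlying sets\<close>

text \<open>Only two nodes lie over the point \<open>i\<close>, and the action interchanges them; so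
  two blocks over \<open>i\<close> share a node, possibly after a flip.\<close>

lemma underlying_eq:
  assumes "stable_partition k d" "C \<in> d" "C' \<in> d" "i \<in> fst ` C" "i \<in> fst ` C'"
  shows "C' = C \<or> C' = act True ` C"
proof -
  have d: "d \<in> stable_partitions (act True) (nodes k)" using assms(1) by (simp add: stable_partition_iff)
  note D = flip.stable_partitionsD[OF d]
  obtain b b' where b: "(i, b) \<in> C" "(i, b') \<in> C'" using assms(4,5) by force
  show ?thesis
  proof (cases "b = b'")
    case True
    then show ?thesis using partition_block_eq[OF D(1) assms(3,2)] b by blast
  next
    case False
    then have "(i, b') = act True (i, b)" by (auto simp: act_def)
    then have "(i, b') \<in> act True ` C" using b(1) by (metis imageI)
    then show ?thesis using partition_block_eq[OF D(1) assms(3) D(2)[OF assms(2)]] b(2) by blast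
  qed
qed

lemma underlying_flip: "fst ` act True ` C = fst ` C"
  by (auto simp: act_def image_image)

lemma underlying_partition:
  assumes "stable_partition k d"
  shows "partition_on {1..k} ((`) fst ` d)"
proof (rule partition_onI)
  have part: "partition_on (nodes k) d" using assms by (simp add: stable_partition_def)
  have "\<Union>((`) fst ` d) = fst ` \<Union>d" by (rule image_Union[symmetric])
  also have "\<dots> = {1..k}" unfolding partition_onD1[OF part, symmetric] by (simp add: nodes_def)
  finally show "\<Union>((`) fst ` d) = {1..k}" .
  show "{} \<notin> (`) fst ` d" using partition_onD3[OF part] by auto
  show "disjnt U U'" if U: "U \<in> (`) fst ` d" "U' \<in> (`) fst ` d" "U \<noteq> U'" for U U'
  proof (unfold disjnt_iff, intro allI notI)
    fix i assume i: "i \<in> U \<and> i \<in> U'"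
    obtain C C' where C: "C \<in> d" "C' \<in> d" "U = fst ` C" "U' = fst ` C'" using U by auto
    then have "C' = C \<or> C' = act True ` C" using underlying_eq[OF assms C(1,2), of i] i C(3,4) by simp
    then have "fst ` C' = fst ` C" using underlying_flip[of C] by metis
    then show False using U(3) C(3,4) by simp
  qed
qed

lemma e_pair_underlying:
  assumes "Q \<in> e_pairs d" "stable_partition k d"
  obtains C where "C \<in> d" "act True ` C \<noteq> C" "Q = {C, act True ` C}" "fst ` \<Union>Q = fst ` C"
proof -
  obtain C where "C \<in> d" "act True ` C \<noteq> C" "Q = {C, act True ` C}" using assms(1) by (auto simp: e_pairs_def)
  moreover from this have "fst ` \<Union>Q = fst ` C" using underlying_flip[of C] by (simp add: image_Un)
  ultimately show thesis using that by blast
qed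

text \<open>The underlying sets correspond one to one to the classes, a pair of free blocks counting
  as one class.\<close>

lemma underlying_inj:
  assumes "stable_partition k d"
  shows "inj_on (\<lambda>Q. fst ` \<Union>Q) (e_pairs d)" "inj_on ((`) fst) (z_classes d)"
    "(\<lambda>Q. fst ` \<Union>Q) ` e_pairs d \<inter> (`) fst ` z_classes d = {}"
    "(\<lambda>Q. fst ` \<Union>Q) ` e_pairs d \<union> (`) fst ` z_classes d = (`) fst ` d"
proof -
  have ne: "fst ` C \<noteq> {}" if "C \<in> d" for C
    using that assms partition_onD3[of "nodes k" d] by (auto simp: stable_partition_def)
  have eq: "C' = C \<or> C' = act True ` C" if C: "C \<in> d" "C' \<in> d" "fst ` C = fst ` C'" for C C'
  proof -
    obtain i where "i \<in> fst ` C" using ne[OF C(1)] by blast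
    then show ?thesis using underlying_eq[OF assms C(1,2), of i] C(3) by simp
  qed
  have zd: "C \<in> d" "act True ` C = C" if "C \<in> z_classes d" for C using that by (simp_all add: z_classes_def)
  show "inj_on (\<lambda>Q. fst ` \<Union>Q) (e_pairs d)"
  proof (rule inj_onI)
    fix Q R assume QR: "Q \<in> e_pairs d" "R \<in> e_pairs d" "fst ` \<Union>Q = fst ` \<Union>R"
    obtain C where C: "C \<in> d" "Q = {C, act True ` C}" "fst ` \<Union>Q = fst ` C" using e_pair_underlying[OF QR(1) assms] by metis
    obtain D where D: "D \<in> d" "R = {D, act True ` D}" "fst ` \<Union>R = fst ` D" using e_pair_underlying[OF QR(2) assms] by metis
    have "D = C \<or> D = act True ` C" using eq[OF C(1) D(1)] C(3) D(3) QR(3) by simp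
    then show "Q = R" using C(2) D(2) by auto
  qed
  show "inj_on ((`) fst) (z_classes d)"
  proof (rule inj_onI)
    fix C D assume "C \<in> z_classes d" "D \<in> z_classes d" "fst ` C = fst ` D"
    then show "C = D" using eq[of C D] zd by metis
  qed
  show "(\<lambda>Q. fst ` \<Union>Q) ` e_pairs d \<inter> (`) fst ` z_classes d = {}"
  proof (rule equals0I)
    fix U assume "U \<in> (\<lambda>Q. fst ` \<Union>Q) ` e_pairs d \<inter> (`) fst ` z_classes d"
    then obtain Q D where Q: "Q \<in> e_pairs d" and U: "U = fst ` \<Union>Q" "U = fst ` D" and D: "D \<in> z_classes d" by blast
    obtain C where C: "C \<in> d" "act True ` C \<noteq> C" "fst ` \<Union>Q = fst ` C" using e_pair_underlying[OF Q assms] by metis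
    have "C = D \<or> C = act True ` D" using eq[of D C] zd[OF D] C U by metis
    then show False using zd(2)[OF D] C(2) by auto
  qed
  show "(\<lambda>Q. fst ` \<Union>Q) ` e_pairs d \<union> (`) fst ` z_classes d = (`) fst ` d"
  proof (intro equalityI subsetI)
    fix U assume "U \<in> (\<lambda>Q. fst ` \<Union>Q) ` e_pairs d \<union> (`) fst ` z_classes d"
    then consider Q where "Q \<in> e_pairs d" "U = fst ` \<Union>Q" | D where "D \<in> z_classes d" "U = fst ` D" by blast
    then show "U \<in> (`) fst ` d"
    proof cases
      case (1 Q)
      then show ?thesis using e_pair_underlying[OF 1(1) assms] by (metis imageI)
    next
      case (2 D)
      then show ?thesis using zd by blast
    qed
  next
    fix U assume "U \<in> (`) fst ` d"
    then obtain C where C: "C \<in> d" "U = fst ` C" by blast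
    show "U \<in> (\<lambda>Q. fst ` \<Union>Q) ` e_pairs d \<union> (`) fst ` z_classes d"
    proof (cases "act True ` C = C")
      case True
      then show ?thesis using C by (auto simp: z_classes_def)
    next
      case False
      then have "{C, act True ` C} \<in> e_pairs d" using C by (auto simp: e_pairs_def)
      moreover have "fst ` \<Union>{C, act True ` C} = U" using C underlying_flip[of C] by (simp add: image_Un)
      ultimately show ?thesis by (metis UnI1 imageI)
    qed
  qed
qed

lemma card_underlying:
  assumes "stable_partition k d"
  shows "card ((`) fst ` d) = card (e_pairs d) + card (z_classes d)"
proof -
  note u = underlying_inj[OF assms]
  have fin: "finite (e_pairs d)" "finite (z_classes d)"
    using finite_stable[OF assms] finite_e_pairs finite_z_classes by auto
  show ?thesis
    unfolding u(4)[symmetric] using u(3) fin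
    by (simp add: card_Un_disjoint card_image[OF u(1)] card_image[OF u(2)])
qed

text \<open>The underlying sets partition \<open>k\<close> points; each has at least one point, and
  those counted by \<open>H_e\<close> have at least two. This bound makes the extra condition on
  signed diagrams automatic in \<open>signed_diagrams_eq\<close>.\<close>

lemma card_classes_le:
  assumes "stable_partition k d" "P \<subseteq> d"
  shows "card (e_pairs d) + card (z_classes d) + H_e (d, P) \<le> k"
proof -
  let ?u = "(`) fst ` d"
  let ?E = "{Q \<in> e_pairs (d - P). card (fst ` \<Union>Q) \<ge> 2}"
  let ?T = "(\<lambda>Q. fst ` \<Union>Q) ` ?E"
  note part = underlying_partition[OF assms(1)] and u = underlying_inj[OF assms(1)]
  have sub: "?E \<subseteq> e_pairs d" using e_pairs_mono[of "d - P" d] by blast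
  then have Tu: "?T \<subseteq> ?u" using u(4) by blast
  have cT: "card ?T = H_e (d, P)"
    using card_image[OF inj_on_subset[OF u(1) sub]] by (simp add: H_e_def)
  have finu: "finite ?u" using finite_stable[OF assms(1)] by simp
  have fU: "finite U" if "U \<in> ?u" for U using that partition_onD1[OF part] finite_subset[of U "{1..k}"] by blast
  have "card ?u + card ?T = (\<Sum>U\<in>?u. 1 + (if U \<in> ?T then 1 else 0))"
    unfolding sum.distrib sum.inter_restrict[OF finu, symmetric] Int_absorb1[OF Tu] by simp
  also have "\<dots> \<le> (\<Sum>U\<in>?u. card U)"
  proof (rule sum_mono)
    fix U assume U: "U \<in> ?u"
    then have "U \<noteq> {}" using partition_onD3[OF part] by blast
    then have "card U \<noteq> 0" using fU[OF U] by simp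
    moreover have "card U \<ge> 2" if "U \<in> ?T" using that by auto
    ultimately show "1 + (if U \<in> ?T then 1 else 0) \<le> card U" by auto
  qed
  also have "\<dots> = card (\<Union>?u)"
    using partition_onD2[OF part] fU by (intro card_Union_disjoint[symmetric]) (auto simp: disjoint_def pairwise_def disjnt_def)
  also have "\<dots> = k" unfolding partition_onD1[OF part, symmetric] by simp
  finally show ?thesis using card_underlying[OF assms(1)] cT by simp
qed

text \<open>Coarser stable partitions have coarser underlying partitions, and these have one member
  per class. Hence the diagrams with fewer than k classes are closed upwards.\<close>

lemma card_underlying_mono:
  assumes "stable_partition k d" "stable_partition k d'" "refined_by d' d"
  shows "card (e_pairs d') + card (z_classes d') \<le> card (e_pairs d) + card (z_classes d)"
proof -
  have r: "refined_by ((`) fst ` d') ((`) fst ` d)"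
    unfolding refined_by_def
  proof
    fix U assume "U \<in> (`) fst ` d"
    then obtain C where "C \<in> d" "U = fst ` C" by blast
    moreover obtain B where "B \<in> d'" "C \<subseteq> B" using calculation(1) assms(3) by (auto simp: refined_by_def)
    ultimately show "\<exists>B\<in>(`) fst ` d'. U \<subseteq> B" by (intro bexI[of _ "fst ` B"]) auto
  qed
  note parts = underlying_partition[OF assms(2)] underlying_partition[OF assms(1)]
  have "lift ((`) fst ` d') ((`) fst ` d) = (`) fst ` d'"
    by (rule lift_refined[OF parts r])
  then show ?thesis
    using card_lift_eq_iff(1)[OF _ parts r subset_refl] card_underlying[OF assms(1)] card_underlying[OF assms(2)] by simp
qed

section \<open>The order on diagrams\<close>

lemma mem_diagrams_iff:
  "(d, P) \<in> diagrams k s1 s2 r1 r2 \<longleftrightarrow> stable_partition k d \<and>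
     card (e_pairs d) = s1 + r1 \<and> card (z_classes d) = s2 + r2 \<and>
     P \<subseteq> d \<and> (\<forall>C\<in>P. act True ` C \<in> P) \<and> card (e_pairs P) = s1 \<and> card (z_classes P) = s2"
  by (simp add: diagrams_def)

lemma class_counts:
  assumes "stable_partition k d" "P \<subseteq> d" "card (e_pairs P) = s1" "card (z_classes P) = s2"
  shows "s1 \<le> card (e_pairs d)" "s2 \<le> card (z_classes d)" "card (e_pairs d) + card (z_classes d) \<le> k"
  using card_mono[OF finite_e_pairs[OF finite_stable[OF assms(1)]] e_pairs_mono[OF assms(2)]]
    card_mono[OF finite_z_classes[OF finite_stable[OF assms(1)]] z_classes_mono[OF assms(2)]]
    card_classes_le[OF assms(1,2)] assms(3,4) by simp_all

text \<open>The bounds on r1 and r2 are automatic, because there are at most \<open>k\<close>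
  classes.\<close>

lemma mem_all_diagrams_iff:
  "(d, P) \<in> all_diagrams k s1 s2 \<longleftrightarrow> stable_partition k d \<and>
     P \<subseteq> d \<and> (\<forall>C\<in>P. act True ` C \<in> P) \<and> card (e_pairs P) = s1 \<and> card (z_classes P) = s2"
proof
  assume "(d, P) \<in> all_diagrams k s1 s2"
  then show "stable_partition k d \<and>
     P \<subseteq> d \<and> (\<forall>C\<in>P. act True ` C \<in> P) \<and> card (e_pairs P) = s1 \<and> card (z_classes P) = s2"
    by (auto simp: all_diagrams_def mem_diagrams_iff)
next
  assume r: "stable_partition k d \<and>
     P \<subseteq> d \<and> (\<forall>C\<in>P. act True ` C \<in> P) \<and> card (e_pairs P) = s1 \<and> card (z_classes P) = s2"
  then have c: "s1 \<le> card (e_pairs d)" "s2 \<le> card (z_classes d)" "card (e_pairs d) + card (z_classes d) \<le> k"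
    using class_counts[of k d P s1 s2] by simp_all
  have "(d, P) \<in> diagrams k s1 s2 (card (e_pairs d) - s1) (card (z_classes d) - s2)"
    using r c by (simp add: mem_diagrams_iff)
  moreover have "card (e_pairs d) - s1 \<le> k - s1 - s2" "card (z_classes d) - s2 \<le> k - s1 - s2"
    using c by linarith+
  ultimately show "(d, P) \<in> all_diagrams k s1 s2" unfolding all_diagrams_def by blast
qed

lemma finite_all_diagrams: "finite (all_diagrams k s1 s2)"
proof (rule finite_subset)
  show "all_diagrams k s1 s2 \<subseteq> Pow (Pow (nodes k)) \<times> Pow (Pow (nodes k))"
  proof
    fix p assume p: "p \<in> all_diagrams k s1 s2"
    obtain d P where dP: "p = (d, P)" by (cases p)
    have "stable_partition k d" "P \<subseteq> d" using p by (simp_all add: dP mem_all_diagrams_iff)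
    then have "d \<subseteq> Pow (nodes k)" using partition_onD1[of "nodes k" d] by (auto simp: stable_partition_def)
    then show "p \<in> Pow (Pow (nodes k)) \<times> Pow (Pow (nodes k))" using \<open>P \<subseteq> d\<close> by (auto simp: dP)
  qed
qed (simp add: finite_nodes)

definition below :: "diagram \<Rightarrow> diagram \<Rightarrow> bool" where
  "below p q \<longleftrightarrow> refined_by (fst q) (fst p) \<and> unmerged (fst q) (snd p) \<and> snd q = lift (fst q) (snd p)"

lemma self_block:
  assumes "partition_on V d" "B \<in> d" "C \<in> d" "C \<subseteq> B"
  shows "C = B"
proof -
  have "C \<noteq> {}" using assms(3) partition_onD3[OF assms(1)] by auto
  then show ?thesis using partition_block_eq[OF assms(1,3,2)] assms(4) by blast
qed

lemma lift_self: "partition_on V d \<Longrightarrow> P \<subseteq> d \<Longrightarrow> lift d P = P"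
  unfolding lift_def using self_block by blast

lemma unmerged_self: "partition_on V d \<Longrightarrow> P \<subseteq> d \<Longrightarrow> unmerged d P"
  unfolding unmerged_def using self_block by (metis subsetD)

text \<open>Sending a block of \<open>d\<close> to the block of \<open>D\<close> around it is
  surjective; with the bound on the cardinalities it is injective, so every block of
  \<open>D\<close> consists of a single block of \<open>d\<close>. This makes the number of blocks a
  strict rank for \<open>below\<close>.\<close>

lemma refined_antisym:
  assumes "finite V" "partition_on V D" "partition_on V d" "refined_by D d" "card d \<le> card D"
  shows "D = d"
proof -
  have l: "lift D d = D" by (rule lift_refined[OF assms(2-4)])
  have u: "unmerged D d" using card_lift_eq_iff[OF assms(1-4) subset_refl] assms(5) l by simp
  have sub: "B \<in> d" if B: "B \<in> D" for B
  proof -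
    obtain C where C: "C \<in> d" "C \<subseteq> B" using B l unfolding lift_def by blast
    have "B \<subseteq> C"
    proof
      fix x assume x: "x \<in> B"
      then have "x \<in> \<Union>d" using B partition_onD1[OF assms(2)] partition_onD1[OF assms(3)] by blast
      then obtain C' where C': "C' \<in> d" "x \<in> C'" by (rule UnionE)
      then have "C' \<subseteq> B" using refined_block[OF assms(2-4) C'(1) B C'(2) x] by simp
      then have "C' = C" using u B C C'(1) unfolding unmerged_def by blast
      then show "x \<in> C" using C'(2) by simp
    qed
    then show ?thesis using C by simp
  qed
  have "C \<in> D" if C: "C \<in> d" for C
  proof -
    obtain B where B: "B \<in> D" "C \<subseteq> B" using C assms(4) by (auto simp: refined_by_def)
    have "C = B" by (rule self_block[OF assms(3) sub[OF B(1)] C B(2)])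
    then show ?thesis using B(1) by simp
  qed
  then show ?thesis using sub by blast
qed

lemma below_refl: "p \<in> all_diagrams k s1 s2 \<Longrightarrow> below p p"
  using lift_self unmerged_self refined_by_refl
  by (cases p) (auto simp: below_def mem_all_diagrams_iff stable_partition_def)

lemma below_rank:
  assumes p: "p \<in> all_diagrams k s1 s2" and q: "q \<in> all_diagrams k s1 s2" and b: "below p q"
  shows "p = q \<or> card (fst q) < card (fst p)"
proof (cases "card (fst q) < card (fst p)")
  case False
  obtain d P d' Q where dP: "p = (d, P)" "q = (d', Q)" by (cases p, cases q)
  have parts: "partition_on (nodes k) d" "partition_on (nodes k) d'" and P: "P \<subseteq> d"
    using p q by (auto simp: dP mem_all_diagrams_iff stable_partition_def)
  have "d' = d"
    using refined_antisym[OF finite_nodes parts(2,1)] b False by (simp add: dP below_def)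
  then show ?thesis using b lift_self[OF parts(1) P] by (simp add: dP below_def)
qed simp

lemma lift_stable:
  assumes "D \<in> stable_partitions (act True) V" "\<And>C. C \<in> P \<Longrightarrow> act True ` C \<in> P" "B \<in> lift D P"
  shows "act True ` B \<in> lift D P"
proof -
  obtain C where C: "B \<in> D" "C \<in> P" "C \<subseteq> B" using assms(3) by (auto simp: lift_def)
  then have "act True ` C \<subseteq> act True ` B" "act True ` C \<in> P" "act True ` B \<in> D"
    using assms(2) flip.stable_partitionsD(2)[OF assms(1)] by (auto intro: image_mono)
  then show ?thesis by (auto simp: lift_def)
qed

lemma card_e_pairs:
  assumes "finite B" "\<And>C. C \<in> B \<Longrightarrow> act True ` C \<in> B"
  shows "card (free_blocks (act True) B) = 2 * card (e_pairs B)"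
  using flip.card_free_blocks[OF assms] by (simp add: e_pairs_eq)

lemma lift_counts:
  assumes "stable_partition k d" "P \<subseteq> d" "\<And>C. C \<in> P \<Longrightarrow> act True ` C \<in> P"
    and "stable_partition k D" "refined_by D d" "unmerged D P"
  shows "card (e_pairs (lift D P)) = card (e_pairs P)" "card (z_classes (lift D P)) = card (z_classes P)"
proof -
  have st: "d \<in> stable_partitions (act True) (nodes k)" "D \<in> stable_partitions (act True) (nodes k)"
    using assms(1,4) by (simp_all add: stable_partition_iff)
  note c = flip.card_lift[OF st(1) finite_nodes assms(2,3) st(2) assms(5,6)]
  show "card (z_classes (lift D P)) = card (z_classes P)" using c(1) by (simp add: z_classes_eq)
  have fin: "finite P" "finite (lift D P)"
    using finite_stable[OF assms(1)] finite_stable[OF assms(4)] assms(2) finite_subset by (auto simp: lift_def)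
  show "card (e_pairs (lift D P)) = card (e_pairs P)"
    using c(2) card_e_pairs[OF fin(1) assms(3)] card_e_pairs[OF fin(2) lift_stable[OF st(2) assms(3)]] by simp
qed

text \<open>An element above is determined by its partition, so the upper set is parametrised by
  coarsenings; \<open>lift_counts\<close> ensures that each admissible coarsening does give a
  diagram.\<close>

lemma above_eq:
  assumes "(d, P) \<in> all_diagrams k s1 s2"
  shows "{p'. p' \<in> all_diagrams k s1 s2 \<and> below (d, P) p'} =
    (\<lambda>D. (D, lift D P)) ` {D. stable_partition k D \<and> refined_by D d \<and> unmerged D P}" (is "?L = ?R")
proof (intro equalityI subsetI)
  fix p' assume p': "p' \<in> ?L"
  obtain D P' where "p' = (D, P')" by (cases p')
  then show "p' \<in> ?R" using p' by (auto simp: below_def mem_all_diagrams_iff)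
next
  fix p' assume "p' \<in> ?R"
  then obtain D where D: "p' = (D, lift D P)" "stable_partition k D" "refined_by D d" "unmerged D P" by auto
  have a: "stable_partition k d" "P \<subseteq> d" "\<And>C. C \<in> P \<Longrightarrow> act True ` C \<in> P"
    "card (e_pairs P) = s1" "card (z_classes P) = s2"
    using assms by (auto simp: mem_all_diagrams_iff)
  have "D \<in> stable_partitions (act True) (nodes k)" using D(2) by (simp add: stable_partition_iff)
  then have "\<forall>C\<in>lift D P. act True ` C \<in> lift D P" using lift_stable a(3) by blast
  moreover have "lift D P \<subseteq> D" by (auto simp: lift_def)
  ultimately have "p' \<in> all_diagrams k s1 s2"
    using D lift_counts[OF a(1-3) D(2-4)] a(4,5) by (simp add: mem_all_diagrams_iff)
  then show "p' \<in> ?L" using D by (simp add: below_def)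
qed

lemma factor_entry_weight:
  assumes "finite A" "card A = s + r" "S \<in> subsets_of_card s A" "T \<in> subsets_of_card s A"
  shows "factor_entry X_e s r S T = weight_e s r (card (S - T))"
    "factor_entry X_z s r S T = weight_z s r (card (S - T))"
proof -
  have "min s r - (min s r - card (S - T)) = card (S - T)"
    using card_Diff_le_min[OF assms] by simp
  then show "factor_entry X_e s r S T = weight_e s r (card (S - T))"
    "factor_entry X_z s r S T = weight_z s r (card (S - T))"
    by (simp_all add: factor_entry_def X_e_def X_z_def weight_gen_def Let_def)
qed

text \<open>Identifies the summands of \<open>Z\<^sup>T R Z\<close> with the weights: the exchanged
  classes are those in \<open>lift D P\<close> but not in \<open>lift D Q\<close>.\<close>

lemma reduced_entry_lift:
  assumes p: "(d, P) \<in> all_diagrams k s1 s2" and q: "(d', Q) \<in> all_diagrams k s1 s2"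
    and D: "stable_partition k D" "refined_by D d" "refined_by D d'" "unmerged D P" "unmerged D Q"
  shows "reduced_entry s1 s2 (D, lift D P) (D, lift D Q) = flip.coarse_weight s1 s2 P Q D"
proof -
  have a: "stable_partition k d" "P \<subseteq> d" "\<And>C. C \<in> P \<Longrightarrow> act True ` C \<in> P" "card (e_pairs P) = s1" "card (z_classes P) = s2"
    using p by (auto simp: mem_all_diagrams_iff)
  have b: "stable_partition k d'" "Q \<subseteq> d'" "\<And>C. C \<in> Q \<Longrightarrow> act True ` C \<in> Q" "card (e_pairs Q) = s1" "card (z_classes Q) = s2"
    using q by (auto simp: mem_all_diagrams_iff)
  have st: "D \<in> stable_partitions (act True) (nodes k)" using D(1) by (simp add: stable_partition_iff)
  have fin: "finite D" using finite_stable[OF D(1)] .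
  have sub: "lift D P \<subseteq> D" "lift D Q \<subseteq> D" by (auto simp: lift_def)
  note cP = lift_counts[OF a(1-3) D(1,2,4)] and cQ = lift_counts[OF b(1-3) D(1,3,5)]
  note stP = lift_stable[OF st a(3)] and stQ = lift_stable[OF st b(3)]
  have le: "s1 \<le> card (e_pairs D)" "s2 \<le> card (z_classes D)"
    using class_counts[OF D(1) sub(1) cP] a(4,5) by simp_all
  have e: "e_pairs (lift D P) \<in> subsets_of_card s1 (e_pairs D)" "e_pairs (lift D Q) \<in> subsets_of_card s1 (e_pairs D)"
    using cP cQ a b e_pairs_mono[OF sub(1)] e_pairs_mono[OF sub(2)] by (auto simp: subsets_of_card_def)
  have z: "z_classes (lift D P) \<in> subsets_of_card s2 (z_classes D)" "z_classes (lift D Q) \<in> subsets_of_card s2 (z_classes D)"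
    using cP cQ a b z_classes_mono[OF sub(1)] z_classes_mono[OF sub(2)] by (auto simp: subsets_of_card_def)
  have nD: "card (free_blocks (act True) D) div 2 = card (e_pairs D)"
    using card_e_pairs[OF fin flip.stable_partitionsD(2)[OF st]] by simp
  have stPQ: "act True ` C \<in> lift D P - lift D Q" if C: "C \<in> lift D P - lift D Q" for C
  proof -
    have "act True ` C \<notin> lift D Q" using stQ[of "act True ` C"] C by auto
    then show ?thesis using stP C by auto
  qed
  have nPQ: "card (free_blocks (act True) (lift D P - lift D Q)) div 2 = card (e_pairs (lift D P) - e_pairs (lift D Q))"
  proof -
    have "finite (lift D P - lift D Q)" using fin by (simp add: lift_def)
    from card_e_pairs[OF this stPQ]
    show ?thesis using e_pairs_diff[of "lift D Q" "lift D P", OF stQ] by simp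
  qed
  show ?thesis
    unfolding reduced_entry_def fst_conv snd_conv flip.coarse_weight_def nD nPQ
    using factor_entry_weight(1)[OF finite_e_pairs[OF fin] _ e, of "card (e_pairs D) - s1"]
      factor_entry_weight(2)[OF finite_z_classes[OF fin] _ z, of "card (z_classes D) - s2"] le
    by (simp add: z_classes_diff z_classes_eq[symmetric])
qed

lemma card_blocks:
  assumes "finite R" "\<And>C. C \<in> R \<Longrightarrow> act True ` C \<in> R" "card (e_pairs R) = s1" "card (z_classes R) = s2"
  shows "card R = 2 * s1 + s2"
proof -
  have "R = free_blocks (act True) R \<union> z_classes R" "free_blocks (act True) R \<inter> z_classes R = {}"
    by (auto simp: free_blocks_def z_classes_def)
  then have "card R = card (free_blocks (act True) R) + card (z_classes R)"
    using assms(1) card_Un_disjoint[of "free_blocks (act True) R" "z_classes R"] by (metis finite_Un)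
  then show ?thesis using card_e_pairs[OF assms(1,2)] assms(3,4) by simp
qed

text \<open>The identity \<open>G = Z\<^sup>T R Z\<close> entry by entry. As the reduced matrix
  vanishes between different partitions, the double sum collapses to the common coarsenings of
  \<open>d1\<close> and \<open>d2\<close>, that is, to the coarsenings of their join, where
  \<open>sum_coarse_weight\<close> evaluates it.\<close>

lemma gram_entry_expand:
  assumes p: "p \<in> all_diagrams k s1 s2" and q: "q \<in> all_diagrams k s1 s2"
  shows "gram_entry s1 s2 p q =
    (\<Sum>p' | p' \<in> all_diagrams k s1 s2 \<and> below p p'. \<Sum>q' | q' \<in> all_diagrams k s1 s2 \<and> below q q'. reduced_entry s1 s2 p' q')"
proof -
  let ?V = "nodes k"
  obtain d1 P d2 Q where dP: "p = (d1, P)" "q = (d2, Q)" by (cases p, cases q)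
  note p' = p[unfolded dP(1)] and q' = q[unfolded dP(2)]
  have a: "stable_partition k d1" "P \<subseteq> d1" "\<And>C. C \<in> P \<Longrightarrow> act True ` C \<in> P" "card (e_pairs P) = s1" "card (z_classes P) = s2"
    using p' by (auto simp: mem_all_diagrams_iff)
  have b: "stable_partition k d2" "Q \<subseteq> d2" "\<And>C. C \<in> Q \<Longrightarrow> act True ` C \<in> Q" "card (e_pairs Q) = s1" "card (z_classes Q) = s2"
    using q' by (auto simp: mem_all_diagrams_iff)
  have st1: "d1 \<in> stable_partitions (act True) ?V" and st2: "d2 \<in> stable_partitions (act True) ?V"
    using a(1) b(1) by (simp_all add: stable_partition_iff)
  have parts: "partition_on ?V d1" "partition_on ?V d2" using a(1) b(1) by (simp_all add: stable_partition_def)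
  have finP: "finite P" "finite Q"
    using finite_subset[OF a(2) finite_stable[OF a(1)]] finite_subset[OF b(2) finite_stable[OF b(1)]] by auto
  define J where "J = components (d1 \<union> d2)"
  note jp = join_partition[OF parts a(2) b(2), folded J_def]
  note jr = join_refined[OF parts a(2) b(2), folded J_def]
  have stJ: "J \<in> stable_partitions (act True) ?V"
  proof -
    have "\<And>C. C \<in> d1 \<union> d2 \<Longrightarrow> act True ` C \<in> d1 \<union> d2"
      using flip.stable_partitionsD(2)[OF st1] flip.stable_partitionsD(2)[OF st2] by blast
    from flip.components_stable[OF this] show ?thesis
      unfolding J_def using join_union[OF parts a(2) b(2)] by simp
  qed
  have sJ: "stable_partition k J" using stJ by (simp add: stable_partition_iff)
  let ?A1 = "{D. stable_partition k D \<and> refined_by D d1 \<and> unmerged D P}"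
  let ?A2 = "{D. stable_partition k D \<and> refined_by D d2 \<and> unmerged D Q}"
  let ?A = "{D. D \<in> stable_partitions (act True) ?V \<and> refined_by D J \<and> unmerged D P \<and> unmerged D Q}"
  have finA: "finite ?A1" "finite ?A2"
    using flip.finite_stable_partitions[OF finite_nodes, of k] by (simp_all add: stable_partition_iff)
  have inj: "inj_on (\<lambda>D. (D, lift D P)) A" for A P by (rule inj_onI) simp
  have join: "refined_by D J \<longleftrightarrow> refined_by D d1 \<and> refined_by D d2" if "stable_partition k D" for D
  proof
    assume "refined_by D J"
    then show "refined_by D d1 \<and> refined_by D d2" using refined_by_trans jr by blast
  next
    assume "refined_by D d1 \<and> refined_by D d2"
    then show "refined_by D J"
      using join_least[OF parts a(2) b(2), of D, folded J_def] that by (simp add: stable_partition_def)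
  qed
  have A: "?A1 \<inter> ?A2 = ?A"
    using join by (auto simp: stable_partition_iff)
  have "(\<Sum>p' | p' \<in> all_diagrams k s1 s2 \<and> below p p'. \<Sum>q' | q' \<in> all_diagrams k s1 s2 \<and> below q q'. reduced_entry s1 s2 p' q') =
      (\<Sum>D\<in>?A1. \<Sum>D'\<in>?A2. reduced_entry s1 s2 (D, lift D P) (D', lift D' Q))"
    unfolding dP above_eq[OF p'] above_eq[OF q'] sum.reindex[OF inj] by (simp add: o_def)
  also have "\<dots> = (\<Sum>D\<in>?A1. \<Sum>D'\<in>?A2. if D' = D then reduced_entry s1 s2 (D, lift D P) (D, lift D Q) else 0)"
    by (intro sum.cong refl) (simp add: reduced_entry_def)
  also have "\<dots> = (\<Sum>D\<in>?A1. if D \<in> ?A2 then reduced_entry s1 s2 (D, lift D P) (D, lift D Q) else 0)"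
    by (simp only: sum.delta[OF finA(2)])
  also have "\<dots> = (\<Sum>D\<in>?A. reduced_entry s1 s2 (D, lift D P) (D, lift D Q))"
    unfolding A[symmetric] by (rule sum.inter_restrict[OF finA(1), symmetric])
  also have "\<dots> = (\<Sum>D\<in>?A. flip.coarse_weight s1 s2 P Q D)"
    by (intro sum.cong refl reduced_entry_lift[OF p' q']) (use join in \<open>auto simp: stable_partition_iff\<close>)
  also have "\<dots> = gram_entry s1 s2 p q"
  proof (cases "unmerged J P \<and> unmerged J Q")
    case False
    \<comment> \<open>A merge in the join persists in all its coarsenings, so nothing is left to
      sum; the Gram entry vanishes for the same merge.\<close>
    then have "?A = {}" using unmerged_mono by blast
    then have "(\<Sum>D\<in>?A. flip.coarse_weight s1 s2 P Q D) = 0" by (simp only: sum.empty)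
    moreover have "gram_entry s1 s2 p q = 0"
    proof -
      show ?thesis
        using gram_entry_eq[OF parts a(2) b(2) finite_nodes card_blocks[OF finP(1) a(3-5)] card_blocks[OF finP(2) b(3-5)], folded J_def] False
        by (auto simp: dP)
    qed
    ultimately show ?thesis by simp
  next
    case True
    \<comment> \<open>\<open>sum_coarse_weight\<close> expects through sets made of blocks of
      \<open>J\<close>; \<open>P\<close> and \<open>Q\<close> are replaced by their lifts, which
      changes neither the conditions nor the weights.\<close>
    have lc: "lift D (lift J P) = lift D P" "unmerged D (lift J P) \<longleftrightarrow> unmerged D P"
      "lift D (lift J Q) = lift D Q" "unmerged D (lift J Q) \<longleftrightarrow> unmerged D Q"
      if "D \<in> stable_partitions (act True) ?V" "refined_by D J" for D
      using lift_lift[OF flip.stable_partitionsD(1)[OF that(1)] jp parts(1) that(2) jr(1) a(2)]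
        lift_lift[OF flip.stable_partitionsD(1)[OF that(1)] jp parts(2) that(2) jr(2) b(2)]
        unmerged_lift[OF flip.stable_partitionsD(1)[OF that(1)] jp parts(1) that(2) jr(1) a(2)]
        unmerged_lift[OF flip.stable_partitionsD(1)[OF that(1)] jp parts(2) that(2) jr(2) b(2)] True by auto
    have stL: "\<And>C. C \<in> lift J P \<Longrightarrow> act True ` C \<in> lift J P" "\<And>C. C \<in> lift J Q \<Longrightarrow> act True ` C \<in> lift J Q"
      using lift_stable[OF stJ a(3)] lift_stable[OF stJ b(3)] by blast+
    have finL: "finite (lift J P)" "finite (lift J Q)" using finite_stable[OF sJ] by (simp_all add: lift_def)
    have cL: "card (e_pairs (lift J P)) = s1" "card (z_classes (lift J P)) = s2"
        "card (e_pairs (lift J Q)) = s1" "card (z_classes (lift J Q)) = s2"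
      using lift_counts[OF a(1-3) sJ jr(1)] lift_counts[OF b(1-3) sJ jr(2)] True a b by simp_all
    have "(\<Sum>D\<in>?A. flip.coarse_weight s1 s2 P Q D) =
      (\<Sum>D | D \<in> stable_partitions (act True) ?V \<and> refined_by D J \<and> unmerged D (lift J P) \<and> unmerged D (lift J Q).
        flip.coarse_weight s1 s2 (lift J P) (lift J Q) D)"
      by (rule sum.cong) (auto simp: lc flip.coarse_weight_def)
    also have "\<dots> = (if lift J P = lift J Q then var_x ^ card (J - lift J P) else 0)"
    proof (rule flip.sum_coarse_weight[OF stJ finite_nodes _ _ stL])
      show "lift J P \<subseteq> J" "lift J Q \<subseteq> J" by (auto simp: lift_def)
      show "card (fix_blocks (act True) (lift J P)) = s2" "card (fix_blocks (act True) (lift J Q)) = s2"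
        using cL by (simp_all add: z_classes_eq)
      show "card (free_blocks (act True) (lift J P)) = 2 * s1" "card (free_blocks (act True) (lift J Q)) = 2 * s1"
        using card_e_pairs[OF finL(1) stL(1)] card_e_pairs[OF finL(2) stL(2)] cL by simp_all
    qed
    also have "\<dots> = gram_entry s1 s2 p q"
      using gram_entry_eq[OF parts a(2) b(2) finite_nodes card_blocks[OF finP(1) a(3-5)] card_blocks[OF finP(2) b(3-5)], folded J_def] True
      by (simp add: dP)
    finally show ?thesis .
  qed
  finally show ?thesis by simp
qed

section \<open>Eigenvalues of the reduced matrices\<close>

lemma blocks_decompose:
  assumes "\<And>C. C \<in> P \<Longrightarrow> act True ` C \<in> P"
  shows "\<Union>(e_pairs P) \<union> z_classes P = P"
proof (intro equalityI subsetI)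
  fix C assume "C \<in> \<Union>(e_pairs P) \<union> z_classes P"
  then consider D where "D \<in> P" "C \<in> {D, act True ` D}" | "C \<in> P"
    unfolding e_pairs_def z_classes_def by blast
  then show "C \<in> P" using assms by cases auto
next
  fix C assume C: "C \<in> P"
  show "C \<in> \<Union>(e_pairs P) \<union> z_classes P"
  proof (cases "act True ` C = C")
    case True
    then show ?thesis using C by (simp add: z_classes_def)
  next
    case False
    then have "{C, act True ` C} \<in> e_pairs P" using C unfolding e_pairs_def by blast
    then show ?thesis by blast
  qed
qed

text \<open>Together with \<open>blocks_decompose\<close> this shows that a through set amounts to
  independent choices of pairs and of invariant blocks, which is the source of the tensor
  structure.\<close>

lemma compose_blocks:
  assumes "stable_partition k d" "S \<subseteq> e_pairs d" "T \<subseteq> z_classes d"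
  shows "\<Union>S \<union> T \<subseteq> d" "\<And>C. C \<in> \<Union>S \<union> T \<Longrightarrow> act True ` C \<in> \<Union>S \<union> T"
    "e_pairs (\<Union>S \<union> T) = S" "z_classes (\<Union>S \<union> T) = T"
proof -
  have d: "d \<in> stable_partitions (act True) (nodes k)" using assms(1) by (simp add: stable_partition_iff)
  have S: "act True ` C \<noteq> C" "Q = {C, act True ` C}" "C \<in> d" if Q: "Q \<in> S" "C \<in> Q" for Q C
  proof -
    obtain D where D: "D \<in> d" "act True ` D \<noteq> D" "Q = {D, act True ` D}"
      using subsetD[OF assms(2) Q(1)] unfolding e_pairs_def by blast
    then consider "C = D" | "C = act True ` D" using Q(2) by blast
    then show "act True ` C \<noteq> C" "Q = {C, act True ` C}" "C \<in> d"
      using D flip.stable_partitionsD(2)[OF d D(1)] by (cases; simp add: insert_commute)+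
  qed
  have T: "act True ` C = C" "C \<in> d" if "C \<in> T" for C using that assms(3) by (auto simp: z_classes_def)
  show "\<Union>S \<union> T \<subseteq> d" using S(3) T(2) by blast
  show "act True ` C \<in> \<Union>S \<union> T" if C: "C \<in> \<Union>S \<union> T" for C
  proof (cases "C \<in> T")
    case True
    then show ?thesis using T by simp
  next
    case False
    then obtain Q where Q: "Q \<in> S" "C \<in> Q" using C by blast
    then have "act True ` C \<in> Q" using S(2) by blast
    then show ?thesis using Q(1) by blast
  qed
  show "e_pairs (\<Union>S \<union> T) = S"
  proof (intro equalityI subsetI)
    fix Q assume "Q \<in> e_pairs (\<Union>S \<union> T)"
    then obtain C where C: "C \<in> \<Union>S \<union> T" "act True ` C \<noteq> C" "Q = {C, act True ` C}" unfolding e_pairs_def by blast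
    then have "C \<notin> T" using T(1) by blast
    then obtain R where R: "R \<in> S" "C \<in> R" using C(1) by blast
    then show "Q \<in> S" using S(2)[OF R] C(3) by simp
  next
    fix Q assume Q: "Q \<in> S"
    then have "Q \<in> e_pairs d" using assms(2) by blast
    then obtain C where C: "C \<in> Q" unfolding e_pairs_def by blast
    then show "Q \<in> e_pairs (\<Union>S \<union> T)" using S(1,2)[OF Q C] Q unfolding e_pairs_def by blast
  qed
  show "z_classes (\<Union>S \<union> T) = T"
  proof (intro equalityI subsetI)
    fix C assume C: "C \<in> z_classes (\<Union>S \<union> T)"
    then have "C \<in> \<Union>S \<union> T" "act True ` C = C" by (simp_all add: z_classes_def)
    then show "C \<in> T" using S(1) by blast
  next
    fix C assume "C \<in> T"
    then show "C \<in> z_classes (\<Union>S \<union> T)" using T(1) by (simp add: z_classes_def)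
  qed
qed

text \<open>By \<open>sat\<close> the index set contains all admissible through sets on each of its
  partitions, so it is a union of complete tensor blocks.\<close>

lemma reduced_has_eigenvalue_set:
  assumes sub: "I \<subseteq> all_diagrams k s1 s2"
    and sat: "\<And>d P P'. (d, P) \<in> I \<Longrightarrow> (d, P') \<in> all_diagrams k s1 s2 \<Longrightarrow> (d, P') \<in> I"
  shows "has_eigenvalue_set I (reduced_entry s1 s2)
    (\<Union>d\<in>fst ` I. products (eigenvalue_list X_e s1 (card (e_pairs d) - s1)) (eigenvalue_list X_z s2 (card (z_classes d) - s2)))"
proof (rule tensor_has_eigenvalue_set[where \<epsilon> = "\<lambda>p. e_pairs (snd p)" and \<zeta> = "\<lambda>p. z_classes (snd p)" and A = e_pairs and B = z_classes])
  show "finite I" using sub finite_all_diagrams finite_subset by blast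
  have d: "stable_partition k d" "s1 \<le> card (e_pairs d)" "s2 \<le> card (z_classes d)" if d: "d \<in> fst ` I" for d
  proof -
    obtain P where "(d, P) \<in> all_diagrams k s1 s2" using d sub by force
    then show "stable_partition k d" "s1 \<le> card (e_pairs d)" "s2 \<le> card (z_classes d)"
      using class_counts[of k d P s1 s2] by (simp_all add: mem_all_diagrams_iff)
  qed
  show "finite (e_pairs d) \<and> card (e_pairs d) = s1 + (card (e_pairs d) - s1)" if "d \<in> fst ` I" for d
    using d[OF that] finite_e_pairs[OF finite_stable] by simp
  show "finite (z_classes d) \<and> card (z_classes d) = s2 + (card (z_classes d) - s2)" if "d \<in> fst ` I" for d
    using d[OF that] finite_z_classes[OF finite_stable] by simp
  show "bij_betw (\<lambda>p. (e_pairs (snd p), z_classes (snd p))) {p \<in> I. fst p = d}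
      (subsets_of_card s1 (e_pairs d) \<times> subsets_of_card s2 (z_classes d))" if dI: "d \<in> fst ` I" for d
  proof (rule bij_betwI[where g = "\<lambda>(S, T). (d, \<Union>S \<union> T)"])
    have P: "P \<subseteq> d" "\<And>C. C \<in> P \<Longrightarrow> act True ` C \<in> P" "card (e_pairs P) = s1" "card (z_classes P) = s2"
      if "(d, P) \<in> I" for P
      using subsetD[OF sub that] unfolding mem_all_diagrams_iff by simp_all
    show "(\<lambda>p. (e_pairs (snd p), z_classes (snd p))) \<in> {p \<in> I. fst p = d} \<rightarrow>
        subsets_of_card s1 (e_pairs d) \<times> subsets_of_card s2 (z_classes d)"
    proof
      fix p assume "p \<in> {p \<in> I. fst p = d}"
      then obtain P where p: "p = (d, P)" "(d, P) \<in> I" by (cases p) auto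
      show "(e_pairs (snd p), z_classes (snd p)) \<in> subsets_of_card s1 (e_pairs d) \<times> subsets_of_card s2 (z_classes d)"
        using P[OF p(2)] e_pairs_mono[of P d] z_classes_mono[of P d] by (simp add: p(1) subsets_of_card_def)
    qed
    have comp: "(d, \<Union>S \<union> T) \<in> I \<and> e_pairs (\<Union>S \<union> T) = S \<and> z_classes (\<Union>S \<union> T) = T"
      if "S \<in> subsets_of_card s1 (e_pairs d)" "T \<in> subsets_of_card s2 (z_classes d)" for S T
    proof -
      have ST: "S \<subseteq> e_pairs d" "T \<subseteq> z_classes d" "card S = s1" "card T = s2"
        using that by (simp_all add: subsets_of_card_def)
      note c = compose_blocks[OF d(1)[OF dI] ST(1,2)]
      have "(d, \<Union>S \<union> T) \<in> all_diagrams k s1 s2"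
        unfolding mem_all_diagrams_iff c(3,4) using c(1,2) d(1)[OF dI] ST(3,4) by blast
      moreover obtain P where "(d, P) \<in> I" using dI by force
      ultimately show ?thesis using sat c(3,4) by blast
    qed
    show "(\<lambda>(S, T). (d, \<Union>S \<union> T)) \<in> subsets_of_card s1 (e_pairs d) \<times> subsets_of_card s2 (z_classes d) \<rightarrow> {p \<in> I. fst p = d}"
      using comp by auto
    show "(\<lambda>(S, T). (d, \<Union>S \<union> T)) (e_pairs (snd p), z_classes (snd p)) = p" if p: "p \<in> {p \<in> I. fst p = d}" for p
    proof -
      obtain P where "p = (d, P)" "(d, P) \<in> I" using p by (cases p) auto
      then show ?thesis using blocks_decompose[OF P(2)] by simp
    qed
    show "(\<lambda>p. (e_pairs (snd p), z_classes (snd p))) ((\<lambda>(S, T). (d, \<Union>S \<union> T)) y) = y"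
      if y: "y \<in> subsets_of_card s1 (e_pairs d) \<times> subsets_of_card s2 (z_classes d)" for y
    proof -
      obtain S T where "y = (S, T)" by (cases y)
      then show ?thesis using comp[of S T] y by simp
    qed
  qed
qed (simp add: reduced_entry_def)

section \<open>Eigenvalue sets for the two algebras\<close>

lemma has_eigenvalue_set_all:
  "has_eigenvalue_set (all_diagrams k s1 s2) (reduced_entry s1 s2)
    (\<Union>{products (eigenvalue_list X_e s1 r1) (eigenvalue_list X_z s2 r2) |r1 r2.
       r1 \<le> k - s1 - s2 \<and> r2 \<le> k - s1 - s2 \<and> diagrams k s1 s2 r1 r2 \<noteq> {}})"
proof -
  let ?pr = "\<lambda>r1 r2. products (eigenvalue_list X_e s1 r1) (eigenvalue_list X_z s2 r2)"
  have "(\<lambda>d. ?pr (card (e_pairs d) - s1) (card (z_classes d) - s2)) ` fst ` all_diagrams k s1 s2 =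
      {?pr r1 r2 |r1 r2. r1 \<le> k - s1 - s2 \<and> r2 \<le> k - s1 - s2 \<and> diagrams k s1 s2 r1 r2 \<noteq> {}}" (is "?L = ?R")
  proof (intro equalityI subsetI)
    fix E assume "E \<in> ?L"
    then obtain d P where dP: "(d, P) \<in> all_diagrams k s1 s2"
      and E: "E = ?pr (card (e_pairs d) - s1) (card (z_classes d) - s2)" by force
    obtain r1 r2 where r: "r1 \<le> k - s1 - s2" "r2 \<le> k - s1 - s2" "(d, P) \<in> diagrams k s1 s2 r1 r2"
      using dP unfolding all_diagrams_def by blast
    then have "card (e_pairs d) - s1 = r1" "card (z_classes d) - s2 = r2" by (simp_all add: mem_diagrams_iff)
    then show "E \<in> ?R" using r E by blast
  next
    fix E assume "E \<in> ?R"
    then obtain r1 r2 where r: "r1 \<le> k - s1 - s2" "r2 \<le> k - s1 - s2" "diagrams k s1 s2 r1 r2 \<noteq> {}" "E = ?pr r1 r2" by blast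
    then obtain d P where dP: "(d, P) \<in> diagrams k s1 s2 r1 r2" by force
    then have "(d, P) \<in> all_diagrams k s1 s2" using r unfolding all_diagrams_def by blast
    moreover have "E = ?pr (card (e_pairs d) - s1) (card (z_classes d) - s2)"
      using dP r(4) by (simp add: mem_diagrams_iff)
    ultimately show "E \<in> ?L" by force
  qed
  then show ?thesis using reduced_has_eigenvalue_set[of "all_diagrams k s1 s2" k s1 s2] by simp
qed

lemma has_eigenvalue_set_diagrams:
  assumes "diagrams k s1 s2 r1 r2 \<noteq> {}" "r1 \<le> k - s1 - s2" "r2 \<le> k - s1 - s2"
  shows "has_eigenvalue_set (diagrams k s1 s2 r1 r2) (reduced_entry s1 s2)
    (products (eigenvalue_list X_e s1 r1) (eigenvalue_list X_z s2 r2))"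
proof -
  let ?pr = "\<lambda>r1 r2. products (eigenvalue_list X_e s1 r1) (eigenvalue_list X_z s2 r2)"
  have "has_eigenvalue_set (diagrams k s1 s2 r1 r2) (reduced_entry s1 s2)
    (\<Union>d\<in>fst ` diagrams k s1 s2 r1 r2. ?pr (card (e_pairs d) - s1) (card (z_classes d) - s2))"
  proof (rule reduced_has_eigenvalue_set[of _ k])
    show "diagrams k s1 s2 r1 r2 \<subseteq> all_diagrams k s1 s2" using assms(2,3) unfolding all_diagrams_def by blast
    show "\<And>d P P'. (d, P) \<in> diagrams k s1 s2 r1 r2 \<Longrightarrow> (d, P') \<in> all_diagrams k s1 s2 \<Longrightarrow> (d, P') \<in> diagrams k s1 s2 r1 r2"
      by (simp add: mem_diagrams_iff mem_all_diagrams_iff)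
  qed
  moreover have "card (e_pairs d) - s1 = r1 \<and> card (z_classes d) - s2 = r2" if "d \<in> fst ` diagrams k s1 s2 r1 r2" for d
    using that by (auto simp: diagrams_def)
  then have "(\<Union>d\<in>fst ` diagrams k s1 s2 r1 r2. ?pr (card (e_pairs d) - s1) (card (z_classes d) - s2)) = ?pr r1 r2"
    using assms(1) by simp
  ultimately show ?thesis by simp
qed

text \<open>By \<open>card_classes_le\<close> the sum s1 + s2 + r1 + r2 + H_e is at most k. For r1 >
  0 this is the signed condition at once, since H_z = r2; for r1 = 0 there are no horizontal pairs,
  so H_e = 0 and the bound on r2 suffices.\<close>

lemma signed_diagrams_eq:
  assumes "s1 + s2 + 1 \<le> k" "r2 < k - s1 - s2"
  shows "signed_diagrams k s1 s2 r1 r2 = diagrams k s1 s2 r1 r2"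
proof -
  have "s1 + s2 + H_e p + H_z p + 1 \<le> k" if p: "p \<in> diagrams k s1 s2 r1 r2" for p
  proof -
    obtain d P where dP: "p = (d, P)" by (cases p)
    have a: "stable_partition k d" "card (e_pairs d) = s1 + r1" "card (z_classes d) = s2 + r2" "P \<subseteq> d"
      "\<And>C. C \<in> P \<Longrightarrow> act True ` C \<in> P" "card (e_pairs P) = s1" "card (z_classes P) = s2"
      using p by (auto simp: dP mem_diagrams_iff)
    note fin = finite_e_pairs[OF finite_stable[OF a(1)]] finite_z_classes[OF finite_stable[OF a(1)]]
    have "H_z p = card (z_classes d - z_classes P)" by (simp add: H_z_def dP z_classes_diff)
    also have "\<dots> = r2"
      using card_Diff_subset[OF finite_subset[OF z_classes_mono[OF a(4)] fin(2)] z_classes_mono[OF a(4)]] a by simp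
    finally have hz: "H_z p = r2" .
    have ed: "e_pairs (d - P) = e_pairs d - e_pairs P" using e_pairs_diff[of P d, OF a(5)] by simp
    have "card (e_pairs (d - P)) = r1"
      unfolding ed using card_Diff_subset[OF finite_subset[OF e_pairs_mono[OF a(4)] fin(1)] e_pairs_mono[OF a(4)]] a by simp
    moreover have "finite (e_pairs (d - P))" unfolding ed using fin(1) by simp
    ultimately have he: "H_e p \<le> r1"
      unfolding H_e_def dP fst_conv snd_conv by (metis (no_types, lifting) card_mono mem_Collect_eq subsetI)
    have "s1 + r1 + (s2 + r2) + H_e p \<le> k" using card_classes_le[OF a(1,4)] a(2,3) dP by simp
    then show ?thesis using hz he assms by linarith
  qed
  then show ?thesis by (auto simp: signed_diagrams_def)
qed

theorem theorem4p2:
  fixes k s1 s2 :: nat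
  defines "K \<equiv> k - s1 - s2"
  shows
    "(s1 + s2 \<le> k \<longrightarrow>
        (\<forall>ix. enumerates ix (all_diagrams k s1 s2) \<longrightarrow>
           (\<exists>U \<in> carrier_mat (length ix) (length ix). det U = 1 \<and>
              transpose_mat U * matrix_of ix (gram_entry s1 s2) * U
                = matrix_of ix (reduced_entry s1 s2))) \<and>
        has_eigenvalue_set (all_diagrams k s1 s2) (reduced_entry s1 s2)
          (\<Union>{products (eigenvalue_list X_e s1 r1) (eigenvalue_list X_z s2 r2) |r1 r2.
             r1 \<le> K \<and> r2 \<le> K \<and> diagrams k s1 s2 r1 r2 \<noteq> {}}) \<and>
        (\<forall>r1 \<le> K. has_eigenvalue_set (subsets_of_card s1 {..<s1 + r1}) (factor_entry X_e s1 r1)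
           (eigenvalue_list X_e s1 r1)) \<and>
        (\<forall>r2 \<le> K. has_eigenvalue_set (subsets_of_card s2 {..<s2 + r2}) (factor_entry X_z s2 r2)
           (eigenvalue_list X_z s2 r2)))
   \<and> (s1 + s2 + 1 \<le> k \<longrightarrow>
        (\<forall>ix. enumerates ix (all_signed_diagrams k s1 s2) \<longrightarrow>
           (\<exists>U \<in> carrier_mat (length ix) (length ix). det U = 1 \<and>
              (\<forall>a < length ix. \<forall>b < length ix.
                 (\<exists>r1 r2. r1 + r2 < K \<and> ix ! a \<in> signed_diagrams k s1 s2 r1 r2) \<longrightarrow>
                 (transpose_mat U * matrix_of ix (gram_entry s1 s2) * U) $$ (a, b)
                   = reduced_entry s1 s2 (ix ! a) (ix ! b)))) \<and>
        (\<forall>r1 r2. 2 * r1 + r2 \<le> 2 * K - 1 \<and> r1 \<le> K - 1 \<and> r2 \<le> K - 1 \<and>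
             signed_diagrams k s1 s2 r1 r2 \<noteq> {} \<longrightarrow>
           has_eigenvalue_set (signed_diagrams k s1 s2 r1 r2) (reduced_entry s1 s2)
             (products (eigenvalue_list X_e s1 r1) (eigenvalue_list X_z s2 r2))) \<and>
        (\<forall>r1 \<le> K. has_eigenvalue_set (subsets_of_card s1 {..<s1 + r1}) (factor_entry X_e s1 r1)
           (eigenvalue_list X_e s1 r1)) \<and>
        (\<forall>r2 \<le> K - 1. has_eigenvalue_set (subsets_of_card s2 {..<s2 + r2}) (factor_entry X_z s2 r2)
           (eigenvalue_list X_z s2 r2)))"
proof (intro conjI impI allI)
  let ?J = "all_diagrams k s1 s2"
  fix ix assume ix: "enumerates ix ?J"
  \<comment> \<open>Here \<open>L\<close>, \<open>I\<close> and \<open>J\<close> of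
    \<open>zeta_congruence\<close> are all equal to the full set of diagrams, so the whole matrix is
    transformed.\<close>
  have "\<exists>U \<in> carrier_mat (length ix) (length ix). det U = 1 \<and>
    (\<forall>a < length ix. \<forall>b < length ix. ix ! a \<in> ?J \<longrightarrow>
      (transpose_mat U * matrix_of ix (gram_entry s1 s2) * U) $$ (a, b) = reduced_entry s1 s2 (ix ! a) (ix ! b))"
    by (rule zeta_congruence[OF ix finite_all_diagrams subset_refl subset_refl, where below = below and rank = "\<lambda>p. card (fst p)"])
      (use below_refl below_rank gram_entry_expand in \<open>blast+\<close>)
  then obtain U where U: "U \<in> carrier_mat (length ix) (length ix)" "det U = 1"
    and e: "\<And>a b. a < length ix \<Longrightarrow> b < length ix \<Longrightarrow> ix ! a \<in> ?J \<Longrightarrow>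
      (transpose_mat U * matrix_of ix (gram_entry s1 s2) * U) $$ (a, b) = reduced_entry s1 s2 (ix ! a) (ix ! b)"
    by blast
  have "ix ! a \<in> ?J" if "a < length ix" for a using ix that nth_mem by (auto simp: enumerates_def)
  then have "transpose_mat U * matrix_of ix (gram_entry s1 s2) * U = matrix_of ix (reduced_entry s1 s2)"
    using U(1) e by (intro eq_matI) (auto simp: matrix_of_def)
  then show "\<exists>U \<in> carrier_mat (length ix) (length ix). det U = 1 \<and>
      transpose_mat U * matrix_of ix (gram_entry s1 s2) * U = matrix_of ix (reduced_entry s1 s2)"
    using U by blast
next
  show "has_eigenvalue_set (all_diagrams k s1 s2) (reduced_entry s1 s2)
      (\<Union>{products (eigenvalue_list X_e s1 r1) (eigenvalue_list X_z s2 r2) |r1 r2.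
        r1 \<le> K \<and> r2 \<le> K \<and> diagrams k s1 s2 r1 r2 \<noteq> {}})"
    unfolding K_def by (rule has_eigenvalue_set_all)
next
  let ?J = "all_diagrams k s1 s2" and ?I = "all_signed_diagrams k s1 s2"
  \<comment> \<open>Fewer than k classes, which for given class counts means r1 + r2 < K. This set
    is closed upwards and lies in \<open>?I\<close>: what \<open>?I\<close> lacks are the diagrams
    with r2 = K, and those have k classes.\<close>
  let ?L = "{p \<in> ?J. card (e_pairs (fst p)) + card (z_classes (fst p)) < k}"
  assume k: "s1 + s2 + 1 \<le> k"
  fix ix assume ix: "enumerates ix ?I"
  have IJ: "?I \<subseteq> ?J"
  proof
    fix p assume "p \<in> ?I"
    then obtain r1 r2 where "r1 \<le> k - s1 - s2" "r2 < k - s1 - s2" "p \<in> diagrams k s1 s2 r1 r2"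
      unfolding all_signed_diagrams_def signed_diagrams_def by blast
    then show "p \<in> ?J" unfolding all_diagrams_def by (meson UN_I atMost_iff less_imp_le)
  qed
  have LI: "?L \<subseteq> ?I"
  proof
    fix p assume p: "p \<in> ?L"
    obtain d P where dP: "p = (d, P)" by (cases p)
    obtain r1 r2 where r: "r1 \<le> k - s1 - s2" "(d, P) \<in> diagrams k s1 s2 r1 r2"
      using p unfolding dP all_diagrams_def by blast
    then have "s1 + r1 + (s2 + r2) < k" using p by (simp add: dP mem_diagrams_iff)
    then have "r2 < k - s1 - s2" by linarith
    then show "p \<in> ?I"
      using r signed_diagrams_eq[OF k, of r2 r1] unfolding dP all_signed_diagrams_def by blast
  qed
  have up: "q \<in> ?L" if p: "p \<in> ?L" and q: "q \<in> ?J" and b: "below p q" for p q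
  proof -
    obtain d P D Q where dP: "p = (d, P)" "q = (D, Q)" by (cases p, cases q)
    have "card (e_pairs D) + card (z_classes D) \<le> card (e_pairs d) + card (z_classes d)"
      by (rule card_underlying_mono[of k]) (use p q b in \<open>simp_all add: dP mem_all_diagrams_iff below_def\<close>)
    then show ?thesis using p q by (simp add: dP)
  qed
  have R0: "reduced_entry s1 s2 p q = 0" if "p \<in> ?J" "q \<in> ?J" "p \<in> ?L \<longleftrightarrow> q \<notin> ?L" for p q
  proof -
    have "fst p \<noteq> fst q" using that by auto
    then show ?thesis by (simp add: reduced_entry_def)
  qed
  have "\<exists>U \<in> carrier_mat (length ix) (length ix). det U = 1 \<and>
    (\<forall>a < length ix. \<forall>b < length ix. ix ! a \<in> ?L \<longrightarrow>
      (transpose_mat U * matrix_of ix (gram_entry s1 s2) * U) $$ (a, b) = reduced_entry s1 s2 (ix ! a) (ix ! b))"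
  proof (rule zeta_congruence[OF ix finite_all_diagrams LI IJ, where below = below and rank = "\<lambda>p. card (fst p)"])
    show "\<And>p. p \<in> ?J \<Longrightarrow> below p p" by (rule below_refl)
    show "\<And>p q. p \<in> ?I \<Longrightarrow> q \<in> ?I \<Longrightarrow> below p q \<Longrightarrow> p = q \<or> card (fst q) < card (fst p)"
      using below_rank IJ by blast
    show "\<And>p q. p \<in> ?I \<Longrightarrow> q \<in> ?I \<Longrightarrow> gram_entry s1 s2 p q =
      (\<Sum>p' | p' \<in> ?J \<and> below p p'. \<Sum>q' | q' \<in> ?J \<and> below q q'. reduced_entry s1 s2 p' q')"
      using gram_entry_expand IJ by blast
  qed (use up R0 in blast)+
  moreover have "p \<in> ?L" if "r1 + r2 < K" "p \<in> signed_diagrams k s1 s2 r1 r2" for p r1 r2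
  proof -
    obtain d P where dP: "p = (d, P)" by (cases p)
    have "(d, P) \<in> diagrams k s1 s2 r1 r2" using that(2) by (simp add: dP signed_diagrams_def)
    then show ?thesis using that(1) k by (simp add: dP mem_diagrams_iff mem_all_diagrams_iff K_def)
  qed
  ultimately show "\<exists>U \<in> carrier_mat (length ix) (length ix). det U = 1 \<and>
      (\<forall>a < length ix. \<forall>b < length ix.
         (\<exists>r1 r2. r1 + r2 < K \<and> ix ! a \<in> signed_diagrams k s1 s2 r1 r2) \<longrightarrow>
         (transpose_mat U * matrix_of ix (gram_entry s1 s2) * U) $$ (a, b) = reduced_entry s1 s2 (ix ! a) (ix ! b))"
    by blast
next
  fix r1 r2
  assume k: "s1 + s2 + 1 \<le> k" and r: "2 * r1 + r2 \<le> 2 * K - 1 \<and> r1 \<le> K - 1 \<and> r2 \<le> K - 1 \<and>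
    signed_diagrams k s1 s2 r1 r2 \<noteq> {}"
  \<comment> \<open>\<open>K\<close> is positive here, so the truncated bound \<open>K - 1\<close>
    is strict below \<open>K\<close>.\<close>
  have "r2 < k - s1 - s2" "r1 \<le> k - s1 - s2" using k r by (auto simp: K_def)
  then show "has_eigenvalue_set (signed_diagrams k s1 s2 r1 r2) (reduced_entry s1 s2)
      (products (eigenvalue_list X_e s1 r1) (eigenvalue_list X_z s2 r2))"
    using r signed_diagrams_eq[OF k, of r2 r1] has_eigenvalue_set_diagrams[of k s1 s2 r1 r2] by simp
\<comment> \<open>The remaining goals are the spectra of single tensor factors, on the model set of
  the first s + r natural numbers.\<close>
qed (rule factor_has_eigenvalue_set; simp)+

end
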